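(* For any time window size $\lambda$, a minimum-size TWC target set for the ring $R^n$ (nodes $\{0,\dots,n-1\}$, edges $(i,(i+1)\bmod n)$, with any threshold function $t$ satisfying $1\le t(v)\le 2$) can be computed in time $O(n)$.
   Context: For a graph $G=(V,E)$ with thresholds $t:V\to\{1,2,\dots\}$, $1\le t(v)\le\deg(v)$, a time window size $\lambda\in\{1,2,\dots\}$ and $S\subseteq V$, define $\mathrm{Inf}[S,0]=S$, $\mathrm{Act}[S,0]=\emptyset$, and for $r\ge1$: $\mathrm{Act}[S,r]=\mathrm{Inf}[S,r-1]$ if $r\le\lambda$, $\mathrm{Act}[S,r]=\mathrm{Inf}[S,r-1]\setminus\mathrm{Inf}[S,r-1-\lambda]$ if $r>\lambda$, and $\mathrm{Inf}[S,r]=\mathrm{Inf}[S,r-1]\cup\{v: |N(v)\cap \mathrm{Act}[S,r]|\ge t(v)\}$, where $N(v)$ is the neighborhood of $v$. $S$ is a TWC target set if $\mathrm{Inf}[S,r]=V$ for some $r\ge0$. *)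

theory Defs
  imports Complex_Main "HOL-Library.Landau_Symbols"
begin

section \<open>Influence diffusion with a time window\<close>

definition nbhd :: "'a set set \<Rightarrow> 'a \<Rightarrow> 'a set" where
  "nbhd E v = {u. {u, v} \<in> E}"

text \<open>
  \<open>influenced\<close> and \<open>active\<close> are \<open>Inf[S,r]\<close> and \<open>Act[S,r]\<close>; a node influenced in
  round \<open>r\<close> is active exactly in the rounds \<open>r + 1, \<dots>, r + lam\<close>.
\<close>
function
  influenced :: "'a set \<Rightarrow> 'a set set \<Rightarrow> ('a \<Rightarrow> nat) \<Rightarrow> nat \<Rightarrow> 'a set \<Rightarrow> nat \<Rightarrow> 'a set" and
  active :: "'a set \<Rightarrow> 'a set set \<Rightarrow> ('a \<Rightarrow> nat) \<Rightarrow> nat \<Rightarrow> 'a set \<Rightarrow> nat \<Rightarrow> 'a set"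
where
  "influenced V E t lam S 0 = S"
| "influenced V E t lam S (Suc r) =
     influenced V E t lam S r \<union>
     {v \<in> V. card (nbhd E v \<inter> active V E t lam S (Suc r)) \<ge> t v}"
| "active V E t lam S 0 = {}"
| "active V E t lam S (Suc r) =
     (if Suc r \<le> lam then influenced V E t lam S r
      else influenced V E t lam S r - influenced V E t lam S (Suc r - 1 - lam))"
  by pat_completeness auto
termination
  by (relation "measure (case_sum (\<lambda>(V, E, t, lam, S, r). 2 * r + 1) (\<lambda>(V, E, t, lam, S, r). 2 * r))")
     auto

definition twc_target_set ::
  "'a set \<Rightarrow> 'a set set \<Rightarrow> ('a \<Rightarrow> nat) \<Rightarrow> nat \<Rightarrow> 'a set \<Rightarrow> bool" where
  "twc_target_set V E t lam S \<longleftrightarrow> S \<subseteq> V \<and> (\<exists>r. influenced V E t lam S r = V)"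

definition min_twc_target_set ::
  "'a set \<Rightarrow> 'a set set \<Rightarrow> ('a \<Rightarrow> nat) \<Rightarrow> nat \<Rightarrow> 'a set \<Rightarrow> bool" where
  "min_twc_target_set V E t lam S \<longleftrightarrow>
     twc_target_set V E t lam S \<and> (\<forall>S'. twc_target_set V E t lam S' \<longrightarrow> card S \<le> card S')"

definition ring_nodes :: "nat \<Rightarrow> nat set" where
  "ring_nodes n = {0..<n}"

definition ring_edges :: "nat \<Rightarrow> nat set set" where
  "ring_edges n = {{i, (i + 1) mod n} | i. i < n}"


section \<open>Random access machine with uniform cost\<close>

text \<open>
  The model of computation is a random access machine in the style of Cook and Reckhow: integer
  contents, addition and subtraction as the only arithmetic, indirect addressing, unit cost per
  instruction. Control flow is structured (conditionals and loops on the sign of a register)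
  instead of using jumps; such a program translates to one with jumps, and conversely, with
  constant-factor overhead. A program is a finite object and so refers to finitely many registers,
  while the memory, reached only through addresses held in registers, is unbounded.
\<close>

datatype com =
    Const nat int
  | Add nat nat nat
  | Sub nat nat nat
  | Load nat nat
  | Store nat nat
  | Seq com com
  | IfPos nat com com
  | WhilePos nat com

type_synonym state = "(nat \<Rightarrow> int) \<times> (nat \<Rightarrow> int)"  \<comment> \<open>registers, memory\<close>

text \<open>
  \<open>exec P s k s'\<close>: started in \<open>s\<close>, the program \<open>P\<close> halts in \<open>s'\<close> after exactly \<open>k\<close> steps.
  Every elementary instruction and every evaluation of a guard counts as one step. An access to a
  negative address has no successor state, so such a run does not halt.
\<close>
inductive exec :: "com \<Rightarrow> state \<Rightarrow> nat \<Rightarrow> state \<Rightarrow> bool" where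
  Const: "exec (Const i c) (R, M) 1 (R(i := c), M)"
| Add: "exec (Add i j k) (R, M) 1 (R(i := R j + R k), M)"
| Sub: "exec (Sub i j k) (R, M) 1 (R(i := R j - R k), M)"
| Load: "0 \<le> R j \<Longrightarrow> exec (Load i j) (R, M) 1 (R(i := M (nat (R j))), M)"
| Store: "0 \<le> R i \<Longrightarrow> exec (Store i j) (R, M) 1 (R, M(nat (R i) := R j))"
| Seq: "exec c1 s k1 s1 \<Longrightarrow> exec c2 s1 k2 s2 \<Longrightarrow> exec (Seq c1 c2) s (k1 + k2) s2"
| IfTrue: "R i > 0 \<Longrightarrow> exec c1 (R, M) k s' \<Longrightarrow> exec (IfPos i c1 c2) (R, M) (k + 1) s'"
| IfFalse: "\<not> R i > 0 \<Longrightarrow> exec c2 (R, M) k s' \<Longrightarrow> exec (IfPos i c1 c2) (R, M) (k + 1) s'"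
| WhileFalse: "\<not> R i > 0 \<Longrightarrow> exec (WhilePos i c) (R, M) 1 (R, M)"
| WhileTrue: "R i > 0 \<Longrightarrow> exec c (R, M) k1 s1 \<Longrightarrow> exec (WhilePos i c) s1 k2 s2 \<Longrightarrow>
    exec (WhilePos i c) (R, M) (k1 + k2 + 1) s2"

text \<open>
  Input: \<open>n\<close> in register 0, the window size in register 1, the thresholds in memory cells
  \<open>0, \<dots>, n - 1\<close>; all else is zero. Output: the characteristic vector of the computed set
  in memory cells \<open>0, \<dots>, n - 1\<close>.
\<close>
definition input_state :: "nat \<Rightarrow> nat \<Rightarrow> (nat \<Rightarrow> nat) \<Rightarrow> state" where
  "input_state n lam t =
     ((\<lambda>_. 0)(0 := int n, 1 := int lam), \<lambda>v. if v < n then int (t v) else 0)"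

definition outputs :: "nat \<Rightarrow> state \<Rightarrow> nat set \<Rightarrow> bool" where
  "outputs n s S \<longleftrightarrow> S \<subseteq> ring_nodes n \<and> (\<forall>v<n. snd s v = (if v \<in> S then 1 else 0))"

end

theory Submission imports Defs
begin

text \<open>
  Unroll the ring into the line of natural numbers, with node \<open>x mod n\<close> at position \<open>x\<close>. A
  nonempty set is a target set iff between two consecutive elements \<open>p < q\<close> there is at most one node
  of threshold 2, and if there is one, at \<open>x\<close>, the influence arrives at it from both sides less than
  \<open>lam\<close> rounds apart: \<open>\<bar>(x - p) - (q - x)\<bar> < lam\<close>.

  Compared with taking all nodes of threshold 2, a set saves one node for every \<^emph>\<open>block\<close>: a chain of
  steps from a selected threshold-2 node \<open>i\<close> to a selected threshold-2 node \<open>j\<close>, each skipping exactly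
  one threshold-2 node, with only threshold-1 nodes selected strictly between \<open>i\<close> and \<open>j\<close>. So the task
  is to pack as many blocks as possible into one lap. Greedily taking the block with the earliest end
  does this, provided one starts at the right place: any point on a cycle of the greedy successor map
  (mod \<open>n\<close>) works, because the density of the greedy blocks along the cycle bounds the savings of
  every target set. Following the successor map for \<open>n\<close> steps reaches such a point.

  To tabulate the successor map in linear time, scan the line backwards and store for every position
  the earliest end of a chain through it. The admissible next positions form a window in the segment
  beyond the skipped node; the earliest ends are quasi-concave along a segment, so the minimum over a
  window is attained at its first or its last position from which a chain continues. Both of these are
  found through links between neighbouring such positions.
\<close>

section \<open>Target sets of the ring\<close>

text \<open>A node of threshold 2 needs both neighbours influenced before it, so two such nodes
  inside one gap would each wait for a side that only the other can open. The savings are a balance: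
  every passed threshold-2 node is credited, every selected node costs one. Entering or continuing a
  chain is then neutral, and only its arrival at a threshold-2 node gains one. The obstacle is the
  closed ring: taking the earliest end is optimal on a line, but on a ring it may lose a block where
  the lap closes. Comparing densities avoids this. A target set, repeated lap after lap, is matched
  by the greedy blocks from any start up to an additive constant; along a cycle of the successor map
  the greedy blocks are themselves periodic, so a shortfall in one lap would accumulate beyond every
  constant. Only monotonicity and invariance under shifts by \<open>n\<close> enter. If nothing can
  be saved, any start will do, because the walk never selects more nodes than \<open>tw\<close> has
  in a lap.\<close>

text \<open>\<open>w\<close> stands for \<open>lam - 1\<close>, and \<open>tw\<close> for having threshold 2.\<close>
definition gap_ok :: "(nat \<Rightarrow> bool) \<Rightarrow> nat \<Rightarrow> nat \<Rightarrow> nat \<Rightarrow> bool" where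
  "gap_ok tw w p q \<longleftrightarrow> (\<forall>y. p < y \<and> y < q \<longrightarrow> \<not> tw y) \<or>
     (\<exists>x. p < x \<and> x < q \<and> tw x \<and> (\<forall>y. p < y \<and> y < q \<and> tw y \<longrightarrow> y = x) \<and>
          2 * x \<le> p + q + w \<and> p + q \<le> 2 * x + w)"

definition lift_set :: "nat \<Rightarrow> nat set \<Rightarrow> nat set" where
  "lift_set n S = {x. x mod n \<in> S}"

lemma nbhd_ring:
  assumes "n \<ge> 3" "v < n"
  shows "nbhd (ring_edges n) v = {(v + 1) mod n, (v + n - 1) mod n}"
proof -
  have pred: "(i + 1) mod n = v \<longleftrightarrow> i = (v + n - 1) mod n" if "i < n" for i
  proof (cases "Suc i = n")
    case True
    then show ?thesis using assms by (cases v) (auto simp: mod_if)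
  next
    case False
    then show ?thesis using assms that by (cases v) (auto simp: mod_if)
  qed
  have "{u, v} \<in> ring_edges n \<longleftrightarrow> u = (v + 1) mod n \<or> u = (v + n - 1) mod n" for u
  proof -
    have "{u, v} \<in> ring_edges n \<longleftrightarrow> (\<exists>i<n. u = i \<and> v = (i + 1) mod n \<or> v = i \<and> u = (i + 1) mod n)"
      unfolding ring_edges_def by (auto simp: doubleton_eq_iff)
    also have "\<dots> \<longleftrightarrow> u < n \<and> v = (u + 1) mod n \<or> u = (v + 1) mod n"
      using assms by auto
    also have "\<dots> \<longleftrightarrow> u = (v + 1) mod n \<or> u = (v + n - 1) mod n"
      using pred[of u] assms by (metis mod_less_divisor less_le_trans zero_less_numeral)
    finally show ?thesis .
  qed
  then show ?thesis by (auto simp: nbhd_def)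
qed

section \<open>Influence times on the unrolled ring\<close>

locale ring_spread =
  fixes n lam :: nat and t :: "nat \<Rightarrow> nat" and S :: "nat set"
  assumes n3: "n \<ge> 3" and lam1: "lam \<ge> 1"
    and t12: "\<And>v. v < n \<Longrightarrow> t v = 1 \<or> t v = 2" and S: "S \<subseteq> ring_nodes n"
begin

definition infl :: "nat \<Rightarrow> nat \<Rightarrow> bool" where
  "infl x r \<longleftrightarrow> x mod n \<in> influenced (ring_nodes n) (ring_edges n) t lam S r"

definition two :: "nat \<Rightarrow> bool" where
  "two x \<longleftrightarrow> t (x mod n) = 2"

text \<open>Being active in round \<open>r + 1\<close>.\<close>
definition act :: "nat \<Rightarrow> nat \<Rightarrow> bool" where
  "act x r \<longleftrightarrow> infl x r \<and> \<not> (lam \<le> r \<and> infl x (r - lam))"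

lemma infl_0: "infl x 0 \<longleftrightarrow> x \<in> lift_set n S"
  by (simp add: infl_def lift_set_def)

text \<open>Stated for \<open>Suc y\<close> so that the left neighbour \<open>y\<close> exists on
  the line; every node has a positive copy. As \<open>n \<ge> 3\<close>, the neighbours
  \<open>y\<close> and \<open>y + 2\<close> differ modulo \<open>n\<close>, and the cardinality
  splits into two indicators.\<close>

lemma infl_Suc:
  "infl (Suc y) (Suc r) \<longleftrightarrow> infl (Suc y) r \<or>
     (if two (Suc y) then act y r \<and> act (y + 2) r else act y r \<or> act (y + 2) r)"
proof -
  define v where "v = Suc y mod n"
  define A where "A = active (ring_nodes n) (ring_edges n) t lam S (Suc r)"
  have v: "v < n" using n3 by (simp add: v_def)
  have r1: "(v + 1) mod n = (y + 2) mod n" by (simp add: v_def mod_simps)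
  have r2: "(v + n - 1) mod n = y mod n"
  proof -
    have "(v + n - 1) mod n = (v + (n - 1)) mod n" using n3 by simp
    also have "\<dots> = (Suc y + (n - 1)) mod n" by (simp only: v_def mod_add_left_eq)
    also have "Suc y + (n - 1) = y + n" using n3 by simp
    finally show ?thesis by simp
  qed
  have ne: "y mod n \<noteq> (y + 2) mod n"
  proof -
    have "y mod n < n" using n3 by simp
    moreover have "(y + 2) mod n = (y mod n + 2) mod n" by (simp add: mod_simps)
    moreover have "(y mod n + 2) mod n = y mod n + 2 - n" if "\<not> y mod n + 2 < n"
    proof -
      have "y mod n + 2 - n < n" "n \<le> y mod n + 2" using that n3 \<open>y mod n < n\<close> by linarith+
      then show ?thesis by (metis le_mod_geq mod_less)
    qed
    ultimately show ?thesis using n3 by (cases "y mod n + 2 < n") auto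
  qed
  have nb: "nbhd (ring_edges n) v = {(y + 2) mod n, y mod n}"
    using nbhd_ring[OF n3 v] r1 r2 by simp
  have A: "z mod n \<in> A \<longleftrightarrow> act z r" for z
    unfolding A_def act_def infl_def by auto
  have c: "card ({(y + 2) mod n, y mod n} \<inter> A) =
      (if act y r then 1 else 0) + (if act (y + 2) r then 1 else 0)"
    using ne A[of y] A[of "y+2"] by (auto simp: Int_insert_left)
  have "infl (Suc y) (Suc r) \<longleftrightarrow> infl (Suc y) r \<or> card ({(y + 2) mod n, y mod n} \<inter> A) \<ge> t v"
    using v nb unfolding infl_def v_def[symmetric] A_def by (simp add: ring_nodes_def)
  moreover have "t v = (if two (Suc y) then 2 else 1)"
    using t12[OF v] by (auto simp: two_def v_def)
  ultimately show ?thesis unfolding c by (auto split: if_splits)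
qed

lemma infl_mono: "infl x r \<Longrightarrow> r \<le> r' \<Longrightarrow> infl x r'"
  by (induction r' rule: nat_induct) (auto simp: infl_def le_Suc_eq)

definition inf_time :: "nat \<Rightarrow> nat" where
  "inf_time x = (LEAST r. infl x r)"

lemma infl_inf_time: "infl x s \<Longrightarrow> infl x r \<longleftrightarrow> inf_time x \<le> r"
  unfolding inf_time_def by (metis LeastI Least_le infl_mono)

lemma act_inf_time: "infl x s \<Longrightarrow> act x r \<longleftrightarrow> inf_time x \<le> r \<and> r < inf_time x + lam"
  using infl_inf_time[of x s r] infl_inf_time[of x s "r - lam"] lam1 unfolding act_def by auto

text \<open>Because \<open>lam \<ge> 1\<close>, a neighbour is active in the round right after its
  own influence, so the earlier neighbour acts without delay.\<close>

lemma inf_time_one: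
  assumes all: "\<And>x. \<exists>r. infl x r" and "\<not> two (Suc y)" "inf_time (Suc y) > 0"
  shows "inf_time (Suc y) = Suc (min (inf_time y) (inf_time (y + 2)))"
proof -
  obtain r where r: "inf_time (Suc y) = Suc r" using assms(3) by (cases "inf_time (Suc y)") auto
  have I: "infl x r \<longleftrightarrow> inf_time x \<le> r" and A: "act x r \<longleftrightarrow> inf_time x \<le> r \<and> r < inf_time x + lam" for x r
    using all[of x] infl_inf_time act_inf_time by blast+
  have Suc: "inf_time (Suc y) \<le> Suc r \<longleftrightarrow> inf_time (Suc y) \<le> r \<or>
      (inf_time y \<le> r \<and> r < inf_time y + lam) \<or> (inf_time (y+2) \<le> r \<and> r < inf_time (y+2) + lam)" for r
    using infl_Suc[of y r] assms(2) unfolding I A by simp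
  have "inf_time y \<ge> r" using Suc[of "inf_time y"] r lam1 by auto
  moreover have "inf_time (y+2) \<ge> r" using Suc[of "inf_time (y+2)"] r lam1 by auto
  ultimately show ?thesis using Suc[of r] r by auto
qed

text \<open>Both neighbours must be active at once, and activity intervals of length
  \<open>lam\<close> overlap only if their starts are less than \<open>lam\<close> apart.\<close>

lemma inf_time_two:
  assumes all: "\<And>x. \<exists>r. infl x r" and "two (Suc y)" "inf_time (Suc y) > 0"
  shows "inf_time y < inf_time (Suc y) \<and> inf_time (y + 2) < inf_time (Suc y) \<and>
         inf_time y < inf_time (y + 2) + lam \<and> inf_time (y + 2) < inf_time y + lam"
proof -
  obtain r where r: "inf_time (Suc y) = Suc r" using assms(3) by (cases "inf_time (Suc y)") auto
  have I: "infl x r \<longleftrightarrow> inf_time x \<le> r" and A: "act x r \<longleftrightarrow> inf_time x \<le> r \<and> r < inf_time x + lam" for x r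
    using all[of x] infl_inf_time act_inf_time by blast+
  show ?thesis using infl_Suc[of y r] assms(2) r unfolding I A by auto
qed

text \<open>Going outwards from a threshold-2 node \<open>x\<close> of the gap, each node is earlier
  than its inner neighbour; so it has threshold 1 and got its influence from outside. The times drop
  by one per node, down to 0 at \<open>p\<close> and \<open>q\<close>. This excludes a second
  threshold-2 node and gives the exact times at the neighbours of \<open>x\<close>.\<close>

lemma gap_ok_if_spread:
  assumes all: "\<And>x. \<exists>r. infl x r"
    and pq: "p < q" "p \<in> lift_set n S" "q \<in> lift_set n S"
    and out: "\<And>y. p < y \<Longrightarrow> y < q \<Longrightarrow> y \<notin> lift_set n S"
  shows "gap_ok two (lam - 1) p q"
proof (cases "\<exists>x. p < x \<and> x < q \<and> two x")
  case False
  then show ?thesis by (auto simp: gap_ok_def)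
next
  case True
  then obtain x where x: "p < x" "x < q" "two x" by blast
  have tm0: "inf_time y = 0 \<longleftrightarrow> y \<in> lift_set n S" for y
    using all[of y] infl_inf_time[of y _ 0] infl_0[of y] by auto
  obtain x' where x': "x = Suc x'" using x by (cases x) auto
  have tx: "inf_time x' < inf_time x" "inf_time (Suc x) < inf_time x" "inf_time x' < inf_time (Suc x) + lam" "inf_time (Suc x) < inf_time x' + lam"
    using inf_time_two[OF all, of x'] x out[of x] tm0[of x] x' by auto
  have step: "\<not> two (Suc y) \<and> inf_time (Suc y) = Suc (min (inf_time y) (inf_time (y + 2)))"
    if "p < Suc y" "Suc y < q" "\<not> (inf_time y < inf_time (Suc y) \<and> inf_time (y + 2) < inf_time (Suc y))" for y
  proof -
    have pos: "inf_time (Suc y) > 0" using out[of "Suc y"] that tm0[of "Suc y"] by auto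
    then have "\<not> two (Suc y)" using inf_time_two[OF all, of y] that(3) by blast
    then show ?thesis using inf_time_one[OF all] pos by blast
  qed
  have L: "inf_time (x - Suc d) < inf_time (x - d) \<and> (d > 0 \<longrightarrow> \<not> two (x - d) \<and> inf_time (x - d) = Suc (inf_time (x - Suc d)))"
    if "d < x - p" for d
    using that
  proof (induction d)
    case 0
    then show ?case using tx x' by simp
  next
    case (Suc d)
    define y where "y = x - Suc (Suc d)"
    have e: "x - Suc d = Suc y" "x - d = y + 2" using Suc.prems by (auto simp: y_def)
    have "inf_time (Suc y) < inf_time (y + 2)" using Suc e by simp
    then have "\<not> two (Suc y) \<and> inf_time (Suc y) = Suc (inf_time y)"
      using step[of y] Suc.prems x e by (auto simp: min_def split: if_splits)
    then show ?case using e y_def by simp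
  qed
  have R: "inf_time (x + Suc d) < inf_time (x + d) \<and> (d > 0 \<longrightarrow> \<not> two (x + d) \<and> inf_time (x + d) = Suc (inf_time (x + Suc d)))"
    if "d < q - x" for d
    using that
  proof (induction d)
    case 0
    then show ?case using tx by simp
  next
    case (Suc d)
    define y where "y = x + d"
    have "inf_time (y + 1) < inf_time y" using Suc y_def by simp
    then have "\<not> two (Suc y) \<and> inf_time (Suc y) = Suc (inf_time (y + 2))"
      using step[of y] Suc.prems x y_def by (auto simp: min_def split: if_splits)
    then show ?case using y_def by simp
  qed
  \<comment> \<open>Induction on the distance to \<open>p\<close>, where the time is 0;
    \<open>d = 0\<close> is the left neighbour of \<open>x\<close>.\<close>
  have "inf_time (x - Suc d) = x - p - Suc d" if "d < x - p" for d
    using that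
  proof (induction "x - p - Suc d" arbitrary: d)
    case 0
    then have "x - Suc d = p" using x by auto
    then show ?case using tm0[of p] pq 0 by simp
  next
    case (Suc m)
    have "inf_time (x - Suc (Suc d)) = x - p - Suc (Suc d)"
      by (rule Suc.hyps(1)) (use Suc.hyps(2) Suc.prems in linarith)+
    moreover have "inf_time (x - Suc d) = Suc (inf_time (x - Suc (Suc d)))" using L[of "Suc d"] Suc by auto
    ultimately show ?case using Suc by auto
  qed
  from this[of 0] have a: "inf_time x' = x - p - 1" using x x' by simp
  have "inf_time (x + Suc d) = q - x - Suc d" if "d < q - x" for d
    using that
  proof (induction "q - x - Suc d" arbitrary: d)
    case 0
    then have "x + Suc d = q" using x by auto
    then show ?case using tm0[of q] pq 0 by simp
  next
    case (Suc m)
    have "inf_time (x + Suc (Suc d)) = q - x - Suc (Suc d)"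
      by (rule Suc.hyps(1)) (use Suc.hyps(2) Suc.prems in linarith)+
    moreover have "inf_time (x + Suc d) = Suc (inf_time (x + Suc (Suc d)))" using R[of "Suc d"] Suc by auto
    ultimately show ?case using Suc by auto
  qed
  from this[of 0] have b: "inf_time (Suc x) = q - x - 1" using x by simp
  have "y = x" if "p < y" "y < q" "two y" for y
  proof (cases y x rule: linorder_cases)
    case less
    moreover have "x - y < x - p" using less that by linarith
    ultimately show ?thesis using L[of "x - y"] that by auto
  next
    case greater
    moreover have "y - x < q - x" using greater that by linarith
    ultimately show ?thesis using R[of "y - x"] that by auto
  qed
  moreover have "2 * x \<le> p + q + (lam - 1)" "p + q \<le> 2 * x + (lam - 1)"
    using tx(3,4) x(1,2) lam1 unfolding a b by linarith+
  ultimately show ?thesis using x unfolding gap_ok_def by blast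
qed

section \<open>Sufficiency of the gap condition\<close>

lemma infl_one:
  assumes "\<not> two (Suc y)" "infl y s \<or> infl (y + 2) s"
  shows "\<exists>r. infl (Suc y) r"
proof -
  from assms(2) obtain u where u: "u = y \<or> u = y + 2" "infl u s" by auto
  have "act u (inf_time u)" using act_inf_time[OF u(2)] lam1 by auto
  then show ?thesis using infl_Suc[of y "inf_time u"] assms(1) u(1) by auto
qed

lemma spread_right:
  assumes "infl p s" "\<And>y. p < y \<Longrightarrow> y \<le> q \<Longrightarrow> \<not> two y" "p \<le> q"
  shows "\<exists>r. infl q r"
  using assms(3,2)
proof (induction q rule: dec_induct)
  case base
  show ?case using assms(1) by blast
next
  case (step m)
  then obtain r where "infl m r" by force
  then show ?case using infl_one[of m r] step.prems[of "Suc m"] step.hyps by auto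
qed

text \<open>A node \<open>x\<close> that is never influenced is a wall: influence between
  \<open>p\<close> and \<open>x\<close> can only enter at \<open>p\<close>, and it moves one
  position per round. This serves the refutation in \<open>spread_gap\<close>.\<close>

lemma infl_bound_left:
  assumes first_end: "\<And>r. \<not> infl x r" and out: "\<And>y. p < y \<Longrightarrow> y < x \<Longrightarrow> y \<notin> lift_set n S"
  shows "infl y r \<Longrightarrow> p \<le> y \<Longrightarrow> y < x \<Longrightarrow> y \<le> p + r"
proof (induction r arbitrary: y)
  case 0
  then show ?case using out[of y] infl_0[of y] by force
next
  case (Suc r)
  show ?case
  proof (cases "y = p")
    case False
    then obtain y' where y': "y = Suc y'" "p \<le> y'" using Suc.prems by (cases y) auto
    have "infl y r \<or> infl y' r \<or> infl (y' + 2) r"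
      using infl_Suc[of y' r] Suc.prems(1) y'(1) by (auto simp: act_def split: if_splits)
    moreover have "y' + 2 \<noteq> x" if "infl (y' + 2) r" using first_end that by blast
    ultimately show ?thesis using Suc.IH[of y] Suc.IH[of y'] Suc.IH[of "y'+2"] Suc.prems y' by force
  qed simp
qed

lemma infl_bound_right:
  assumes first_end: "\<And>r. \<not> infl x r" and out: "\<And>y. x < y \<Longrightarrow> y < q \<Longrightarrow> y \<notin> lift_set n S"
  shows "infl y r \<Longrightarrow> y \<le> q \<Longrightarrow> x < y \<Longrightarrow> q \<le> y + r"
proof (induction r arbitrary: y)
  case 0
  then show ?case using out[of y] infl_0[of y] by force
next
  case (Suc r)
  show ?case
  proof (cases "y = q")
    case False
    then obtain y' where y': "y = Suc y'" "x \<le> y'" "y' + 2 \<le> q" using Suc.prems by (cases y) auto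
    have "infl y r \<or> infl y' r \<or> infl (y' + 2) r"
      using infl_Suc[of y' r] Suc.prems(1) y'(1) by (auto simp: act_def split: if_splits)
    moreover have "y' \<noteq> x" if "infl y' r" using first_end that by blast
    ultimately show ?thesis using Suc.IH[of y] Suc.IH[of y'] Suc.IH[of "y'+2"] Suc.prems y' by force
  qed simp
qed

text \<open>The lower bound makes each influence time exact, so a node is still active in the very
  round in which the next one is due.\<close>

lemma upper_left:
  assumes "infl p 0" "\<And>y. p < y \<Longrightarrow> y \<le> q \<Longrightarrow> \<not> two y" "p \<le> q"
    and lower: "\<And>y r. p \<le> y \<Longrightarrow> y \<le> q \<Longrightarrow> infl y r \<Longrightarrow> y \<le> p + r"
  shows "infl q (q - p)"
  using assms(3,2,4)
proof (induction q rule: dec_induct)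
  case base
  show ?case using assms(1) by simp
next
  case (step m)
  have m: "infl m (m - p)" using step by auto
  have "inf_time m = m - p"
    using infl_inf_time[OF m] m step.prems(2)[of m "inf_time m"] step.hyps by force
  then have "act m (m - p)" using act_inf_time[OF m] lam1 by simp
  then show ?case using infl_Suc[of m "m - p"] step by (auto simp: Suc_diff_le)
qed

lemma upper_right:
  assumes "infl q 0" "\<And>y. p \<le> y \<Longrightarrow> y < q \<Longrightarrow> \<not> two y" "p \<le> q" "0 < p"
    and lower: "\<And>y r. p \<le> y \<Longrightarrow> y \<le> q \<Longrightarrow> infl y r \<Longrightarrow> q \<le> y + r"
  shows "infl p (q - p)"
  using assms(3,2,5)
proof (induction p rule: inc_induct)
  case base
  show ?case using assms(1) by simp
next
  case (step m)
  have m: "infl (Suc m) (q - Suc m)" using step by auto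
  have "inf_time (Suc m) = q - Suc m"
    using infl_inf_time[OF m] m step.prems(2)[of "Suc m" "inf_time (Suc m)"] step.hyps by force
  then have "act (Suc m) (q - Suc m)" using act_inf_time[OF m] lam1 by simp
  moreover obtain m' where "m = Suc m'" using step.hyps assms(4) by (cases m) auto
  moreover have "q - m = Suc (q - Suc m)" using step.hyps by simp
  ultimately show ?case using infl_Suc[of m' "q - Suc m"] step by auto
qed

text \<open>If the threshold-2 node were never influenced, the waves from \<open>p\<close> and
  \<open>q\<close> would reach its neighbours at exactly known times, less than \<open>lam\<close>
  apart; both would be active in the later of the two rounds and influence it.\<close>

lemma spread_gap:
  assumes g: "gap_ok two (lam - 1) p q"
    and pq: "p < q" "p \<in> lift_set n S" "q \<in> lift_set n S"
    and out: "\<And>y. p < y \<Longrightarrow> y < q \<Longrightarrow> y \<notin> lift_set n S"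
    and y: "p \<le> y" "y < q"
  shows "\<exists>r. infl y r"
proof (cases "\<exists>x. p < x \<and> x < q \<and> two x")
  case False
  then show ?thesis using spread_right[of p 0 y] infl_0[of p] pq y by auto
next
  case True
  then obtain x where x: "p < x" "x < q" "two x" "\<And>y. p < y \<Longrightarrow> y < q \<Longrightarrow> two y \<Longrightarrow> y = x"
    "2 * x \<le> p + q + (lam - 1)" "p + q \<le> 2 * x + (lam - 1)"
    using g unfolding gap_ok_def by blast
  have "\<exists>r. infl x r"
  proof (rule ccontr)
    assume "\<nexists>r. infl x r"
    then have first_end: "\<not> infl x r" for r by blast
    obtain x' where x': "x = Suc x'" using x(1) by (cases x) simp_all
    have l: "y \<le> p + r" if "p \<le> y" "y \<le> x'" "infl y r" for y r
      by (rule infl_bound_left[OF first_end _ that(3,1)]) (use that(2) x' out x(2) in auto)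
    have r: "q \<le> y + r" if "x < y" "y \<le> q" "infl y r" for y r
      by (rule infl_bound_right[OF first_end _ that(3,2,1)]) (use out x(1) in auto)
    have next_two: "\<not> two y" if "p < y" "y < q" "y \<noteq> x" for y
      using x(4) that by blast
    have i1: "infl x' (x' - p)"
    proof (rule upper_left)
      show "infl p 0" using infl_0 pq by simp
      show "\<not> two y" if "p < y" "y \<le> x'" for y using next_two[of y] that x(1,2) x' by linarith
      show "p \<le> x'" using x(1) x' by simp
    qed (rule l)
    have i2: "infl (x + 1) (q - (x + 1))"
    proof (rule upper_right)
      show "infl q 0" using infl_0 pq by simp
      show "\<not> two y" if "x + 1 \<le> y" "y < q" for y using next_two[of y] that x(1,2) by linarith
      show "x + 1 \<le> q" using x(2) by simp
    qed (use r in auto)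
    have "infl x' (inf_time x')" "infl (x + 1) (inf_time (x + 1))"
      using infl_inf_time[OF i1] infl_inf_time[OF i2] by blast+
    then have "x' \<le> p + inf_time x'" "q \<le> (x + 1) + inf_time (x + 1)"
      using l[of x'] r[of "x + 1"] x(1,2) x' by auto
    moreover have "inf_time x' \<le> x' - p" "inf_time (x + 1) \<le> q - (x + 1)"
      using infl_inf_time[OF i1] infl_inf_time[OF i2] i1 i2 by blast+
    ultimately have t1: "inf_time x' = x' - p" and t2: "inf_time (x' + 2) = q - x - 1"
      using x(1,2) x' by auto
    define r where "r = max (x' - p) (q - x - 1)"
    have d: "x' - p < q - x - 1 + lam" "q - x - 1 < x' - p + lam"
      using x(1,2,5,6) x' lam1 by linarith+
    have i2': "infl (x' + 2) (q - (x + 1))" using i2 x' by simp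
    have "act x' r" "act (x' + 2) r"
      unfolding act_inf_time[OF i1] act_inf_time[OF i2'] t1 t2 r_def using d lam1 by linarith+
    then have "infl (Suc x') (Suc r)" using infl_Suc[of x' r] by simp
    then show False using first_end x' by blast
  qed
  then obtain r where r: "infl x r" by blast
  consider "y < x" | "y = x" | "x < y" by linarith
  then show ?thesis
  proof cases
    case 1
    then have "\<not> two y'" if "p < y'" "y' \<le> y" for y'
      using x(4)[of y'] that x(2) by force
    then show ?thesis using spread_right[of p 0 y] infl_0[of p] pq(2) y(1) by blast
  next
    case 2
    then show ?thesis using r by blast
  next
    case 3
    \<comment> \<open>The rest of the gap is reached from \<open>x\<close>, whatever the time of its
      influence.\<close>
    then have "\<not> two y'" if "x < y'" "y' \<le> y" for y'
      using x(4)[of y'] that x(1) y(2) by force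
    then show ?thesis using spread_right[OF r, of y] 3 by force
  qed
qed

lemma target_iff:
  "twc_target_set (ring_nodes n) (ring_edges n) t lam S \<longleftrightarrow> S \<noteq> {} \<and>
   (\<forall>p q. p < q \<and> p \<in> lift_set n S \<and> q \<in> lift_set n S \<and>
      (\<forall>y. p < y \<and> y < q \<longrightarrow> y \<notin> lift_set n S) \<longrightarrow> gap_ok two (lam - 1) p q)"
  (is "?L \<longleftrightarrow> _ \<and> ?G")
proof
  assume ?L
  then obtain r where r: "influenced (ring_nodes n) (ring_edges n) t lam S r = ring_nodes n"
    by (auto simp: twc_target_set_def)
  have all: "infl x r" for x
    unfolding infl_def r using n3 by (simp add: ring_nodes_def)
  have "\<not> infl x r" if "S = {}" for x r
  proof (induction r arbitrary: x)
    case 0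
    show ?case unfolding infl_0 lift_set_def using that by simp
  next
    case (Suc r)
    have "\<not> infl (Suc y) (Suc r)" for y
      using infl_Suc[of y r] Suc by (auto simp: act_def split: if_splits)
    \<comment> \<open>Position 0 has no left neighbour, but its copy one lap further on has.\<close>
    from this[of "x + n - 1"] show ?case using n3 by (simp add: infl_def)
  qed
  then have "S \<noteq> {}" using all by blast
  moreover have ?G using gap_ok_if_spread all by blast
  ultimately show "S \<noteq> {} \<and> ?G" by blast
next
  assume R: "S \<noteq> {} \<and> ?G"
  then obtain s where s: "s \<in> S" "s < n" using S unfolding ring_nodes_def by fastforce
  have "\<exists>r. infl v r" if "v < n" for v
  proof -
    \<comment> \<open>One lap up, so that elements of \<open>lift_set n S\<close> lie on both
      sides.\<close>
    define x where "x = v + n"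
    define p where "p = (GREATEST p. p \<le> x \<and> p \<in> lift_set n S)"
    define q where "q = (LEAST q. x < q \<and> q \<in> lift_set n S)"
    have ex1: "s \<le> x \<and> s \<in> lift_set n S" using s by (auto simp: x_def lift_set_def)
    have ex2: "x < s + n + n \<and> s + n + n \<in> lift_set n S" using s that by (auto simp: x_def lift_set_def)
    have p: "p \<le> x" "p \<in> lift_set n S" "\<And>y. y \<le> x \<Longrightarrow> y \<in> lift_set n S \<Longrightarrow> y \<le> p"
      using GreatestI_nat[of "\<lambda>p. p \<le> x \<and> p \<in> lift_set n S", OF ex1, of x]
        Greatest_le_nat[of "\<lambda>p. p \<le> x \<and> p \<in> lift_set n S" _ x] unfolding p_def by auto
    have q: "x < q" "q \<in> lift_set n S" "\<And>y. x < y \<Longrightarrow> y \<in> lift_set n S \<Longrightarrow> q \<le> y"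
      using LeastI[of "\<lambda>q. x < q \<and> q \<in> lift_set n S", OF ex2]
        Least_le[of "\<lambda>q. x < q \<and> q \<in> lift_set n S"] unfolding q_def by auto
    have out: "y \<notin> lift_set n S" if "p < y" "y < q" for y
      using p(3)[of y] q(3)[of y] that by force
    have "gap_ok two (lam - 1) p q" using R p q out by force
    from spread_gap[OF this _ p(2) q(2) out p(1) q(1)] p(1) q(1)
    obtain r where "infl x r" by auto
    then show ?thesis using n3 by (auto simp: infl_def x_def)
  qed
  then obtain f where f: "\<And>v. v < n \<Longrightarrow> infl v (f v)" by metis
  define r where "r = Max (f ` {..<n})"
  have "infl v r" if "v < n" for v
    using infl_mono[OF f[OF that], of r] that by (auto simp: r_def)
  then have "ring_nodes n \<subseteq> influenced (ring_nodes n) (ring_edges n) t lam S r"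
    by (auto simp: infl_def ring_nodes_def)
  moreover have "influenced (ring_nodes n) (ring_edges n) t lam S r \<subseteq> ring_nodes n" for r
    using S by (induction r) auto
  ultimately show ?L using S by (auto simp: twc_target_set_def)
qed

end

section \<open>Blocks and the greedy successor\<close>

lemma Least_shift:
  fixes P :: "nat \<Rightarrow> bool"
  assumes "P j" "\<And>j. P j \<Longrightarrow> n \<le> j"
  shows "(LEAST j. P j) = (LEAST j. P (j + n)) + n"
proof (rule Least_equality)
  have "P (j - n + n)" using assms by simp
  then show "P ((LEAST j. P (j + n)) + n)" by (rule LeastI)
  show "(LEAST j. P (j + n)) + n \<le> y" if "P y" for y
    using Least_le[of "\<lambda>j. P (j + n)" "y - n"] assms(2)[OF that] that by simp
qed

lemma finite_card_between: "finite {x::nat. u < x \<and> x \<le> v \<and> Q x}"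
  by (rule finite_subset[of _ "{..v}"]) auto

text \<open>Shifting a window of length \<open>n\<close> by one replaces \<open>Suc u\<close> by its
  copy \<open>Suc u + n\<close>, so all windows of one period count alike.\<close>

lemma card_periodic:
  assumes per: "\<And>x. Q (x + n) \<longleftrightarrow> Q x"
  shows "card {x. u < x \<and> x \<le> u + N * n \<and> Q x} = N * card {x. x < n \<and> Q x}"
proof (induction N)
  case 0
  have "{x. u < x \<and> x \<le> u + 0 * n \<and> Q x} = {}" by auto
  then show ?case by (metis card.empty mult_0)
next
  case (Suc N)
  have one: "card {x. u < x \<and> x \<le> u + n \<and> Q x} = card {x. x < n \<and> Q x}" for u
  proof (induction u)
    case 0
    define M where "M = {x. 0 < x \<and> x < n \<and> Q x}"
    have M: "finite M" "0 \<notin> M" "n \<notin> M" by (auto simp: M_def)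
    have n: "Q 0 \<longleftrightarrow> Q n" using per[of 0] by simp
    have "{x. x < n \<and> Q x} = (if 0 < n \<and> Q n then insert 0 M else M)"
      unfolding n[symmetric] M_def by (rule set_eqI, rename_tac x, case_tac "x = 0") auto
    moreover have "{x. 0 < x \<and> x \<le> 0 + n \<and> Q x} = (if 0 < n \<and> Q n then insert n M else M)"
      by (auto simp: le_less M_def)
    ultimately show ?case using M by (metis card_insert_disjoint)
  next
    case (Suc u)
    define M where "M = {x. Suc u < x \<and> x \<le> u + n \<and> Q x}"
    have M: "finite M" "Suc u \<notin> M" "Suc u + n \<notin> M"
      using finite_card_between[of "Suc u" "u + n" Q] by (auto simp: M_def)
    show ?case
    proof (cases "n = 0")
      case False
      have "{x. u < x \<and> x \<le> u + n \<and> Q x} = (if Q (Suc u) then insert (Suc u) M else M)"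
        using False by (auto simp: less_Suc_eq_le M_def intro: Suc_lessI)
      moreover have "{x. Suc u < x \<and> x \<le> Suc u + n \<and> Q x} = (if Q (Suc u) then insert (Suc u + n) M else M)"
        using False per[of "Suc u"] by (auto simp: le_Suc_eq M_def)
      ultimately show ?thesis using Suc M by (metis card_insert_disjoint)
    qed auto
  qed
  have "{x. u < x \<and> x \<le> u + Suc N * n \<and> Q x} =
      {x. u < x \<and> x \<le> u + N * n \<and> Q x} \<union> {x. u + N * n < x \<and> x \<le> u + N * n + n \<and> Q x}"
    by auto
  moreover have "finite {x. u < x \<and> x \<le> v \<and> Q x}" for u v :: nat
    by (rule finite_subset[of _ "{..v}"]) auto
  ultimately have "card {x. u < x \<and> x \<le> u + Suc N * n \<and> Q x} =
      card {x. u < x \<and> x \<le> u + N * n \<and> Q x} + card {x. u + N * n < x \<and> x \<le> u + N * n + n \<and> Q x}"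
    by (simp add: card_Un_disjoint disjoint_iff)
  then show ?case using Suc one[of "u + N * n"] by simp
qed

text \<open>The combinatorics of a periodic line, detached from influence. \<open>z\<close> makes
  \<open>next_two\<close> total and marks where laps begin.\<close>

locale ring_line =
  fixes n w :: nat and tw :: "nat \<Rightarrow> bool" and z :: nat
  assumes tw_shift: "tw (x + n) \<longleftrightarrow> tw x" and tw_z: "tw z" and z_less: "z < n"
begin

lemma n_pos: "0 < n"
  using z_less by simp

lemma tw_shift_mult: "tw (x + d * n) \<longleftrightarrow> tw x"
proof (induction d)
  case (Suc d)
  then show ?case using tw_shift[of "x + d * n"] by (simp add: algebra_simps)
qed simp

definition next_two :: "nat \<Rightarrow> nat" where
  "next_two p = (LEAST y. p < y \<and> tw y)"

lemma ex_tw: "\<exists>y. p < y \<and> tw y"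
proof -
  have "p < z + Suc p * n" using n_pos by (cases n) auto
  then show ?thesis using tw_shift_mult[of z "Suc p"] tw_z by blast
qed

lemma next_two_gt: "p < next_two p" and tw_next_two: "tw (next_two p)"
  using LeastI_ex[OF ex_tw[of p]] by (auto simp: next_two_def)

lemma next_two_le: "p < y \<Longrightarrow> tw y \<Longrightarrow> next_two p \<le> y"
  unfolding next_two_def by (rule Least_le) simp

lemma not_tw_before_next_two: "p < y \<Longrightarrow> y < next_two p \<Longrightarrow> \<not> tw y"
  using next_two_le by fastforce

lemma next_two_eqI: "p < y \<Longrightarrow> tw y \<Longrightarrow> (\<And>x. p < x \<Longrightarrow> x < y \<Longrightarrow> \<not> tw x) \<Longrightarrow> next_two p = y"
  by (metis linorder_neqE_nat next_two_gt next_two_le not_le tw_next_two)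

lemma next_two_shift: "next_two (p + n) = next_two p + n"
proof -
  have "next_two (p + n) = (LEAST j. p + n < j + n \<and> tw (j + n)) + n"
    unfolding next_two_def by (rule Least_shift[where j = "next_two (p + n)"]) (auto simp: next_two_gt tw_next_two)
  then show ?thesis unfolding next_two_def tw_shift by simp
qed

lemma next_two_mono: "p \<le> q \<Longrightarrow> next_two p \<le> next_two q"
  by (meson le_less_trans next_two_gt next_two_le tw_next_two)

lemma next_two_eq: "p \<le> q \<Longrightarrow> q < next_two p \<Longrightarrow> next_two q = next_two p"
  by (meson next_two_le next_two_mono order_antisym tw_next_two)

definition step :: "nat \<Rightarrow> nat \<Rightarrow> bool" where
  "step p q \<longleftrightarrow> next_two p < q \<and> q \<le> next_two (next_two p) \<and> 2 * next_two p \<le> p + q + w \<and> p + q \<le> 2 * next_two p + w"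

lemma step_gt: "step p q \<Longrightarrow> p < q"
  using next_two_gt[of p] by (auto simp: step_def)

lemma step_shift: "step (p + n) (q + n) \<longleftrightarrow> step p q"
  by (auto simp: step_def next_two_shift)

lemma gap_ok_iff:
  assumes "p < q"
  shows "gap_ok tw w p q \<longleftrightarrow> q \<le> next_two p \<or> step p q"
proof
  assume "gap_ok tw w p q"
  then show "q \<le> next_two p \<or> step p q"
    unfolding gap_ok_def
  proof (elim disjE exE conjE)
    assume "\<forall>y. p < y \<and> y < q \<longrightarrow> \<not> tw y"
    then show ?thesis using next_two_gt[of p] tw_next_two[of p] by force
  next
    fix x assume x: "p < x" "x < q" "tw x" "\<forall>y. p < y \<and> y < q \<and> tw y \<longrightarrow> y = x"
      "2 * x \<le> p + q + w" "p + q \<le> 2 * x + w"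
    have a: "next_two p = x"
    proof (rule next_two_eqI[OF x(1,3)])
      fix y assume y: "p < y" "y < x"
      then have "y < q" "y \<noteq> x" using x(2) by simp_all
      then show "\<not> tw y" using x(4) y(1) by blast
    qed
    have "q \<le> next_two x"
    proof (rule ccontr)
      assume "\<not> q \<le> next_two x"
      then have "next_two x = x" using x(1,4) next_two_gt[of x] tw_next_two[of x] by simp
      then show False using next_two_gt[of x] by simp
    qed
    then show ?thesis unfolding step_def a using x(2,5,6) by simp
  qed
next
  assume "q \<le> next_two p \<or> step p q"
  then show "gap_ok tw w p q"
  proof
    assume "q \<le> next_two p"
    then show ?thesis using not_tw_before_next_two[of p] by (auto simp: gap_ok_def)
  next
    assume s: "step p q"
    have "y = next_two p" if "p < y" "y < q" "tw y" for y
    proof (rule ccontr)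
      assume "y \<noteq> next_two p"
      then have "y < next_two p \<or> next_two p < y \<and> y < next_two (next_two p)" using s that(2) by (auto simp: step_def)
      then show False using not_tw_before_next_two that(1,3) by blast
    qed
    moreover have "next_two p < q" "2 * next_two p \<le> p + q + w" "p + q \<le> 2 * next_two p + w"
      using s by (auto simp: step_def)
    ultimately show ?thesis using next_two_gt[of p] tw_next_two[of p] unfolding gap_ok_def by blast
  qed
qed

text \<open>The start is arbitrary, so every tail of a chain is again a chain; only
  \<open>block\<close> asks for threshold 2 at the start.\<close>

inductive chain :: "nat \<Rightarrow> nat \<Rightarrow> bool" where
  last: "step p j \<Longrightarrow> tw j \<Longrightarrow> chain p j"
| more: "step p q \<Longrightarrow> \<not> tw q \<Longrightarrow> chain q j \<Longrightarrow> chain p j"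

lemma chain_tw: "chain p j \<Longrightarrow> tw j"
  by (induction rule: chain.induct) auto

lemma chain_gt: "chain p j \<Longrightarrow> next_two (next_two p) \<le> j"
proof (induction rule: chain.induct)
  case (last p j)
  then show ?case using next_two_le[of "next_two p" j] by (simp add: step_def)
next
  case (more p q j)
  then show ?case using next_two_mono[of "next_two p" "next_two q"] next_two_mono[of p q] step_gt[of p q] by force
qed

lemma chain_less: "chain p j \<Longrightarrow> p < j"
  using chain_gt[of p j] next_two_gt[of p] next_two_gt[of "next_two p"] by simp

lemma chain_shift: "chain p j \<Longrightarrow> chain (p + n) (j + n)"
proof (induction rule: chain.induct)
  case (last p j)
  then show ?case using chain.last step_shift tw_shift by blast
next
  case (more p q j)
  then show ?case using chain.more[of "p + n" "q + n"] step_shift tw_shift by blast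
qed

lemma chain_unshift: "chain p' j \<Longrightarrow> p' = p + n \<Longrightarrow> chain p (j - n)"
proof (induction arbitrary: p rule: chain.induct)
  case (last p' j)
  then obtain i where i: "j = i + n" using step_gt[of p' j] by (metis add.commute less_imp_add_positive add.assoc)
  then show ?case using last chain.last[of p i] step_shift tw_shift by simp
next
  case (more p' q j)
  then obtain i where i: "q = i + n" using step_gt[of p' q] by (metis add.commute less_imp_add_positive add.assoc)
  then show ?case using more chain.more[of p i] step_shift tw_shift by simp
qed

definition block :: "nat \<Rightarrow> nat \<Rightarrow> bool" where
  "block i j \<longleftrightarrow> tw i \<and> chain i j"

lemma block_less: "block i j \<Longrightarrow> i < j"
  using chain_less by (simp add: block_def)

lemma block_shift: "block (i + n) (j + n) \<longleftrightarrow> block i j"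
  using chain_shift[of i j] chain_unshift[of "i + n" "j + n" i] tw_shift by (auto simp: block_def)

text \<open>The cut-off at \<open>2 n\<close> is never reached if there is a block of length at most \<open>n\<close>.\<close>
definition gnext :: "nat \<Rightarrow> nat" where
  "gnext i = (LEAST j. i < j \<and> tw j \<and> ((\<exists>i'\<ge>i. block i' j) \<or> i + 2 * n < j))"

lemma gnext_ex: "\<exists>j. i < j \<and> tw j \<and> ((\<exists>i'\<ge>i. block i' j) \<or> i + 2 * n < j)"
  using ex_tw[of "i + 2 * n"] by (meson le_add1 le_less_trans)

lemma gnext_gt: "i < gnext i" and tw_gnext: "tw (gnext i)"
  and gnext_cases: "(\<exists>i'\<ge>i. block i' (gnext i)) \<or> i + 2 * n < gnext i"
  using LeastI_ex[OF gnext_ex[of i]] by (auto simp: gnext_def)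

lemma gnext_le_block: "i \<le> i' \<Longrightarrow> block i' j \<Longrightarrow> gnext i \<le> j"
  unfolding gnext_def by (rule Least_le) (use block_less[of i' j] chain_tw[of i' j] in \<open>auto simp: block_def\<close>)

lemma gnext_le_cut: "i + 2 * n < j \<Longrightarrow> tw j \<Longrightarrow> gnext i \<le> j"
  unfolding gnext_def by (rule Least_le) auto

text \<open>A block that starts at or after \<open>i'\<close> also starts at or after
  \<open>i\<close>, and the cut-off moves along with the argument.\<close>

lemma gnext_mono: "i \<le> i' \<Longrightarrow> gnext i \<le> gnext i'"
  using gnext_cases[of i'] gnext_le_block[of i _ "gnext i'"] gnext_le_cut[of i "gnext i'"] tw_gnext[of i']
  by (metis add_le_mono1 le_less_trans le_trans)

lemma gnext_shift: "gnext (i + n) = gnext i + n"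
proof -
  have e: "(\<exists>i'\<ge>i + n. block i' (j + n)) \<longleftrightarrow> (\<exists>i'\<ge>i. block i' j)" for j
    by (metis add_le_mono1 block_shift le_add_diff_inverse2 le_diff_conv2 add_leD2)
  have "gnext (i + n) = (LEAST j. i + n < j + n \<and> tw (j + n) \<and>
      ((\<exists>i'\<ge>i + n. block i' (j + n)) \<or> i + n + 2 * n < j + n)) + n"
    unfolding gnext_def by (rule Least_shift[where j = "gnext (i + n)"])
      (use gnext_gt[of "i+n"] tw_gnext[of "i+n"] gnext_cases[of "i+n"] in auto)
  moreover have "i + n + 2 * n < j + n \<longleftrightarrow> i + 2 * n < j" "i + n < j + n \<longleftrightarrow> i < j" for j by auto
  ultimately show ?thesis unfolding e tw_shift by (simp only: gnext_def[symmetric])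
qed

lemma gnext_shift_mult: "gnext (i + d * n) = gnext i + d * n"
proof (induction d)
  case (Suc d)
  then show ?case using gnext_shift[of "i + d * n"] by (simp add: algebra_simps)
qed simp

lemma gpow_shift: "(gnext ^^ s) (i + d * n) = (gnext ^^ s) i + d * n"
  by (induction s) (auto simp: gnext_shift_mult)

lemma gpow_mono: "i \<le> i' \<Longrightarrow> (gnext ^^ s) i \<le> (gnext ^^ s) i'"
  by (induction s) (auto simp: gnext_mono)

lemma gpow_ge: "i + s \<le> (gnext ^^ s) i"
proof (induction s)
  case (Suc s)
  then show ?case using gnext_gt[of "(gnext ^^ s) i"] by simp
qed simp

lemma gpow_mono_exp: "s \<le> s' \<Longrightarrow> (gnext ^^ s) i \<le> (gnext ^^ s') i"
proof (induction s' rule: dec_induct)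
  case (step m)
  then show ?case using gnext_gt[of "(gnext ^^ m) i"] by simp
qed simp

section \<open>Greedy blocks against an arbitrary target set\<close>

text \<open>A set with good gaps saves, up to an additive constant, no more than the greedy sequence
  of blocks started at \<open>u\<close>. While a chain of the set is running, the disjunct with \<open>i\<close> records
  a possible start of it.\<close>
lemma greedy_ahead:
  fixes L :: "nat set"
  assumes gaps: "\<And>p q. p < q \<Longrightarrow> p \<in> L \<Longrightarrow> q \<in> L \<Longrightarrow> (\<And>y. p < y \<Longrightarrow> y < q \<Longrightarrow> y \<notin> L) \<Longrightarrow>
      q \<le> next_two p \<or> step p q"
    and p0: "p0 \<in> L" "u \<le> p0" and p: "p \<in> L" "p0 \<le> p"
    and e: "e = int (card {x. p0 < x \<and> x \<le> p \<and> tw x}) - int (card {x. p0 < x \<and> x \<le> p \<and> x \<in> L}) - 1"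
  shows "(gnext ^^ nat e) u \<le> p \<and>
    (tw p \<or> (gnext ^^ nat (e + 1)) u \<le> p \<or>
      (\<exists>i\<le>p. tw i \<and> (gnext ^^ nat e) u \<le> i \<and> (\<forall>j. chain p j \<longrightarrow> chain i j)))"
  using p e
proof (induction p arbitrary: e rule: less_induct)
  case (less q)
  show ?case
  proof (cases "q = p0")
    case True
    \<comment> \<open>Here \<open>e = -1\<close>, and \<open>nat\<close> turns both exponents into
      0. The \<open>- 1\<close> in \<open>e\<close> pays for a chain that is already running at
      \<open>p0\<close>, whose end counts as a gain although its start lies before
      \<open>p0\<close>.\<close>
    then have "{x. p0 < x \<and> x \<le> q \<and> tw x} = {}" "{x. p0 < x \<and> x \<le> q \<and> x \<in> L} = {}" by auto
    then have "e = -1" using less.prems by (metis card.empty diff_0 diff_self of_nat_0)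
    then show ?thesis using p0 True by simp
  next
    case False
    define p where "p = (GREATEST p. p < q \<and> p \<in> L)"
    have ex: "p0 < q \<and> p0 \<in> L" using False less.prems p0 by simp
    have p: "p < q" "p \<in> L"
      using GreatestI_nat[of "\<lambda>p. p < q \<and> p \<in> L", OF ex, of q] unfolding p_def by auto
    have pm: "y \<le> p" if "y < q" "y \<in> L" for y
      using Greatest_le_nat[of "\<lambda>p. p < q \<and> p \<in> L" y q] that unfolding p_def by auto
    have p0p: "p0 \<le> p" using pm ex by simp
    have out: "y \<notin> L" if "p < y" "y < q" for y using pm[of y] that by force
    define f where "f = int (card {x. p0 < x \<and> x \<le> p \<and> tw x}) - int (card {x. p0 < x \<and> x \<le> p \<and> x \<in> L}) - 1"
    note IH = less.IH[OF p(1,2) p0p f_def]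
    have split: "card {x. p0 < x \<and> x \<le> q \<and> Q x} = card {x. p0 < x \<and> x \<le> p \<and> Q x} + card {x. p < x \<and> x \<le> q \<and> Q x}" for Q
    proof -
      have "{x. p0 < x \<and> x \<le> q \<and> Q x} = {x. p0 < x \<and> x \<le> p \<and> Q x} \<union> {x. p < x \<and> x \<le> q \<and> Q x}"
        using p0p p by auto
      then show ?thesis using finite_card_between by (simp add: card_Un_disjoint disjoint_iff)
    qed
    have "{x. p < x \<and> x \<le> q \<and> x \<in> L} = {q}" using out p less.prems by (auto simp: le_less)
    then have ef: "e = f + int (card {x. p < x \<and> x \<le> q \<and> tw x}) - 1"
      using split[of tw] split[of "\<lambda>x. x \<in> L"] less.prems(3) f_def by simp
    have Gf: "(gnext ^^ nat f) u \<le> q" "(gnext ^^ nat (f - 1)) u \<le> q"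
    proof -
      show "(gnext ^^ nat f) u \<le> q" using IH p(1) by simp
      moreover have "nat (f - 1) \<le> nat f" by (rule nat_mono) simp
      ultimately show "(gnext ^^ nat (f - 1)) u \<le> q" using gpow_mono_exp le_trans by blast
    qed
    \<comment> \<open>A block from \<open>i\<close> to \<open>q\<close> lies behind the first
      \<open>f\<close> greedy blocks, so the next greedy block ends by \<open>q\<close>. For
      negative \<open>f\<close> the exponent is 0.\<close>
    have Gq: "(gnext ^^ nat (f + 1)) u \<le> q" if "(gnext ^^ nat f) u \<le> i" "tw i" "chain i q" for i
    proof (cases "f \<ge> 0")
      case True
      then have "nat (f + 1) = Suc (nat f)" by simp
      then show ?thesis using gnext_le_block[of "(gnext ^^ nat f) u" i q] that by (simp add: block_def)
    next
      case False
      then show ?thesis using p0 less.prems by simp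
    qed
    have "q \<le> next_two p \<or> step p q" using gaps[OF p(1,2) less.prems(1)] out by blast
    then show ?thesis
    proof
      assume q: "q \<le> next_two p"
      have "{x. p < x \<and> x \<le> q \<and> tw x} = (if tw q then {q} else {})"
        using q p not_tw_before_next_two[of p] by (auto simp: le_less)
      \<comment> \<open>A threshold-2 node \<open>q\<close> pays for itself. Otherwise one node is
        lost, which puts the greedy sequence one block ahead.\<close>
      then have "e = (if tw q then f else f - 1)" using ef by simp
      then show ?thesis using Gf by simp
    next
      assume s: "step p q"
      have "{x. p < x \<and> x \<le> q \<and> tw x} = insert (next_two p) (if tw q then {q} else {})"
      proof -
        have "x = next_two p \<or> x = q" if "p < x" "x \<le> q" "tw x" for x
        proof (rule ccontr)
          assume "\<not> ?thesis"
          then have "x < next_two p \<or> next_two p < x \<and> x < next_two (next_two p)" using s that(2) by (auto simp: step_def)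
          then show False using not_tw_before_next_two that(1,3) by blast
        qed
        moreover have "p < next_two p" "next_two p \<le> q" "tw (next_two p)"
          using s next_two_gt[of p] tw_next_two[of p] by (auto simp: step_def)
        ultimately show ?thesis using p(1) by auto
      qed
      moreover have "q \<noteq> next_two p" using s by (auto simp: step_def)
      ultimately have e': "e = (if tw q then f + 1 else f)" using ef by simp
      show ?thesis
      proof (cases "tw q")
        case True
        \<comment> \<open>The chain ends at \<open>q\<close>. Its block starts at \<open>p\<close>,
          or at the recorded \<open>i\<close>, unless the greedy sequence is one block ahead
          anyway.\<close>
        have c: "chain p q" using chain.last s True by blast
        have "(gnext ^^ nat (f + 1)) u \<le> q"
        proof (cases "tw p \<or> \<not> (gnext ^^ nat (f + 1)) u \<le> p")
          case True
          then show ?thesis using IH Gq c by blast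
        next
          case False
          then show ?thesis using p by simp
        qed
        then show ?thesis using e' True by simp
      next
        case F: False
        \<comment> \<open>Every continuation from \<open>q\<close> is one from \<open>p\<close>, so
          a recorded start stays valid; if \<open>p\<close> has threshold 2, it becomes the
          start.\<close>
        have c: "chain q j \<Longrightarrow> chain p j" for j using chain.more s F by blast
        have "(gnext ^^ nat (f + 1)) u \<le> q \<or>
          (\<exists>i\<le>q. tw i \<and> (gnext ^^ nat f) u \<le> i \<and> (\<forall>j. chain q j \<longrightarrow> chain i j))"
          using IH c p by (meson less_imp_le le_trans)
        then show ?thesis using e' F Gf by simp
      qed
    qed
  qed
qed

text \<open>Over \<open>N\<close> laps a periodic set saves \<open>N * m\<close> nodes. The extra
  lap covers the way from \<open>x\<close> to the first comparison point in \<open>L\<close>; the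
  missing block is the \<open>- 1\<close> of \<open>greedy_ahead\<close>.\<close>

lemma greedy_rate:
  fixes L :: "nat set"
  assumes gaps: "\<And>p q. p < q \<Longrightarrow> p \<in> L \<Longrightarrow> q \<in> L \<Longrightarrow> (\<And>y. p < y \<Longrightarrow> y < q \<Longrightarrow> y \<notin> L) \<Longrightarrow>
      q \<le> next_two p \<or> step p q"
    and per: "\<And>x. x + n \<in> L \<longleftrightarrow> x \<in> L" and ne: "L \<noteq> {}"
    and m: "card {x. x < n \<and> tw x} = card {x. x < n \<and> x \<in> L} + m" "1 \<le> m"
  shows "(gnext ^^ (N * m - 1)) x \<le> x + n + N * n"
proof -
  have perm: "y + d * n \<in> L \<longleftrightarrow> y \<in> L" for y d
  proof (induction d)
    case (Suc d)
    then show ?case using per[of "y + d * n"] by (simp add: algebra_simps)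
  qed simp
  have "card {y. x < y \<and> y \<le> x + 1 * n \<and> y \<in> L} = 1 * card {y. y < n \<and> y \<in> L}"
    by (rule card_periodic) (rule per)
  moreover have "card {y. y < n \<and> y \<in> L} > 0"
  proof -
    obtain y where "y \<in> L" using ne by blast
    then have "y mod n \<in> L" using perm[of "y mod n" "y div n"] by simp
    then have "{y. y < n \<and> y \<in> L} \<noteq> {}" using n_pos by (auto intro!: exI[of _ "y mod n"])
    then show ?thesis by (simp add: card_gt_0_iff)
  qed
  ultimately have "{y. x < y \<and> y \<le> x + 1 * n \<and> y \<in> L} \<noteq> {}"
    by (metis card.empty less_numeral_extra(3) mult_1)
  then obtain p0 where p0: "p0 \<in> L" "x \<le> p0" "p0 \<le> x + n" by auto
  define p where "p = p0 + N * n"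
  have p: "p \<in> L" "p0 \<le> p" using perm p0 by (auto simp: p_def)
  have c: "card {x. p0 < x \<and> x \<le> p \<and> tw x} = N * card {x. x < n \<and> tw x}"
    "card {x. p0 < x \<and> x \<le> p \<and> x \<in> L} = N * card {x. x < n \<and> x \<in> L}"
    unfolding p_def by (rule card_periodic; fact tw_shift per)+
  have "(gnext ^^ nat (int (N * card {x. x < n \<and> tw x}) - int (N * card {x. x < n \<and> x \<in> L}) - 1)) x \<le> p"
    using greedy_ahead[OF gaps p0(1,2) p refl] unfolding c by blast
  moreover have "nat (int (N * card {x. x < n \<and> tw x}) - int (N * card {x. x < n \<and> x \<in> L}) - 1) = N * m - 1"
  proof -
    have "int (N * card {x. x < n \<and> tw x}) - int (N * card {x. x < n \<and> x \<in> L}) = int (N * m)"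
      unfolding m by (simp add: distrib_left)
    moreover have "nat (int k - 1) = k - 1" for k by arith
    ultimately show ?thesis by presburger
  qed
  ultimately show ?thesis using p0 by (simp add: p_def)
qed

text \<open>If \<open>m\<close> blocks overshoot one lap, then by monotonicity \<open>m * c\<close>
  blocks overshoot \<open>c\<close> laps, while along the cycle they take exactly
  \<open>W * m\<close> laps. So \<open>c < W * m\<close>: the cycle has fewer blocks per lap than
  \<open>rate\<close> promises.\<close>

lemma cycle_optimal:
  assumes rate: "\<And>N. (gnext ^^ (N * m - 1)) x \<le> x + n + N * n"
    and cyc: "(gnext ^^ c) x = x + W * n" "1 \<le> c"
  shows "(gnext ^^ m) x \<le> x + n"
proof (rule ccontr)
  assume "\<not> ?thesis"
  then have lt: "x + n < (gnext ^^ m) x" by simp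
  have cyc': "(gnext ^^ (c * a)) x = x + W * a * n" for a
  proof (induction a)
    case (Suc a)
    have "(gnext ^^ (c * Suc a)) x = (gnext ^^ (c * a)) ((gnext ^^ c) x)"
      by (metis add.commute comp_apply funpow_add mult_Suc_right)
    also have "\<dots> = x + W * Suc a * n" unfolding cyc gpow_shift Suc by (simp add: algebra_simps)
    finally show ?case .
  qed simp
  have "x + Suc a * n < (gnext ^^ (m * Suc a)) x" for a
  proof (induction a)
    case (Suc a)
    have "(gnext ^^ (m * Suc (Suc a))) x = (gnext ^^ m) ((gnext ^^ (m * Suc a)) x)"
      by (metis add.commute comp_apply funpow_add mult_Suc_right)
    also have "\<dots> \<ge> (gnext ^^ m) (x + Suc a * n)" by (rule gpow_mono) (use Suc in simp)
    finally have "(gnext ^^ m) x + Suc a * n \<le> (gnext ^^ (m * Suc (Suc a))) x" by (simp only: gpow_shift)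
    then show ?case using lt by simp
  qed (use lt in simp)
  from this[of "c - 1"] have "x + c * n < (gnext ^^ (m * c)) x" using cyc(2) by simp
  then have "c * n < W * m * n" using cyc'[of m] by (simp add: mult.commute)
  then have cW: "Suc c \<le> W * m" by simp
  \<comment> \<open>In \<open>W * R\<close> laps plus one, \<open>rate\<close> promises at least
    \<open>c * R + (R - 1)\<close> blocks, but \<open>c * R\<close> blocks already fill
    \<open>W * R\<close> laps. The other \<open>R - 1 = n + 1\<close> would have to end within
    \<open>n\<close> positions.\<close>
  define R where "R = n + 2"
  have "Suc c * R \<le> W * m * R" using cW by (rule mult_le_mono1)
  then have "c * R + (R - 1) \<le> W * R * m - 1" by (simp add: R_def algebra_simps)
  then have "(gnext ^^ (c * R + (R - 1))) x \<le> (gnext ^^ (W * R * m - 1)) x" by (rule gpow_mono_exp)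
  also have "\<dots> \<le> x + n + W * R * n" by (rule rate)
  finally have "(gnext ^^ (R - 1 + c * R)) x \<le> x + n + W * R * n" by (simp add: add.commute)
  moreover have "(gnext ^^ (R - 1 + c * R)) x = (gnext ^^ (R - 1)) x + W * R * n"
    unfolding funpow_add comp_apply cyc' gpow_shift by simp
  ultimately have "(gnext ^^ (R - 1)) x \<le> x + n" by simp
  then show False using gpow_ge[of x "R - 1"] by (simp add: R_def)
qed

section \<open>Earliest ends of chains\<close>

definition reach :: "nat \<Rightarrow> nat \<Rightarrow> bool" where
  "reach N p \<longleftrightarrow> (\<exists>j\<le>N. chain p j)"

text \<open>Where a step may land if the chain is to be complete by \<open>N\<close>, the end of the
  scanned range.\<close>

definition usable :: "nat \<Rightarrow> nat \<Rightarrow> bool" where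
  "usable N q \<longleftrightarrow> q \<le> N \<and> (tw q \<or> reach N q)"

text \<open>Unspecified if no chain starts at \<open>p\<close>; \<open>reach\<close> and
  \<open>usable\<close> guard its use in the tables.\<close>

definition chain_end :: "nat \<Rightarrow> nat" where
  "chain_end p = (LEAST j. chain p j)"

definition lab :: "nat \<Rightarrow> nat" where
  "lab q = (if tw q then q else chain_end q)"

text \<open>The first step of a chain with the earliest end; the last conjunct rules out an
  unspecified \<open>chain_end q\<close>.\<close>

definition good :: "nat \<Rightarrow> nat \<Rightarrow> bool" where
  "good p q \<longleftrightarrow> step p q \<and> lab q = chain_end p \<and> (tw q \<or> chain q (chain_end q))"

lemma chain_chain_end: "chain p j \<Longrightarrow> chain p (chain_end p)"
  unfolding chain_end_def by (rule LeastI)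

lemma chain_end_le: "chain p j \<Longrightarrow> chain_end p \<le> j"
  unfolding chain_end_def by (rule Least_le)

lemma reach_iff: "reach N p \<longleftrightarrow> chain p (chain_end p) \<and> chain_end p \<le> N"
  using chain_chain_end chain_end_le le_trans unfolding reach_def by blast

lemma step_chain: "step p q \<Longrightarrow> tw q \<or> chain q j \<Longrightarrow> chain p (lab q)"
  using chain.last[of p q] chain.more[of p q "chain_end q"] chain_chain_end[of q j] by (auto simp: lab_def)

text \<open>The tail of a chain with the earliest end can be exchanged for one with the earliest end
  from there, so both ends agree.\<close>

lemma ex_good: 
  assumes "chain p j"
  shows "\<exists>q. good p q"
  using chain_chain_end[OF assms]
proof (cases rule: chain.cases)
  case last
  then show ?thesis by (auto simp: good_def lab_def)
next
  case (more q)
  have "chain_end q \<le> chain_end p" using more chain_end_le by blast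
  moreover have "chain_end p \<le> chain_end q" using more chain.more chain_chain_end chain_end_le by blast
  ultimately have "chain_end q = chain_end p" by simp
  then show ?thesis using more chain_chain_end by (auto simp: good_def lab_def)
qed

lemma good_le: "good p q \<Longrightarrow> q \<le> chain_end p"
  using chain_less[of q "chain_end q"] by (auto simp: good_def lab_def split: if_splits)

lemma good_usable:
  assumes "good p q" "chain_end p \<le> N"
  shows "usable N q"
  using assms good_le[OF assms(1)] unfolding usable_def good_def lab_def reach_def
  by (auto split: if_splits)

text \<open>The windows of three nodes of one segment have the same length and are ordered inversely,
  so that an end missed by both outer nodes is reached through a window node that lies strictly
  between theirs. Hence only the outermost usable nodes of a window need to be inspected.\<close>
lemma chain_end_concave:
  assumes "chain x jx" "chain y jy" "chain v jv" "x < y" "y < v" "next_two x = next_two v"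
  shows "min (chain_end x) (chain_end v) \<le> chain_end y"
  using assms
proof (induction "chain_end y - y" arbitrary: x y v jx jy jv rule: less_induct)
  case less
  note pr = less.prems
  define c where "c = next_two x"
  have c: "next_two x = c" "next_two y = c" "next_two v = c"
    using next_two_mono[of x y] next_two_mono[of y v] pr by (auto simp: c_def)
  show ?case
  proof (rule ccontr)
    assume "\<not> ?thesis"
    then have E: "chain_end y < chain_end x" "chain_end y < chain_end v" by auto
    obtain q1 q2 q3 where q: "good x q1" "good y q2" "good v q3"
      using ex_good pr by metis
    have s: "step x q1" "step y q2" "step v q3" and l: "lab q1 = chain_end x" "lab q2 = chain_end y" "lab q3 = chain_end v"
      using q by (auto simp: good_def)
    \<comment> \<open>A shared window node would give \<open>x\<close> or \<open>v\<close> an end as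
      early as that of \<open>y\<close>.\<close>
    have "\<not> step x q2" "\<not> step v q2"
      using step_chain[of _ q2 "chain_end q2"] q(2) l E chain_end_le unfolding good_def by fastforce+
    then have ord: "q2 < q1" "q3 < q2"
      using s pr(4,5) unfolding step_def c by linarith+
    have "c < q3" "q1 \<le> next_two c" using s unfolding step_def c by auto
    \<comment> \<open>No chain that skips \<open>c\<close> ends before \<open>next_two c\<close>; if
      \<open>q1\<close> had threshold 2, \<open>x\<close> would attain this bound.\<close>
    have "next_two c \<le> chain_end y" using chain_gt[of y "chain_end y"] chain_chain_end[OF pr(2)] c by simp
    then have "\<not> tw q1" using E l \<open>q1 \<le> next_two c\<close> by (auto simp: lab_def)
    then have "q1 < next_two c" using \<open>q1 \<le> next_two c\<close> tw_next_two[of c] by (metis le_neq_implies_less)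
    have next_two: "\<not> tw q2" "\<not> tw q3" "next_two q3 = next_two q1"
      using not_tw_before_next_two[of c] \<open>c < q3\<close> ord \<open>q1 < next_two c\<close> next_two_eq[of c q1] next_two_eq[of c q3] by auto
    have ch: "chain q1 (chain_end q1)" "chain q2 (chain_end q2)" "chain q3 (chain_end q3)"
      using q \<open>\<not> tw q1\<close> next_two by (auto simp: good_def)
    have le: "chain_end q1 = chain_end x" "chain_end q2 = chain_end y" "chain_end q3 = chain_end v"
      using l \<open>\<not> tw q1\<close> next_two by (auto simp: lab_def)
    \<comment> \<open>The same configuration one segment further on, in reversed order: the middle
      chain keeps its end while its start advances.\<close>
    have "chain_end q2 - q2 < chain_end y - y"
      using le(2) step_gt[OF s(2)] chain_less[OF ch(2)] by linarith
    from less.hyps[OF this ch(3) ch(2) ch(1) ord(2,1) next_two(3)] show False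
      using E le by auto
  qed
qed

lemma reach_good: "reach N x \<Longrightarrow> \<exists>q. good x q \<and> usable N q"
  using ex_good good_usable reach_iff by blast

text \<open>Even the last admissible landing position comes before the window opens.\<close>

lemma window_far:
  assumes "\<not> 2 * next_two x \<le> x + next_two (next_two x) + w"
  shows "\<not> reach N x"
proof
  assume "reach N x"
  then obtain q where "good x q" using reach_good by blast
  then show False using assms by (auto simp: good_def step_def)
qed

text \<open>By \<open>chain_gt\<close> no chain from \<open>x\<close> can end before the second
  threshold-2 node, and here a single step gets there.\<close>

lemma window_end:
  assumes "2 * next_two x \<le> x + next_two (next_two x) + w" "x + next_two (next_two x) \<le> 2 * next_two x + w" "next_two (next_two x) \<le> N"
  shows "reach N x \<and> chain_end x = next_two (next_two x) \<and> good x (next_two (next_two x))"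
proof -
  have s: "step x (next_two (next_two x))" using assms next_two_gt by (simp add: step_def)
  then have c: "chain x (next_two (next_two x))" using chain.last tw_next_two by blast
  then have "chain_end x = next_two (next_two x)" using chain_end_le chain_gt[OF chain_chain_end[OF c]] by fastforce
  then show ?thesis using s c assms(3) tw_next_two by (auto simp: good_def lab_def reach_def)
qed

text \<open>The window lies inside one segment, so \<open>chain_end_concave\<close> leaves only its
  first usable node \<open>v\<close> and its last one \<open>u\<close>. On a tie \<open>v\<close> is
  kept.\<close>

lemma window_mid:
  assumes hi: "x + hi = 2 * next_two x + w" "hi < next_two (next_two x)" and N: "next_two (next_two x) \<le> N"
    and lo: "\<And>q. lo \<le> q \<longleftrightarrow> next_two x < q \<and> 2 * next_two x \<le> x + q + w"
    and v: "usable N v" "lo \<le> v" "\<And>y. lo \<le> y \<Longrightarrow> y < v \<Longrightarrow> \<not> usable N y"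
  shows "hi < v \<Longrightarrow> \<not> reach N x"
    and "\<lbrakk>v \<le> hi; usable N u; u \<le> hi; \<And>y. u < y \<Longrightarrow> y \<le> hi \<Longrightarrow> \<not> usable N y\<rbrakk> \<Longrightarrow>
      reach N x \<and> lo \<le> u \<and> \<not> tw u \<and> \<not> tw v \<and> reach N u \<and> reach N v \<and>
      chain_end x = min (chain_end u) (chain_end v) \<and> (if chain_end u < chain_end v then good x u else good x v)"
proof -
  have st: "step x q \<longleftrightarrow> lo \<le> q \<and> q \<le> hi" for q
    using hi lo[of q] unfolding step_def by auto
  show "\<not> reach N x" if "hi < v"
  proof
    assume "reach N x"
    then obtain q where q: "good x q" "usable N q" using reach_good by blast
    then have "lo \<le> q" "q \<le> hi" using st by (auto simp: good_def)
    then show False using v(3)[of q] q that by simp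
  qed
  assume vu: "v \<le> hi" "usable N u" "u \<le> hi" and um: "\<And>y. u < y \<Longrightarrow> y \<le> hi \<Longrightarrow> \<not> usable N y"
  have le: "v \<le> u" using um[of v] v vu by force
  have lou: "lo \<le> u" using le v by simp
  have seg: "\<not> tw q \<and> next_two q = next_two (next_two x)" if "lo \<le> q" "q \<le> hi" for q
  proof -
    have "next_two x < q" "q < next_two (next_two x)" using lo[of q] that hi(2) by auto
    then show ?thesis using not_tw_before_next_two next_two_eq[of "next_two x" q] by auto
  qed
  have tu: "\<not> tw u" "\<not> tw v" using seg lou vu v by blast+
  have r: "reach N u" "reach N v" using tu v vu by (auto simp: usable_def)
  then have ch: "chain u (chain_end u)" "chain v (chain_end v)" by (auto simp: reach_iff)
  have s: "step x u" "step x v" using st lou vu v by auto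
  have c: "chain x (chain_end u)" "chain x (chain_end v)"
    using step_chain[OF s(1), of "chain_end u"] step_chain[OF s(2), of "chain_end v"] ch tu
    by (simp_all add: lab_def)
  have x: "reach N x" using c(1) r(1) unfolding reach_iff[of N u] unfolding reach_def by blast
  have up: "chain_end x \<le> chain_end u" "chain_end x \<le> chain_end v" using c chain_end_le by auto
  obtain q where q: "good x q" "usable N q" using reach_good[OF x] by blast
  have ql: "lo \<le> q" "q \<le> hi" using st q by (auto simp: good_def)
  then have qv: "v \<le> q" "q \<le> u" using v(3)[of q] um[of q] q by force+
  have tq: "\<not> tw q" "chain q (chain_end q)" "chain_end q = chain_end x" using seg[of q] ql q by (auto simp: good_def lab_def)
  have "min (chain_end u) (chain_end v) \<le> chain_end q"
  proof (cases "q = v \<or> q = u")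
    case False
    then have "v < q" "q < u" using qv by auto
    moreover have "next_two v = next_two u" using seg lou vu v by metis
    ultimately show ?thesis using chain_end_concave[OF ch(2) tq(2) ch(1)] by (simp add: min.commute)
  qed auto
  then have m: "chain_end x = min (chain_end u) (chain_end v)" using up tq(3) by auto
  have "if chain_end u < chain_end v then good x u else good x v"
    using s tu ch m by (auto simp: good_def lab_def)
  then show "reach N x \<and> lo \<le> u \<and> \<not> tw u \<and> \<not> tw v \<and> reach N u \<and> reach N v \<and>
      chain_end x = min (chain_end u) (chain_end v) \<and> (if chain_end u < chain_end v then good x u else good x v)"
    using x lou tu r m by blast
qed

text \<open>What the scan can see of \<open>gnext\<close>: ends beyond \<open>N\<close> are replaced
  by \<open>N\<close>.\<close>

definition first_end :: "nat \<Rightarrow> nat \<Rightarrow> nat" where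
  "first_end N y = (LEAST j. j = N \<or> (\<exists>i\<ge>y. block i j))"

lemma first_end_le: "first_end N y \<le> N" "y \<le> i \<Longrightarrow> block i j \<Longrightarrow> first_end N y \<le> j"
  unfolding first_end_def by (auto intro: Least_le)

lemma first_end_cases: "first_end N y = N \<or> (\<exists>i\<ge>y. block i (first_end N y))"
  unfolding first_end_def by (rule LeastI[of _ N]) simp

lemma first_end_end: "first_end N N = N"
  using first_end_cases[of N N] first_end_le(1)[of N N] block_less by fastforce

lemma first_end_tw: "tw N \<Longrightarrow> tw (first_end N y)"
  using first_end_cases[of N y] chain_tw by (auto simp: block_def)

lemma first_end_gt: "y < N \<Longrightarrow> y < first_end N y"
  using first_end_cases[of N y] block_less by fastforce

text \<open>Blocks start at threshold-2 nodes, so one that starts at or after \<open>y\<close>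
  starts at \<open>y\<close> or not before \<open>next_two y\<close>.\<close>

lemma first_end_rec:
  assumes "tw y"
  shows "first_end N y = (if reach N y \<and> chain_end y \<le> first_end N (next_two y) then chain_end y else first_end N (next_two y))"
proof -
  have 1: "first_end N y \<le> first_end N (next_two y)"
    using first_end_cases[of N "next_two y"]
  proof
    assume "first_end N (next_two y) = N"
    then show ?thesis using first_end_le(1)[of N y] by simp
  next
    assume "\<exists>i\<ge>next_two y. block i (first_end N (next_two y))"
    then obtain i where i: "next_two y \<le> i" "block i (first_end N (next_two y))" by blast
    moreover have "y \<le> i" using i(1) next_two_gt[of y] by simp
    ultimately show ?thesis using first_end_le(2) by blast
  qed
  have 2: "first_end N y \<le> chain_end y" if "reach N y"
    using that first_end_le(2)[of y y] assms by (auto simp: reach_iff block_def)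
  have 3: "first_end N (next_two y) \<le> first_end N y \<or> reach N y \<and> chain_end y \<le> first_end N y"
    using first_end_cases[of N y]
  proof
    assume "first_end N y = N"
    then show ?thesis using first_end_le(1) by simp
  next
    assume "\<exists>i\<ge>y. block i (first_end N y)"
    then obtain i where i: "y \<le> i" "block i (first_end N y)" by blast
    show ?thesis
    proof (cases "i = y")
      case True
      then have "chain y (first_end N y)" using i by (simp add: block_def)
      then show ?thesis using chain_end_le first_end_le(1) by (auto simp: reach_def)
    next
      case False
      then have "next_two y \<le> i" using i next_two_le by (simp add: block_def)
      then show ?thesis using i first_end_le(2) by blast
    qed
  qed
  show ?thesis using 1 2 3 by auto
qed

text \<open>For values up to \<open>X\<close>, neither the cap at \<open>N\<close> nor the cut-off
  at \<open>y + 2 * n\<close> is active.\<close>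

lemma first_end_eq_gnext:
  assumes "X < N" "X \<le> y + 2 * n" "first_end N y \<le> X \<or> gnext y \<le> X"
  shows "first_end N y = gnext y"
proof -
  have 1: "gnext y \<le> first_end N y" if "first_end N y \<le> X"
    using first_end_cases[of N y] that assms(1) gnext_le_block by auto
  have 2: "first_end N y \<le> gnext y" if "gnext y \<le> X"
    using gnext_cases[of y] that assms(2) first_end_le(2) by auto
  show ?thesis using 1 2 assms(3) by force
qed

lemma block_shift_mult: "block (i + d * n) (j + d * n) \<longleftrightarrow> block i j"
proof (induction d)
  case (Suc d)
  then show ?case using block_shift[of "i + d * n" "j + d * n"] by (simp add: algebra_simps)
qed simp

text \<open>Some translate of the block starts between \<open>y\<close> and \<open>y + n\<close>,
  hence ends by \<open>y + 2 * n\<close>; this is the origin of the cut-off in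
  \<open>gnext\<close>.\<close>

lemma gnext_le_if_short_block:
  assumes "block i j" "j \<le> i + n"
  shows "gnext y \<le> y + 2 * n"
proof -
  obtain l where j: "j = i + l" "l \<le> n"
    using assms block_less[OF assms(1)] by (metis add_le_cancel_left le_add_diff_inverse less_imp_le)
  have "block (i mod n + (i div n) * n) (i mod n + l + (i div n) * n)"
    using assms(1) j by (simp add: add.commute add.left_commute)
  then have b: "block (i mod n) (i mod n + l)" using block_shift_mult by blast
  \<comment> \<open>The first lap in which the copy of \<open>i\<close> is not before
    \<open>y\<close>.\<close>
  define d where "d = (if i mod n < y mod n then Suc (y div n) else y div n)"
  define i' where "i' = i mod n + d * n"
  have "i mod n + l + d * n = i' + l" by (simp add: i'_def)
  then have "block i' (i' + l)"
    using b block_shift_mult[of "i mod n" d "i mod n + l"] by (simp only: i'_def)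
  moreover have "y \<le> i' \<and> i' \<le> y + n"
  proof -
    define r k where rk: "r = y mod n" "k = (y div n) * n"
    have y: "y = r + k" unfolding rk by simp
    have "i' = (if i mod n < r then i mod n + n + k else i mod n + k)"
      by (simp add: i'_def d_def rk)
    moreover have "i mod n < n" "r < n" using n_pos rk(1) by auto
    ultimately show ?thesis
      unfolding y by (cases "i mod n < r") (simp_all only: if_True if_False, linarith+)
  qed
  ultimately show ?thesis using gnext_le_block[of y i' "i' + l"] j(2) by simp
qed

section \<open>A start on a cycle of the greedy map\<close>

definition into_lap :: "nat \<Rightarrow> nat" where
  "into_lap y = z + (y - z) mod n"

lemma into_lap_bounds: "z \<le> into_lap y" "into_lap y < z + n"
  using n_pos by (auto simp: into_lap_def)

lemma into_lap_eq:
  assumes "z \<le> y"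
  shows "y = into_lap y + ((y - z) div n) * n"
  using assms by (simp add: into_lap_def add.assoc)

lemma into_lap_tw: "z \<le> y \<Longrightarrow> tw (into_lap y) \<longleftrightarrow> tw y"
  using into_lap_eq[of y] tw_shift_mult by metis

text \<open>Among \<open>n\<close> positions, \<open>n + 1\<close> iterates must repeat, so the last
  one lies on the cycle. As \<open>gnext\<close> commutes with shifts by \<open>n\<close>, returning
  to the lap after each step changes the iterates only by multiples of \<open>n\<close>.\<close>

lemma greedy_cycle:
  "\<exists>c W. 1 \<le> c \<and> (gnext ^^ c) (((\<lambda>x. into_lap (gnext x)) ^^ n) z) = ((\<lambda>x. into_lap (gnext x)) ^^ n) z + W * n"
proof -
  define f where "f = (\<lambda>x. into_lap (gnext x))"
  have b: "z \<le> (f ^^ s) x \<and> (f ^^ s) x < z + n" if "z \<le> x" "x < z + n" for s x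
    using that into_lap_bounds by (cases s) (auto simp: f_def)
  have g: "\<exists>W. (gnext ^^ s) x = (f ^^ s) x + W * n" if "z \<le> x" "x < z + n" for s x
  proof (induction s)
    case (Suc s)
    then obtain W where W: "(gnext ^^ s) x = (f ^^ s) x + W * n" by blast
    have "z \<le> gnext ((f ^^ s) x)" using b[OF that, of s] gnext_gt[of "(f ^^ s) x"] by simp
    from into_lap_eq[OF this] have "gnext ((f ^^ s) x) = (f ^^ Suc s) x + ((gnext ((f ^^ s) x) - z) div n) * n"
      by (simp add: f_def)
    then have "(gnext ^^ Suc s) x = (f ^^ Suc s) x + ((gnext ((f ^^ s) x) - z) div n + W) * n"
      by (simp add: W gnext_shift_mult add_mult_distrib)
    then show ?case by blast
  qed (auto intro: exI[of _ 0])
  have z: "z \<le> z" "z < z + n" using n_pos by auto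
  have "(\<lambda>s. (f ^^ s) z) ` {..n} \<subseteq> {z..<z + n}" using b[OF z] by auto
  then have "card ((\<lambda>s. (f ^^ s) z) ` {..n}) \<le> n" using card_mono[of "{z..<z+n}"] by fastforce
  then have "\<not> inj_on (\<lambda>s. (f ^^ s) z) {..n}" using card_image[of "\<lambda>s. (f ^^ s) z" "{..n}"] by force
  then obtain i j where ij: "i < j" "j \<le> n" "(f ^^ i) z = (f ^^ j) z"
    by (auto simp: inj_on_def) (metis linorder_neqE_nat)
  define x where "x = (f ^^ n) z"
  have "(f ^^ (j - i)) x = (f ^^ (j - i + n)) z" by (simp add: x_def funpow_add)
  also have "j - i + n = (n - i) + j" using ij by simp
  also have "(f ^^ \<dots>) z = (f ^^ (n - i + i)) z" using ij(3) by (simp only: funpow_add comp_apply)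
  finally have "(f ^^ (j - i)) x = x" using ij by (simp add: x_def)
  then have "\<exists>W. (gnext ^^ (j - i)) x = x + W * n" using g[of x "j - i"] b[OF z, of n] by (simp add: x_def)
  moreover have "1 \<le> j - i" using ij by simp
  ultimately show ?thesis unfolding x_def f_def by blast
qed

text \<open>The machine can iterate only \<open>first_end\<close>; \<open>start_optimal\<close>
  shows that this agrees with iterating \<open>gnext\<close> as soon as a saving is
  possible.\<close>

definition start :: nat where
  "start = ((\<lambda>x. into_lap (first_end (z + 3 * n) x)) ^^ n) z"

lemma iter_props: "z \<le> ((\<lambda>x. into_lap (first_end (z + 3 * n) x)) ^^ s) z \<and>
   ((\<lambda>x. into_lap (first_end (z + 3 * n) x)) ^^ s) z < z + n \<and> tw (((\<lambda>x. into_lap (first_end (z + 3 * n) x)) ^^ s) z)"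
proof (induction s)
  case (Suc s)
  let ?x = "((\<lambda>x. into_lap (first_end (z + 3 * n) x)) ^^ s) z"
  have "z \<le> first_end (z + 3 * n) ?x" using Suc first_end_gt[of ?x "z + 3 * n"] by simp
  moreover have "tw (first_end (z + 3 * n) ?x)" using first_end_tw tw_shift_mult[of z 3] tw_z by blast
  ultimately show ?case using into_lap_bounds into_lap_tw by simp
qed (use n_pos tw_z in auto)

lemma start_props: "z \<le> start" "start < z + n" "tw start"
  using iter_props[of n] unfolding start_def by blast+

text \<open>With \<open>m \<ge> 1\<close>, the greedy block from the cycle point has length at most
  \<open>n\<close>. Its translates keep the cut-off and the cap out of play, so
  \<open>first_end\<close> and \<open>gnext\<close> agree on the lap.\<close>

lemma start_optimal:
  assumes rate: "\<And>N x. (gnext ^^ (N * m - 1)) x \<le> x + n + N * n" and m: "1 \<le> m"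
  shows "(gnext ^^ m) start \<le> start + n"
proof -
  define x where "x = ((\<lambda>x. into_lap (gnext x)) ^^ n) z"
  have x: "(gnext ^^ m) x \<le> x + n"
    using greedy_cycle cycle_optimal[of m x] rate unfolding x_def by blast
  have "gnext x \<le> x + n" using gpow_mono_exp[OF m, of x] x by simp
  then obtain i where i: "i \<ge> x" "block i (gnext x)" using gnext_cases[of x] n_pos by auto
  then have short: "gnext y \<le> y + 2 * n" for y
    using gnext_le_if_short_block[OF i(2)] \<open>gnext x \<le> x + n\<close> by simp
  have eq: "first_end (z + 3 * n) y = gnext y" if "y < z + n" for y
    using first_end_eq_gnext[of "y + 2 * n" "z + 3 * n" y] short[of y] that by simp
  have "((\<lambda>x. into_lap (first_end (z + 3 * n) x)) ^^ s) z = ((\<lambda>x. into_lap (gnext x)) ^^ s) z" for s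
  proof (induction s)
    case (Suc s)
    then show ?case using eq iter_props[of s] by simp
  qed simp
  then have "start = x" by (simp add: start_def x_def)
  then show ?thesis using x by simp
qed

section \<open>Reading off an optimal set\<close>

text \<open>\<open>W\<close> has been selected on the way from \<open>x0\<close> to \<open>y\<close>. In the last conjunct \<open>m\<close> is a number of greedy
  blocks that fit into the lap, of which \<open>m'\<close> are still ahead; when a chain is running at \<open>y\<close>, they are
  counted from its end \<open>lab y\<close>.\<close>
definition walk_inv :: "nat \<Rightarrow> nat \<Rightarrow> nat set \<Rightarrow> bool" where
  "walk_inv x0 y W \<longleftrightarrow> x0 \<le> y \<and> y \<le> x0 + n \<and> W \<subseteq> {x0..<y} \<and> x0 \<in> insert y W \<and>
     (\<forall>p q. p < q \<and> p \<in> insert y W \<and> q \<in> insert y W \<and> (\<forall>r. p < r \<and> r < q \<longrightarrow> r \<notin> W) \<longrightarrow>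
        q \<le> next_two p \<or> step p q) \<and>
     (tw y \<or> reach (x0 + n) y) \<and>
     (\<forall>m. (gnext ^^ m) x0 \<le> x0 + n \<longrightarrow>
        (\<exists>m'. card W + m \<le> card {v. x0 \<le> v \<and> v < y \<and> tw v} + m' \<and> (gnext ^^ m') (lab y) \<le> x0 + n))"

lemma walk_inv_init: "tw x0 \<Longrightarrow> walk_inv x0 x0 {}"
  by (auto simp: walk_inv_def lab_def) (metis le_add2)

text \<open>Reduces a move to local accounting in \<open>cnt\<close>: selecting \<open>y\<close>
  costs one, the threshold-2 nodes from \<open>y\<close> to before \<open>y'\<close> are credited,
  and the number of blocks ahead changes by the difference.\<close>

lemma walk_inv_advance:
  assumes inv: "walk_inv x0 y W" and y: "y < y'" "y' \<le> x0 + n" and gap: "y' \<le> next_two y \<or> step y y'"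
    and st: "tw y' \<or> reach (x0 + n) y'"
    and cnt: "\<And>m'. (gnext ^^ m') (lab y) \<le> x0 + n \<Longrightarrow>
      \<exists>m''. 1 + m' \<le> card {v. y \<le> v \<and> v < y' \<and> tw v} + m'' \<and> (gnext ^^ m'') (lab y') \<le> x0 + n"
  shows "walk_inv x0 y' (insert y W)"
proof -
  have W: "W \<subseteq> {x0..<y}" "x0 \<le> y" using inv by (auto simp: walk_inv_def)
  have fin: "finite W" "y \<notin> W" using W finite_subset by auto
  have gaps: "q \<le> next_two p \<or> step p q"
    if pq: "p < q" "p \<in> insert y' (insert y W)" "q \<in> insert y' (insert y W)"
      and out: "\<And>r. p < r \<Longrightarrow> r < q \<Longrightarrow> r \<notin> insert y W" for p q
  proof (cases "q = y'")
    case True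
    have "p \<in> insert y W" using pq True by auto
    moreover have "p < y \<Longrightarrow> False" using out[of y] True y by simp
    ultimately have "p = y" using W by force
    then show ?thesis using True gap by simp
  next
    case False
    then have q: "q \<in> insert y W" using pq by simp
    then have "q \<le> y" using W by auto
    then have "p \<in> insert y W" using pq y by auto
    then show ?thesis using inv q pq(1) out unfolding walk_inv_def by blast
  qed
  have cards: "card {v. x0 \<le> v \<and> v < y' \<and> tw v} =
      card {v. x0 \<le> v \<and> v < y \<and> tw v} + card {v. y \<le> v \<and> v < y' \<and> tw v}"
  proof -
    have "{v. x0 \<le> v \<and> v < y' \<and> tw v} = {v. x0 \<le> v \<and> v < y \<and> tw v} \<union> {v. y \<le> v \<and> v < y' \<and> tw v}"
      using W y by auto
    moreover have "finite {v. a \<le> v \<and> v < b \<and> tw v}" for a b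
      by (rule finite_subset[of _ "{..b}"]) auto
    ultimately show ?thesis by (simp add: card_Un_disjoint disjoint_iff)
  qed
  have count: "\<exists>m''. card (insert y W) + m \<le> card {v. x0 \<le> v \<and> v < y' \<and> tw v} + m'' \<and>
      (gnext ^^ m'') (lab y') \<le> x0 + n" if m: "(gnext ^^ m) x0 \<le> x0 + n" for m
  proof -
    obtain m' where m': "card W + m \<le> card {v. x0 \<le> v \<and> v < y \<and> tw v} + m'"
      "(gnext ^^ m') (lab y) \<le> x0 + n"
      using inv m unfolding walk_inv_def by blast
    obtain m'' where m'': "1 + m' \<le> card {v. y \<le> v \<and> v < y' \<and> tw v} + m''"
      "(gnext ^^ m'') (lab y') \<le> x0 + n"
      using cnt[OF m'(2)] by blast
    have "card (insert y W) = Suc (card W)" using fin by simp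
    then show ?thesis using m'(1) m'' cards by (intro exI[of _ m'']) linarith
  qed
  show ?thesis
    unfolding walk_inv_def
  proof (intro conjI allI impI)
    show "x0 \<le> y'" "y' \<le> x0 + n" using W y by simp_all
    show "insert y W \<subseteq> {x0..<y'}" using W y by auto
    show "x0 \<in> insert y' (insert y W)" using inv by (auto simp: walk_inv_def)
    show "tw y' \<or> reach (x0 + n) y'" by (rule st)
  next
    fix p q assume "p < q \<and> p \<in> insert y' (insert y W) \<and> q \<in> insert y' (insert y W) \<and>
      (\<forall>r. p < r \<and> r < q \<longrightarrow> r \<notin> insert y W)"
    then show "q \<le> next_two p \<or> step p q" using gaps by blast
  next
    fix m assume "(gnext ^^ m) x0 \<le> x0 + n"
    then show "\<exists>m'. card (insert y W) + m \<le> card {v. x0 \<le> v \<and> v < y' \<and> tw v} + m' \<and>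
      (gnext ^^ m') (lab y') \<le> x0 + n" by (rule count)
  qed
qed

lemma card_tw_skip:
  assumes "step y y'"
  shows "card {v. y \<le> v \<and> v < y' \<and> tw v} = (if tw y then 2 else 1)"
proof -
  have s: "next_two y < y'" "y' \<le> next_two (next_two y)" using assms by (auto simp: step_def)
  have "v = y \<or> v = next_two y" if "y \<le> v" "v < y'" "tw v" for v
  proof (rule ccontr)
    assume "\<not> ?thesis"
    then have "y < v \<and> v < next_two y \<or> next_two y < v \<and> v < next_two (next_two y)" using that(1,2) s by auto
    then show False using not_tw_before_next_two that(3) by blast
  qed
  then have "{v. y \<le> v \<and> v < y' \<and> tw v} = (if tw y then {y, next_two y} else {next_two y})"
    using s next_two_gt[of y] tw_next_two[of y] by auto
  then show ?thesis using next_two_gt[of y] by simp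
qed

lemma card_tw_next:
  assumes "tw y"
  shows "card {v. y \<le> v \<and> v < next_two y \<and> tw v} = 1"
proof -
  have "{v. y \<le> v \<and> v < next_two y \<and> tw v} = {y}"
    using not_tw_before_next_two[of y] next_two_gt[of y] assms by (auto simp: le_less)
  then show ?thesis by simp
qed

lemma gpow_le_Suc:
  "(gnext ^^ m) y \<le> X \<Longrightarrow> m = 0 \<or> (\<exists>k. m = Suc k \<and> (gnext ^^ k) (gnext y) \<le> X \<and> gnext y \<le> X)"
proof (cases m)
  case (Suc k)
  assume "(gnext ^^ m) y \<le> X"
  then have "(gnext ^^ k) (gnext y) \<le> X" by (simp add: Suc funpow_swap1)
  moreover have "gnext y \<le> (gnext ^^ k) (gnext y)" using gpow_ge[of "gnext y" k] by simp
  ultimately show ?thesis using Suc by auto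
qed simp

text \<open>Three moves. Where the next greedy block starts at \<open>y\<close>, two nodes are
  credited and one block is used up. At another threshold-2 node one is credited, and the blocks
  ahead within the lap are those of \<open>next_two y\<close>. Inside a chain the skipped node pays
  for \<open>y\<close>, and the end stays the same.\<close>

lemma walk_inv_step:
  assumes inv: "walk_inv x0 y W" and y: "y < x0 + n" and x0: "tw x0" and N: "x0 + n < N"
    and two: "tw y \<Longrightarrow> Nxy = first_end N y \<and>
      (if reach N y \<and> chain_end y \<le> first_end N (next_two y) then good y Qy else Qy = next_two y)"
    and one: "\<not> tw y \<Longrightarrow> reach N y \<Longrightarrow> Nxy = chain_end y \<and> good y Qy"
    and y': "y' = (if Nxy \<le> x0 + n then Qy else next_two y)"
  shows "walk_inv x0 y' (insert y W) \<and> y < y'"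
proof -
  define X where "X = x0 + n"
  have twX: "tw X" using tw_shift x0 by (simp add: X_def)
  have x0y: "x0 \<le> y" using inv by (simp add: walk_inv_def)
  have ntX: "next_two y \<le> X" using next_two_le[of y X] y twX by (simp add: X_def)
  have geq: "first_end N u = gnext u" if "y \<le> u" "first_end N u \<le> X \<or> gnext u \<le> X" for u
    using first_end_eq_gnext[of X N u] that N x0y by (simp add: X_def)
  have goodX: "q \<le> X \<and> (tw q \<or> reach X q)" if "good y q" "chain_end y \<le> X" for q
    using good_usable[OF that] by (auto simp: usable_def)
  have goodc: "y < q" "lab q = chain_end y" "step y q" if "good y q" for q
    using that step_gt by (auto simp: good_def)
  consider (a) "tw y" "gnext y \<le> X" "good y y'" "chain_end y = gnext y"
    | (b) "tw y" "y' = next_two y" "gnext y \<le> X \<Longrightarrow> gnext (next_two y) = gnext y"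
    | (c) "\<not> tw y" "chain_end y \<le> X" "good y y'"
  proof (cases "tw y")
    case True
    note t = two[OF True]
    show ?thesis
    proof (cases "first_end N y \<le> X")
      case le: True
      then have g: "first_end N y = gnext y" using geq[of y] by simp
      show ?thesis
      proof (cases "reach N y \<and> chain_end y \<le> first_end N (next_two y)")
        case r: True
        then have "chain_end y = gnext y" using first_end_rec[OF True, of N] g by simp
        then show ?thesis using a True g le t y' r by (auto simp: X_def)
      next
        case r: False
        then have e: "first_end N (next_two y) = first_end N y" using first_end_rec[OF True, of N] by auto
        then have "first_end N (next_two y) = gnext (next_two y)" using geq[of "next_two y"] le next_two_gt[of y] by simp
        then show ?thesis using b True g e le t y' r by (auto simp: X_def)
      qed
    next
      case False
      then have "\<not> gnext y \<le> X" using geq[of y] by auto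
      then show ?thesis using b True False t y' by (auto simp: X_def)
    qed
  next
    case False
    \<comment> \<open>A running chain ends within the lap, so the walk follows it.\<close>
    then have r: "reach X y" using inv by (simp add: walk_inv_def X_def)
    then have "reach N y" using N unfolding reach_def X_def by (meson le_trans less_imp_le)
    then show ?thesis using c one False r y' by (auto simp: reach_iff X_def)
  qed
  then show ?thesis
  proof cases
    case a
    have "walk_inv x0 y' (insert y W)"
    proof (rule walk_inv_advance[OF inv])
      fix m' assume m': "(gnext ^^ m') (lab y) \<le> x0 + n"
      have ly: "lab y = y" using a by (simp add: lab_def)
      have "lab y' = gnext y" using goodc(2) a by simp
      then have "\<exists>m''. 1 + m' \<le> 2 + m'' \<and> (gnext ^^ m'') (lab y') \<le> X"
        using gpow_le_Suc[of m' y X] m' a(2) ly by (auto simp: X_def intro: exI[of _ 0])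
      then show "\<exists>m''. 1 + m' \<le> card {v. y \<le> v \<and> v < y' \<and> tw v} + m'' \<and> (gnext ^^ m'') (lab y') \<le> x0 + n"
        using card_tw_skip[OF goodc(3)[OF a(3)]] a(1) by (simp add: X_def)
    qed (use a goodX goodc in \<open>auto simp: X_def\<close>)
    then show ?thesis using goodc(1) a by simp
  next
    case b
    have "walk_inv x0 y' (insert y W)"
    proof (rule walk_inv_advance[OF inv])
      fix m' assume m': "(gnext ^^ m') (lab y) \<le> x0 + n"
      have ly: "lab y = y" "lab y' = y'" using b tw_next_two by (auto simp: lab_def)
      have "(gnext ^^ m') y' \<le> X"
      proof -
        have "(gnext ^^ m') y \<le> X" using m' ly by (simp add: X_def)
        then consider "m' = 0" | k where "m' = Suc k" "(gnext ^^ k) (gnext y) \<le> X" "gnext y \<le> X"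
          using gpow_le_Suc by blast
        then show ?thesis using ntX b by cases (simp_all add: funpow_swap1)
      qed
      then show "\<exists>m''. 1 + m' \<le> card {v. y \<le> v \<and> v < y' \<and> tw v} + m'' \<and> (gnext ^^ m'') (lab y') \<le> x0 + n"
        using card_tw_next b ly by (auto simp: X_def)
    qed (use b ntX tw_next_two next_two_gt in \<open>auto simp: X_def\<close>)
    then show ?thesis using next_two_gt b by simp
  next
    case c
    have "walk_inv x0 y' (insert y W)"
    proof (rule walk_inv_advance[OF inv])
      fix m' assume m': "(gnext ^^ m') (lab y) \<le> x0 + n"
      have "lab y = lab y'" using c goodc(2) by (simp add: lab_def)
      then show "\<exists>m''. 1 + m' \<le> card {v. y \<le> v \<and> v < y' \<and> tw v} + m'' \<and> (gnext ^^ m'') (lab y') \<le> x0 + n"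
        using card_tw_skip[OF goodc(3)[OF c(3)]] c(1) m' by auto
    qed (use c goodX goodc in \<open>auto simp: X_def\<close>)
    then show ?thesis using goodc(1) c by simp
  qed
qed

section \<open>From the walk back to the ring\<close>

lemma mem_lift_image:
  assumes "W \<subseteq> {x0..<x0 + n}" "x0 \<le> x" "x < x0 + n"
  shows "x \<in> lift_set n ((\<lambda>x. x mod n) ` W) \<longleftrightarrow> x \<in> W"
proof
  assume "x \<in> lift_set n ((\<lambda>x. x mod n) ` W)"
  then obtain y where y: "y \<in> W" "x mod n = y mod n" by (auto simp: lift_set_def)
  have "x0 \<le> y" "y < x0 + n" using y(1) assms(1) by auto
  then have "x = y"
  proof -
    have "n dvd max x y - min x y"
    proof (cases "x \<le> y")
      case True
      then have "n dvd y - x" using y(2) mod_eq_dvd_iff_nat[of x y n] by metis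
      then show ?thesis using True by simp
    next
      case False
      then have "n dvd x - y" using y(2) mod_eq_dvd_iff_nat[of y x n] by (metis nat_le_linear)
      then show ?thesis using False by simp
    qed
    moreover have "max x y - min x y < n" using \<open>x0 \<le> y\<close> \<open>y < x0 + n\<close> assms(2,3) by linarith
    ultimately have "max x y - min x y = 0" using nat_dvd_not_less by blast
    then show ?thesis by linarith
  qed
  then show "x \<in> W" using y by simp
qed (auto simp: lift_set_def)

lemma lift_shift_mult: "x + d * n \<in> lift_set n S \<longleftrightarrow> x \<in> lift_set n S"
  by (simp add: lift_set_def)

lemma gap_shift_mult: "q + d * n \<le> next_two (p + d * n) \<or> step (p + d * n) (q + d * n) \<longleftrightarrow> q \<le> next_two p \<or> step p q"
proof (induction d)
  case (Suc d)
  then show ?case using next_two_shift[of "p + d * n"] step_shift[of "p + d * n" "q + d * n"]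
    by (simp add: algebra_simps)
qed simp

text \<open>The end of the lap is a copy of the selected \<open>x0\<close> and closes the last gap.
  No greedy block fits behind it, so all \<open>m\<close> blocks have been realized.\<close>

lemma walk_inv_final:
  assumes inv: "walk_inv x0 (x0 + n) W" and x0: "tw x0"
  defines "S \<equiv> (\<lambda>x. x mod n) ` W"
  shows "S \<noteq> {}" "S \<subseteq> {..<n}" "(gnext ^^ m) x0 \<le> x0 + n \<Longrightarrow> card S + m \<le> card {v. v < n \<and> tw v}"
    "\<And>p q. p < q \<Longrightarrow> p \<in> lift_set n S \<Longrightarrow> q \<in> lift_set n S \<Longrightarrow>
      (\<And>y. p < y \<Longrightarrow> y < q \<Longrightarrow> y \<notin> lift_set n S) \<Longrightarrow> q \<le> next_two p \<or> step p q"
proof -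
  define X where "X = x0 + n"
  have W: "W \<subseteq> {x0..<x0 + n}" "x0 \<in> W" using inv n_pos by (auto simp: walk_inv_def)
  note mem = mem_lift_image[OF W(1), folded S_def]
  show "S \<noteq> {}" "S \<subseteq> {..<n}" using W n_pos by (auto simp: S_def)
  have "card S \<le> card W"
    unfolding S_def by (rule card_image_le) (use W finite_subset in blast)
  moreover have "card {v. x0 \<le> v \<and> v < X \<and> tw v} = card {v. v < n \<and> tw v}"
  proof -
    have "card {v. x0 \<le> v \<and> v < X \<and> tw v} = card {v. x0 < v \<and> v \<le> X \<and> tw v}"
    proof -
      define M where "M = {v. x0 < v \<and> v < X \<and> tw v}"
      have "{v. x0 \<le> v \<and> v < X \<and> tw v} = insert x0 M" "{v. x0 < v \<and> v \<le> X \<and> tw v} = insert X M"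
        using x0 tw_shift[of x0] n_pos by (auto simp: M_def X_def le_less)
      moreover have "finite M" "x0 \<notin> M" "X \<notin> M"
        using finite_subset[of M "{..X}"] by (auto simp: M_def)
      ultimately show ?thesis by simp
    qed
    then show ?thesis using card_periodic[of tw n x0 1] tw_shift by (simp add: X_def)
  qed
  moreover have "\<exists>m'. card W + m \<le> card {v. x0 \<le> v \<and> v < X \<and> tw v} + m' \<and> (gnext ^^ m') X \<le> X"
    if "(gnext ^^ m) x0 \<le> x0 + n"
    using inv that x0 tw_shift unfolding walk_inv_def by (auto simp: X_def lab_def)
  moreover have "m' = 0" if "(gnext ^^ m') X \<le> X" for m'
    using gpow_ge[of X m'] that by simp
  ultimately show "(gnext ^^ m) x0 \<le> x0 + n \<Longrightarrow> card S + m \<le> card {v. v < n \<and> tw v}"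
    by fastforce
  have core: "q \<le> next_two p \<or> step p q"
    if pq: "p < q" "p \<in> W" "q \<in> lift_set n S"
      and out: "\<And>y. p < y \<Longrightarrow> y < q \<Longrightarrow> y \<notin> lift_set n S" for p q
  proof -
    have p: "x0 \<le> p" "p < X" using pq W by (auto simp: X_def)
    have "X \<in> lift_set n S" using lift_shift_mult[of x0 1] mem[of x0] W n_pos by (simp add: X_def)
    then have "q \<le> X" using out[of X] p by force
    then have q: "q \<in> insert X W" using mem[of q] pq p by (cases "q = X") (auto simp: X_def)
    have "r \<notin> W" if "p < r" "r < q" for r
      using out[OF that] mem[of r] that p \<open>q \<le> X\<close> by (simp add: X_def)
    then show ?thesis using inv pq(1,2) q unfolding walk_inv_def X_def by blast
  qed
  show "q \<le> next_two p \<or> step p q"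
    if pq: "p < q" "p \<in> lift_set n S" "q \<in> lift_set n S"
      and out: "\<And>y. p < y \<Longrightarrow> y < q \<Longrightarrow> y \<notin> lift_set n S" for p q
  proof -
    \<comment> \<open>Every gap is a translate, by \<open>d\<close> laps up or down, of one that
      starts in \<open>W\<close>.\<close>
    obtain p' where p': "p' \<in> W" "p mod n = p' mod n" using pq(2) by (auto simp: lift_set_def S_def)
    show ?thesis
    proof (cases "p \<le> p'")
      case True
      then obtain d where d: "p' = p + d * n"
        using p'(2) by (metis le_add_diff_inverse mod_eq_dvd_iff_nat dvd_div_mult_self)
      have "q + d * n \<le> next_two (p + d * n) \<or> step (p + d * n) (q + d * n)"
      proof (rule core)
        show "p + d * n < q + d * n" "p + d * n \<in> W" "q + d * n \<in> lift_set n S"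
          using pq p' d lift_shift_mult by auto
        show "y \<notin> lift_set n S" if "p + d * n < y" "y < q + d * n" for y
        proof -
          have "y = (y - d * n) + d * n" "p < y - d * n" "y - d * n < q" using that by auto
          then show ?thesis using out lift_shift_mult by metis
        qed
      qed
      then show ?thesis using gap_shift_mult by blast
    next
      case False
      then obtain d where d: "p = p' + d * n"
        using p'(2) by (metis le_add_diff_inverse mod_eq_dvd_iff_nat dvd_div_mult_self nat_le_linear)
      define q' where "q' = q - d * n"
      have q: "q = q' + d * n" using pq(1) d by (simp add: q'_def)
      have "q' \<le> next_two p' \<or> step p' q'"
      proof (rule core)
        show "p' < q'" "p' \<in> W" "q' \<in> lift_set n S"
          using pq p' d q lift_shift_mult by auto
        show "y \<notin> lift_set n S" if "p' < y" "y < q'" for y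
          using out[of "y + d * n"] that d q lift_shift_mult by simp
      qed
      then show ?thesis using gap_shift_mult[of q' d p'] d q by blast
    qed
  qed
qed

end

section \<open>Reasoning about programs\<close>

text \<open>A weakest precondition with step counter: the equations below evaluate straight-line
  code by rewriting.\<close>

definition runs :: "com \<Rightarrow> state \<Rightarrow> (nat \<Rightarrow> state \<Rightarrow> bool) \<Rightarrow> bool" where
  "runs c s Q \<longleftrightarrow> (\<exists>k s'. exec c s k s' \<and> Q k s')"

lemma runs_Const: "runs (Const i c) (R, M) Q \<longleftrightarrow> Q 1 (R(i := c), M)"
  unfolding runs_def exec.simps[of "Const i c"] by simp

lemma runs_Add: "runs (Add i j l) (R, M) Q \<longleftrightarrow> Q 1 (R(i := R j + R l), M)"
  unfolding runs_def exec.simps[of "Add i j l"] by simp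

lemma runs_Sub: "runs (Sub i j l) (R, M) Q \<longleftrightarrow> Q 1 (R(i := R j - R l), M)"
  unfolding runs_def exec.simps[of "Sub i j l"] by simp

lemma runs_Load: "runs (Load i j) (R, M) Q \<longleftrightarrow> 0 \<le> R j \<and> Q 1 (R(i := M (nat (R j))), M)"
  unfolding runs_def exec.simps[of "Load i j"] by simp

lemma runs_Store: "runs (Store i j) (R, M) Q \<longleftrightarrow> 0 \<le> R i \<and> Q 1 (R, M(nat (R i) := R j))"
  unfolding runs_def exec.simps[of "Store i j"] by simp

lemma runs_Seq: "runs (Seq c1 c2) s Q \<longleftrightarrow> runs c1 s (\<lambda>k1 s1. runs c2 s1 (\<lambda>k2 s2. Q (k1 + k2) s2))"
proof -
  have "exec (Seq c1 c2) s k s' \<longleftrightarrow> (\<exists>k1 s1 k2. k = k1 + k2 \<and> exec c1 s k1 s1 \<and> exec c2 s1 k2 s')" for k s'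
    by (subst exec.simps) auto
  then show ?thesis unfolding runs_def by metis
qed

lemma runs_IfPos: "runs (IfPos i c1 c2) (R, M) Q \<longleftrightarrow>
    (if 0 < R i then runs c1 (R, M) (\<lambda>k. Q (k + 1)) else runs c2 (R, M) (\<lambda>k. Q (k + 1)))"
proof -
  have "exec (IfPos i c1 c2) (R, M) k s' \<longleftrightarrow>
      (\<exists>k'. k = k' + 1 \<and> exec (if 0 < R i then c1 else c2) (R, M) k' s')" for k s'
    by (subst exec.simps) auto
  then show ?thesis unfolding runs_def by (cases "0 < R i") auto
qed

lemma nat_add_int: "nat (int a + int b) = a + b"
  by simp

lemmas runs_simps = runs_Const runs_Add runs_Sub runs_Load runs_Store runs_Seq runs_IfPos nat_add_int

definition hoare :: "(state \<Rightarrow> bool) \<Rightarrow> com \<Rightarrow> nat \<Rightarrow> (state \<Rightarrow> bool) \<Rightarrow> bool" where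
  "hoare P c T Q \<longleftrightarrow> (\<forall>s. P s \<longrightarrow> runs c s (\<lambda>k s'. k \<le> T \<and> Q s'))"

lemma hoareI: "(\<And>R M. P (R, M) \<Longrightarrow> runs c (R, M) (\<lambda>k s'. k \<le> T \<and> Q s')) \<Longrightarrow> hoare P c T Q"
  by (auto simp: hoare_def)

lemma hoare_seq:
  assumes "hoare P c1 T1 P'" "hoare P' c2 T2 Q"
  shows "hoare P (Seq c1 c2) (T1 + T2) Q"
  unfolding hoare_def
proof (intro allI impI)
  fix s assume "P s"
  then have "runs c1 s (\<lambda>k s'. k \<le> T1 \<and> P' s')" using assms(1) unfolding hoare_def by blast
  then obtain k1 s1 where 1: "exec c1 s k1 s1" "k1 \<le> T1" "P' s1"
    unfolding runs_def by blast
  have "runs c2 s1 (\<lambda>k s'. k \<le> T2 \<and> Q s')" using assms(2) 1(3) unfolding hoare_def by blast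
  then obtain k2 s2 where 2: "exec c2 s1 k2 s2" "k2 \<le> T2" "Q s2"
    unfolding runs_def by blast
  have "exec (Seq c1 c2) s (k1 + k2) s2" using 1 2 exec.Seq by blast
  then show "runs (Seq c1 c2) s (\<lambda>k s'. k \<le> T1 + T2 \<and> Q s')"
    using 1 2 unfolding runs_def by (meson add_mono)
qed

lemma hoare_weaken:
  assumes "hoare P c T Q" "\<And>s. P' s \<Longrightarrow> P s" "\<And>s. Q s \<Longrightarrow> Q' s" "T \<le> T'"
  shows "hoare P' c T' Q'"
  using assms unfolding hoare_def runs_def by (meson le_trans)

text \<open>\<open>v\<close> is the variant and indexes the invariant. The strict
  \<open>k < C\<close> leaves one step for the guard; the final \<open>+ 1\<close> is the failing
  guard.\<close>

lemma hoare_while: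
  assumes step: "\<And>v R M. I v (R, M) \<Longrightarrow> 0 < R i \<Longrightarrow>
      runs c (R, M) (\<lambda>k s'. k < C \<and> (\<exists>v'<v. I v' s'))"
  shows "hoare (I v) (WhilePos i c) (C * v + 1) (\<lambda>s. (\<exists>v'. I v' s) \<and> \<not> 0 < fst s i)"
proof (rule hoareI)
  fix R M assume "I v (R, M)"
  then show "runs (WhilePos i c) (R, M) (\<lambda>k s'. k \<le> C * v + 1 \<and> (\<exists>v'. I v' s') \<and> \<not> 0 < fst s' i)"
  proof (induction v arbitrary: R M rule: less_induct)
    case (less v)
    show ?case
    proof (cases "0 < R i")
      case True
      from step[OF less.prems True] obtain k1 s1 v' where
        1: "exec c (R, M) k1 s1" "k1 < C" "v' < v" "I v' s1"
        by (auto simp: runs_def)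
      obtain R1 M1 where s1: "s1 = (R1, M1)" by (cases s1)
      have "I v' (R1, M1)" using 1(4) s1 by simp
      from less.IH[OF 1(3) this] obtain k2 s2 where
        2: "exec (WhilePos i c) s1 k2 s2" "k2 \<le> C * v' + 1" "\<exists>v'. I v' s2" "\<not> 0 < fst s2 i"
        unfolding runs_def s1 by blast
      have e: "exec (WhilePos i c) (R, M) (k1 + k2 + 1) s2"
        by (rule exec.WhileTrue[OF True 1(1) 2(1)])
      have "C * Suc v' \<le> C * v" using 1(3) by (intro mult_le_mono2) simp
      then have "k1 + k2 + 1 \<le> C * v + 1" using 1(2) 2(2) by simp
      then show ?thesis unfolding runs_def using e 2(3,4) by blast
    next
      case False
      then have "exec (WhilePos i c) (R, M) 1 (R, M)" by (rule exec.WhileFalse)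
      then show ?thesis unfolding runs_def using False less.prems
        by (intro exI[of _ "1::nat"] exI[of _ "(R, M)"]) auto
    qed
  qed
qed

abbreviation (input) seq (infixr ";;" 60) where "c ;; d \<equiv> Seq c d"

section \<open>The program\<close>

abbreviation (input) "rLen \<equiv> 0 :: nat"
abbreviation (input) "rW \<equiv> 1 :: nat"
abbreviation (input) "rOne \<equiv> 2 :: nat"
abbreviation (input) "rTop \<equiv> 3 :: nat"
abbreviation (input) "rX \<equiv> 4 :: nat"
abbreviation (input) "rA \<equiv> 5 :: nat"
abbreviation (input) "rC \<equiv> 6 :: nat"
abbreviation (input) "bA \<equiv> 7 :: nat"
abbreviation (input) "bX \<equiv> 8 :: nat"
abbreviation (input) "bQ \<equiv> 9 :: nat"
abbreviation (input) "bF \<equiv> 10 :: nat"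
abbreviation (input) "bL \<equiv> 11 :: nat"
abbreviation (input) "rZ \<equiv> 12 :: nat"
abbreviation (input) "rI \<equiv> 13 :: nat"
abbreviation (input) "r1 \<equiv> 14 :: nat"
abbreviation (input) "r2 \<equiv> 15 :: nat"
abbreviation (input) "r3 \<equiv> 16 :: nat"
abbreviation (input) "rLo \<equiv> 17 :: nat"
abbreviation (input) "rHi \<equiv> 18 :: nat"
abbreviation (input) "rV \<equiv> 19 :: nat"
abbreviation (input) "rU \<equiv> 20 :: nat"
abbreviation (input) "rE \<equiv> 21 :: nat"
abbreviation (input) "rQ \<equiv> 22 :: nat"
abbreviation (input) "rLu \<equiv> 23 :: nat"
abbreviation (input) "rLv \<equiv> 24 :: nat"
abbreviation (input) "rS \<equiv> 25 :: nat"
abbreviation (input) "rEnd \<equiv> 26 :: nat"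
abbreviation (input) "rZero \<equiv> 27 :: nat"
abbreviation (input) "skip \<equiv> Const 28 0"

text \<open>With the skipped node \<open>a\<close> in \<open>rA\<close>, the landing window is
  \<open>2a - x\<close> plus or minus \<open>w\<close>, clipped below at \<open>a + 1\<close>. The
  value \<open>N + 1\<close> in \<open>rE\<close>, above every end within \<open>N\<close>, stands
  for no chain.\<close>

definition window_bounds :: com where
  "window_bounds =
     Sub rX rX rOne ;; Add r1 rA rA ;; Sub r1 r1 rX ;;
     Sub rLo r1 rW ;; Add r2 rA rOne ;; Sub r3 r2 rLo ;; IfPos r3 (Add rLo r2 rZero) skip ;;
     Add rHi r1 rW ;; Add rE rTop rOne"

text \<open>The branches realize \<open>window_mid\<close>, \<open>window_end\<close> and
  \<open>window_far\<close>. The last usable node up to \<open>rHi\<close> is \<open>rHi\<close>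
  itself or the usable predecessor of the first usable node after it.\<close>

definition window_min :: com where
  "window_min =
     Sub r1 rC rHi ;;
     IfPos r1
       (Add r1 bF rLo ;; Load rV r1 ;; Add r2 rHi rOne ;; Sub r2 r2 rV ;;
        IfPos r2
          (Add r1 bF rHi ;; Load r3 r1 ;; Add rU rHi rZero ;; Sub r2 r3 rHi ;;
           IfPos r2 (Add r1 bL r3 ;; Load rU r1) skip ;;
           Add r1 bX rU ;; Load rLu r1 ;; Add r1 bX rV ;; Load rLv r1 ;;
           Sub r1 rLv rLu ;;
           IfPos r1 (Add rQ rU rZero ;; Add rE rLu rZero) (Add rQ rV rZero ;; Add rE rLv rZero))
          skip)
       (Add r1 rC rOne ;; Sub r1 r1 rLo ;;
        IfPos r1 (Add rQ rC rZero ;; Add rE rC rZero) skip)"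

text \<open>A usable \<open>x\<close> becomes the backward link of the first usable position
  \<open>rV\<close> after it. At a threshold-2 node the chain from \<open>x\<close> competes with
  the later blocks recorded at \<open>rA\<close>; elsewhere \<open>N + 1 - rE > 0\<close> tests for
  a chain.\<close>

definition record_node :: com where
  "record_node =
     Add r2 rX rOne ;; Add r1 bF r2 ;; Load rV r1 ;;
     Load r1 rX ;; Sub r1 r1 rOne ;;
     IfPos r1
       (Add r2 bX rA ;; Load rLu r2 ;; Sub r2 rE rLu ;;
        IfPos r2 (Add rE rLu rZero ;; Add rQ rA rZero) skip ;;
        Add r2 bX rX ;; Store r2 rE ;; Add r2 bQ rX ;; Store r2 rQ ;;
        Add r2 bA rX ;; Store r2 rA ;;
        Add r2 bL rV ;; Store r2 rX ;; Add r2 bF rX ;; Store r2 rX ;;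
        Add rC rA rZero ;; Add rA rX rZero)
       (Add r2 rTop rOne ;; Sub r2 r2 rE ;;
        IfPos r2
          (Add r2 bX rX ;; Store r2 rE ;; Add r2 bQ rX ;; Store r2 rQ ;;
           Add r2 bL rV ;; Store r2 rX ;; Add r2 bF rX ;; Store r2 rX)
          (Add r2 bF rX ;; Store r2 rV))"

text \<open>Memory layout beyond the thresholds, which are extended periodically to the first \<open>4 n\<close> cells:
  the next threshold-2 node (\<open>BA\<close>), the earliest end of a chain or, at threshold-2 nodes, of a later
  block (\<open>BX\<close>), the next element to select (\<open>BQ\<close>), the first usable position from here on (\<open>BF\<close>), and
  the usable position preceding a usable one (\<open>BL\<close>). The scan starts at \<open>N = z + 3 n\<close>, where \<open>z\<close> is a
  threshold-2 node: a block of length at most \<open>n\<close>, if there is one, has a copy that starts at or after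
  \<open>y < z + n\<close> and ends by \<open>y + 2 n < N\<close>.\<close>
locale ring_program = ring_line n w tw z for n w tw z +
  fixes N BA BX BQ BF BL :: nat
  assumes N: "N = z + 3 * n"
    and lay: "BA = 4 * n" "BX = 8 * n" "BQ = 12 * n" "BF = 16 * n" "BL = 20 * n"
begin

section \<open>Contents of the tables during the scan\<close>

definition frame :: "(nat \<Rightarrow> int) \<Rightarrow> bool" where
  "frame R \<longleftrightarrow> R rLen = int n \<and> R rW = int w \<and> R rOne = 1 \<and> R rTop = int N \<and> R bA = int BA \<and>
     R bX = int BX \<and> R bQ = int BQ \<and> R bF = int BF \<and> R bL = int BL \<and> R rZ = int z \<and> R rZero = 0"

lemma tw_N: "tw N" and N_less: "N < 4 * n"
  using tw_shift_mult[of z 3] tw_z z_less by (auto simp: N)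

lemma usable_N: "usable N N"
  using tw_N by (simp add: usable_def)

definition first_usable :: "nat \<Rightarrow> nat" where
  "first_usable y = (LEAST v. y \<le> v \<and> usable N v)"

lemma first_usable_props:
  assumes "y \<le> N"
  shows "y \<le> first_usable y" "first_usable y \<le> N" "usable N (first_usable y)" "\<And>v. y \<le> v \<Longrightarrow> v < first_usable y \<Longrightarrow> \<not> usable N v"
proof -
  have "y \<le> first_usable y \<and> usable N (first_usable y)"
    unfolding first_usable_def by (rule LeastI[of _ N]) (use assms usable_N in simp)
  then show "y \<le> first_usable y" "usable N (first_usable y)" by auto
  show "first_usable y \<le> N" unfolding first_usable_def by (rule Least_le) (use assms usable_N in simp)
  show "\<not> usable N v" if "y \<le> v" "v < first_usable y" for v
    using not_less_Least[of v "\<lambda>v. y \<le> v \<and> usable N v"] that unfolding first_usable_def by blast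
qed

lemma first_usable_usable: "usable N y \<Longrightarrow> first_usable y = y"
  unfolding first_usable_def by (rule Least_equality) auto

lemma first_usable_not_usable: "\<not> usable N y \<Longrightarrow> first_usable y = first_usable (Suc y)"
proof -
  assume "\<not> usable N y"
  then have "(\<lambda>v. y \<le> v \<and> usable N v) = (\<lambda>v. Suc y \<le> v \<and> usable N v)"
    by (auto simp: Suc_le_eq le_less fun_eq_iff)
  then show ?thesis by (simp add: first_usable_def)
qed

definition tab_t :: "(nat \<Rightarrow> int) \<Rightarrow> bool" where
  "tab_t M \<longleftrightarrow> (\<forall>u<4 * n. M u = (if tw u then 2 else 1))"

definition tab_F :: "nat \<Rightarrow> (nat \<Rightarrow> int) \<Rightarrow> bool" where
  "tab_F x M \<longleftrightarrow> (\<forall>y. x \<le> y \<and> y \<le> N \<longrightarrow> M (BF + y) = int (first_usable y))"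

text \<open>A backward link can be set only when its target is scanned, hence the lower bound is on
  \<open>v\<close>.\<close>

definition tab_L :: "nat \<Rightarrow> (nat \<Rightarrow> int) \<Rightarrow> bool" where
  "tab_L x M \<longleftrightarrow> (\<forall>v f. x \<le> v \<and> v < f \<and> f \<le> N \<and> usable N v \<and> usable N f \<and>
     (\<forall>y. v < y \<and> y < f \<longrightarrow> \<not> usable N y) \<longrightarrow> M (BL + f) = int v)"

definition tab_X :: "nat \<Rightarrow> (nat \<Rightarrow> int) \<Rightarrow> bool" where
  "tab_X x M \<longleftrightarrow> (\<forall>y. x \<le> y \<and> y \<le> N \<and> usable N y \<longrightarrow>
     M (BX + y) = int (if tw y then first_end N y else chain_end y))"

definition succ_ok :: "nat \<Rightarrow> nat \<Rightarrow> bool" where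
  "succ_ok y q \<longleftrightarrow> (if tw y \<and> \<not> (reach N y \<and> chain_end y \<le> first_end N (next_two y)) then q = next_two y else good y q)"

definition tab_Q :: "nat \<Rightarrow> (nat \<Rightarrow> int) \<Rightarrow> bool" where
  "tab_Q x M \<longleftrightarrow> (\<forall>y. x \<le> y \<and> y < N \<and> usable N y \<longrightarrow> (\<exists>q. M (BQ + y) = int q \<and> succ_ok y q))"

definition tab_A :: "nat \<Rightarrow> (nat \<Rightarrow> int) \<Rightarrow> bool" where
  "tab_A x M \<longleftrightarrow> (\<forall>y. x \<le> y \<and> y < N \<and> tw y \<longrightarrow> M (BA + y) = int (next_two y))"

definition tabs :: "nat \<Rightarrow> (nat \<Rightarrow> int) \<Rightarrow> bool" where
  "tabs x M \<longleftrightarrow> tab_F x M \<and> tab_L x M \<and> tab_X x M \<and> tab_Q x M \<and> tab_A x M"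

definition two_from :: "nat \<Rightarrow> nat" where
  "two_from x = (if tw x then x else next_two x)"

text \<open>When the scan turns to \<open>x\<close>, the register \<open>rA\<close> thus holds the
  node that a step from \<open>x\<close> skips.\<close>

lemma two_from_Suc: "two_from (Suc x) = next_two x"
proof -
  have "next_two x = Suc x" if "tw (Suc x)" using next_two_le[of x "Suc x"] next_two_gt[of x] that by simp
  moreover have "next_two (Suc x) = next_two x" if "\<not> tw (Suc x)"
  proof -
    have "next_two x \<noteq> Suc x" using tw_next_two[of x] that by metis
    then show ?thesis using next_two_eq[of x "Suc x"] next_two_gt[of x] by simp
  qed
  ultimately show ?thesis by (auto simp: two_from_def)
qed

text \<open>At \<open>N\<close> the second next threshold-2 node is unknown; storing \<open>N\<close> makes the window empty.\<close>
definition next_c :: "nat \<Rightarrow> nat" where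
  "next_c a = (if a = N then N else next_two a)"

definition scan_inv :: "nat \<Rightarrow> state \<Rightarrow> bool" where
  "scan_inv x s \<longleftrightarrow> (case s of (R, M) \<Rightarrow> x \<le> N \<and> frame R \<and> R rX = int x \<and> R rA = int (two_from x) \<and>
     R rC = int (next_c (two_from x)) \<and> tab_t M \<and> tabs x M)"

text \<open>Truncated subtraction is harmless here: when the integer difference is negative, both
  versions are below \<open>a + 1\<close>.\<close>

lemma window_bounds_runs:
  assumes "frame R" "R rX = int (Suc x)" "R rA = int a" "R rC = int c" "x < a"
  shows "runs window_bounds (R, M) (\<lambda>k (R', M'). k \<le> 11 \<and> M' = M \<and> frame R' \<and> R' rX = int x \<and>
     R' rA = int a \<and> R' rC = int c \<and> R' rLo = int (max (a + 1) (2 * a - x - w)) \<and>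
     R' rHi = int (2 * a + w - x) \<and> R' rE = int N + 1)"
  using assms unfolding window_bounds_def frame_def
  by (simp add: runs_simps)

definition window_res :: "nat \<Rightarrow> (nat \<Rightarrow> int) \<Rightarrow> bool" where
  "window_res x R \<longleftrightarrow> (\<not> reach N x \<and> R rE = int N + 1) \<or>
     (\<exists>q. reach N x \<and> R rE = int (chain_end x) \<and> R rQ = int q \<and> good x q)"

lemma window_min_runs:
  assumes R: "frame R" "R rX = int x" "R rA = int a" "R rC = int c"
    "R rLo = int (max (a + 1) (2 * a - x - w))" "R rHi = int (2 * a + w - x)" "R rE = int N + 1"
    and x: "x < N" "a = next_two x" "c = next_c a" and tabs: "tabs (Suc x) M"
  shows "runs window_min (R, M) (\<lambda>k (R', M'). k \<le> 22 \<and> M' = M \<and> frame R' \<and> R' rX = int x \<and>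
     R' rA = int a \<and> R' rC = int c \<and> window_res x R')"
proof -
  define lo where "lo = max (a + 1) (2 * a - x - w)"
  define hi where "hi = 2 * a + w - x"
  have xa: "x < a" using x next_two_gt by simp
  have aN: "a \<le> N" using x next_two_le[of x N] tw_N by simp
  have hiN: "hi \<ge> a + 1" using xa by (auto simp: hi_def)
  have lohi: "lo \<le> hi" "a < lo" using xa by (auto simp: lo_def hi_def)
  have lo_iff: "lo \<le> q \<longleftrightarrow> next_two x < q \<and> 2 * next_two x \<le> x + q + w" for q
    using x(2) by (auto simp: lo_def)
  note RS = R[folded lo_def hi_def]
  have caN: "c = next_two a \<and> a < N \<and> c \<le> N" if "a \<noteq> N"
    using that aN x next_two_le[of a N] tw_N by (auto simp: next_c_def)
  consider (far) "c \<le> hi" "c < lo" | (endd) "c \<le> hi" "lo \<le> c" | (mid) "hi < c"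
    by linarith
  then show ?thesis
  proof cases
    case far
    have "\<not> reach N x"
    proof (cases "a = N")
      case True
      \<comment> \<open>With \<open>a = N\<close> every landing position is beyond the scanned
        range.\<close>
      have "next_two N \<le> j" if "chain x j" for j
        using chain_gt[OF that] x True by simp
      then show ?thesis using next_two_gt[of N] unfolding reach_def by (meson le_less_trans not_less)
    next
      case False
      then have "\<not> 2 * next_two x \<le> x + next_two (next_two x) + w" using far caN x next_two_gt[of a] lo_iff[of c] by auto
      then show ?thesis by (rule window_far)
    qed
    then have "window_res x R" using R by (simp add: window_res_def)
    then show ?thesis using RS far unfolding window_min_def frame_def
      by (simp add: runs_simps window_res_def)
  next
    case endd
    have aN': "a \<noteq> N" using endd lohi x by (auto simp: next_c_def)
    then have c: "c = next_two (next_two x)" "c \<le> N" using caN x by auto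
    have "2 * next_two x \<le> x + next_two (next_two x) + w" using lo_iff[of c] endd c by simp
    moreover have "x + next_two (next_two x) \<le> 2 * next_two x + w" using endd(1) c(1) x(2) xa unfolding hi_def by linarith
    ultimately have "reach N x \<and> chain_end x = c \<and> good x c" using window_end c by simp
    then show ?thesis using RS endd unfolding window_min_def frame_def
      by (simp add: runs_simps window_res_def)
  next
    case mid
    have aN': "a \<noteq> N" using mid hiN x by (auto simp: next_c_def)
    then have c: "c = next_two (next_two x)" "c \<le> N" using caN x by auto
    define v where "v = first_usable lo"
    define f where "f = first_usable hi"
    have loN: "lo \<le> N" "hi \<le> N" "Suc x \<le> lo" "Suc x \<le> hi" using lohi mid c xa by auto
    note v = first_usable_props[OF loN(1), folded v_def]
    note f = first_usable_props[OF loN(2), folded f_def]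
    have Mv: "M (BF + lo) = int v" "M (BF + hi) = int f"
      using tabs loN by (auto simp: tabs_def tab_F_def v_def f_def)
    have hi_eq: "x + hi = 2 * next_two x + w" using x xa by (simp add: hi_def)
    have hic: "hi < next_two (next_two x)" "next_two (next_two x) \<le> N" using mid c by auto
    note wm = window_mid[OF hi_eq hic lo_iff v(3,1)]
    show ?thesis
    proof (cases "hi < v")
      case True
      then have "\<not> reach N x" using wm(1) v(4) by blast
      then show ?thesis using RS mid True Mv unfolding window_min_def frame_def
        by (simp add: runs_simps window_res_def)
    next
      case False
      define u where "u = (GREATEST u. u \<le> hi \<and> usable N u)"
      have ex: "v \<le> hi \<and> usable N v" using False v by simp
      have u: "u \<le> hi" "usable N u" "\<And>y. u < y \<Longrightarrow> y \<le> hi \<Longrightarrow> \<not> usable N y"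
        using GreatestI_nat[of "\<lambda>u. u \<le> hi \<and> usable N u", OF ex, of hi]
          Greatest_le_nat[of "\<lambda>u. u \<le> hi \<and> usable N u" _ hi] unfolding u_def by (auto simp: leD)
      have "v \<le> hi" using False by simp
      then have w: "reach N x \<and> lo \<le> u \<and> \<not> tw u \<and> \<not> tw v \<and> reach N u \<and> reach N v \<and>
          chain_end x = min (chain_end u) (chain_end v) \<and> (if chain_end u < chain_end v then good x u else good x v)"
        using wm(2)[OF _ _ u(2,1)] v(4) u(3) by blast
      have lou: "lo \<le> u" "\<not> tw u" "\<not> tw v" "Suc x \<le> u" "Suc x \<le> v" "u \<le> N" "v \<le> N"
        using w loN u(1) v(1,2) by auto
      have MX: "M (BX + u) = int (chain_end u)" "M (BX + v) = int (chain_end v)"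
        using tabs lou u v unfolding tabs_def tab_X_def by auto
      have Mf: "M (BL + f) = int u" if "hi < f"
      proof -
        \<comment> \<open>Nothing usable lies between \<open>u\<close> and \<open>hi\<close>, nor
          from \<open>hi\<close> to before \<open>f\<close>; so \<open>u\<close> is the node linked
          from \<open>f\<close>.\<close>
        have "\<not> usable N y" if "u < y" "y < f" for y
          using u(3)[of y] f(4)[of y] that by force
        then show ?thesis using tabs u(1,2) f(2,3) lou(4) that unfolding tabs_def tab_L_def by auto
      qed
      have fu: "f = hi \<Longrightarrow> u = hi" using u f by (metis le_neq_implies_less order_refl)
      show ?thesis
      proof (cases "hi < f")
        case True
        then show ?thesis using RS mid \<open>v \<le> hi\<close> Mv MX Mf[OF True] w unfolding window_min_def frame_def
          by (cases "chain_end u < chain_end v") (simp_all add: runs_simps window_res_def)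
      next
        case False
        then have "f = hi" using f(1) by simp
        then show ?thesis using RS mid \<open>v \<le> hi\<close> Mv MX fu w unfolding window_min_def frame_def
          by (cases "chain_end u < chain_end v") (simp_all add: runs_simps window_res_def)
      qed
    qed
  qed
qed

definition scan_mid :: "nat \<Rightarrow> state \<Rightarrow> bool" where
  "scan_mid x s \<longleftrightarrow> (case s of (R, M) \<Rightarrow> x < N \<and> frame R \<and> R rX = int x \<and> R rA = int (next_two x) \<and>
     R rC = int (next_c (next_two x)) \<and> tab_t M \<and> tabs (Suc x) M \<and> window_res x R)"

lemma scan_front:
  assumes "scan_inv (Suc x) (R, M)"
  shows "runs (window_bounds ;; window_min) (R, M) (\<lambda>k s'. k \<le> 33 \<and> scan_mid x s')"
proof -
  define a where "a = next_two x"
  define c where "c = next_c a"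
  have I: "frame R" "R rX = int (Suc x)" "R rA = int a" "R rC = int c" "x < N" "tab_t M" "tabs (Suc x) M"
    using assms unfolding scan_inv_def two_from_Suc a_def c_def by auto
  have "x < a" using next_two_gt by (simp add: a_def)
  from window_bounds_runs[OF I(1-4) this, of M] obtain k1 R1 where 1:
    "exec window_bounds (R, M) k1 (R1, M)" "k1 \<le> 11" "frame R1" "R1 rX = int x"
    "R1 rA = int a" "R1 rC = int c" "R1 rLo = int (max (a + 1) (2 * a - x - w))"
    "R1 rHi = int (2 * a + w - x)" "R1 rE = int N + 1"
    unfolding runs_def by blast
  from window_min_runs[OF 1(3-9) I(5) a_def c_def I(7)] obtain k2 R2 where 2:
    "exec window_min (R1, M) k2 (R2, M)" "k2 \<le> 22" "frame R2" "R2 rX = int x"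
    "R2 rA = int a" "R2 rC = int c" "window_res x R2"
    unfolding runs_def by blast
  have "exec (window_bounds ;; window_min) (R, M) (k1 + k2) (R2, M)" using 1(1) 2(1) exec.Seq by blast
  moreover have "scan_mid x (R2, M)" using 2 I by (simp add: scan_mid_def a_def c_def)
  ultimately show ?thesis using 1(2) 2(2) unfolding runs_def
    by (intro exI[of _ "k1 + k2"] exI[of _ "(R2, M)"]) auto
qed

text \<open>Each table has \<open>4 * n > N\<close> cells, so the tables are disjoint and each of
  the five cells belongs to one of them only.\<close>

lemma tabs_SucI_usable:
  assumes tabs: "tabs (Suc x) M" and x: "x < N" "usable N x"
    and M': "\<And>i. i \<notin> {BX + x, BQ + x, BA + x, BL + first_usable (Suc x), BF + x} \<Longrightarrow> M' i = M i"
    and F: "M' (BF + x) = int x" and L: "M' (BL + first_usable (Suc x)) = int x"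
    and X: "M' (BX + x) = int (if tw x then first_end N x else chain_end x)"
    and Q: "M' (BQ + x) = int q" "succ_ok x q" and A: "tw x \<Longrightarrow> M' (BA + x) = int (next_two x)"
  shows "tabs x M'"
proof -
  note f = first_usable_props[of "Suc x"]
  have fN: "first_usable (Suc x) \<le> N" "Suc x \<le> first_usable (Suc x)" using f(1,2) x(1) by auto
  have T: "tab_F (Suc x) M" "tab_L (Suc x) M" "tab_X (Suc x) M" "tab_Q (Suc x) M" "tab_A (Suc x) M"
    using tabs by (auto simp: tabs_def)
  have "tab_F x M'"
    unfolding tab_F_def
  proof (intro allI impI)
    fix y assume y: "x \<le> y \<and> y \<le> N"
    show "M' (BF + y) = int (first_usable y)"
    proof (cases "y = x")
      case True
      then show ?thesis using F first_usable_usable x by simp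
    next
      case False
      have "M' (BF + y) = M (BF + y)" by (rule M') (use False y fN N_less lay in auto)
      then show ?thesis using T(1) y False by (simp add: tab_F_def)
    qed
  qed
  moreover have "tab_L x M'"
    unfolding tab_L_def
  proof (intro allI impI, elim conjE)
    fix v g assume v: "x \<le> v" "v < g" "g \<le> N" "usable N v" "usable N g"
      "\<forall>y. v < y \<and> y < g \<longrightarrow> \<not> usable N y"
    show "M' (BL + g) = int v"
    proof (cases "v = x")
      case True
      have "\<not> first_usable (Suc x) < g" using v(6) f(3) fN x(1) True by auto
      moreover have "\<not> g < first_usable (Suc x)" using f(4)[of g] v(2,5) True x(1) by auto
      ultimately have "g = first_usable (Suc x)" by simp
      then show ?thesis using L True by simp
    next
      case False
      \<comment> \<open>\<open>g\<close> lies beyond the relinked node, so its link is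
        untouched.\<close>
      then have "first_usable (Suc x) \<le> v" using f(4)[of v] v(1,4) x(1) by force
      have "M' (BL + g) = M (BL + g)"
        by (rule M') (use \<open>first_usable (Suc x) \<le> v\<close> v fN N_less lay in auto)
      then show ?thesis using T(2) v False by (simp add: tab_L_def)
    qed
  qed
  moreover have "tab_X x M'"
    unfolding tab_X_def
  proof (intro allI impI, elim conjE)
    fix y assume y: "x \<le> y" "y \<le> N" "usable N y"
    show "M' (BX + y) = int (if tw y then first_end N y else chain_end y)"
    proof (cases "y = x")
      case False
      have "M' (BX + y) = M (BX + y)" by (rule M') (use False y fN N_less lay in auto)
      then show ?thesis using T(3) y False by (simp add: tab_X_def)
    qed (use X in simp)
  qed
  moreover have "tab_Q x M'"
    unfolding tab_Q_def
  proof (intro allI impI, elim conjE)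
    fix y assume y: "x \<le> y" "y < N" "usable N y"
    show "\<exists>q. M' (BQ + y) = int q \<and> succ_ok y q"
    proof (cases "y = x")
      case False
      have "M' (BQ + y) = M (BQ + y)" by (rule M') (use False y fN N_less lay in auto)
      then show ?thesis using T(4) y False by (simp add: tab_Q_def)
    qed (use Q in auto)
  qed
  moreover have "tab_A x M'"
    unfolding tab_A_def
  proof (intro allI impI, elim conjE)
    fix y assume y: "x \<le> y" "y < N" "tw y"
    show "M' (BA + y) = int (next_two y)"
    proof (cases "y = x")
      case False
      have "M' (BA + y) = M (BA + y)" by (rule M') (use False y fN N_less lay in auto)
      then show ?thesis using T(5) y False by (simp add: tab_A_def)
    qed (use A y in simp)
  qed
  ultimately show ?thesis by (simp add: tabs_def)
qed

lemma tabs_SucI_unusable: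
  assumes tabs: "tabs (Suc x) M" and x: "x < N" "\<not> usable N x"
    and M': "M' = M(BF + x := int (first_usable (Suc x)))"
  shows "tabs x M'"
proof -
  have ne: "y \<noteq> x" if "usable N y" for y using that x by blast
  have tx: "\<not> tw x" using x by (auto simp: usable_def)
  have T: "tab_F (Suc x) M" "tab_L (Suc x) M" "tab_X (Suc x) M" "tab_Q (Suc x) M" "tab_A (Suc x) M"
    using tabs by (auto simp: tabs_def)
  have other: "BL + y \<noteq> BF + x" "BX + y \<noteq> BF + x" "BQ + y \<noteq> BF + x" "BA + y \<noteq> BF + x" if "y \<le> N" for y
    using that x N_less lay by auto
  have Suc: "Suc x \<le> y" if "x \<le> y" "usable N y" for y using that ne[of y] by auto
  have "tab_F x M'"
    unfolding tab_F_def M'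
  proof (intro allI impI)
    fix y assume y: "x \<le> y \<and> y \<le> N"
    show "(M(BF + x := int (first_usable (Suc x)))) (BF + y) = int (first_usable y)"
    proof (cases "y = x")
      case False
      then have "Suc x \<le> y" using y by simp
      then show ?thesis using T(1) y False by (simp add: tab_F_def)
    qed (simp add: first_usable_not_usable[OF x(2)])
  qed
  moreover have "tab_L x M'" using T(2) Suc other unfolding tab_L_def M' by simp
  moreover have "tab_X x M'" using T(3) Suc other unfolding tab_X_def M' by simp
  moreover have "tab_Q x M'" using T(4) Suc other unfolding tab_Q_def M' by simp
  moreover have "tab_A x M'"
  proof -
    have "Suc x \<le> y" if "x \<le> y" "tw y" for y using that tx by (metis Suc_leI le_neq_implies_less)
    then show ?thesis using T(5) other unfolding tab_A_def M' by simp
  qed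
  ultimately show ?thesis by (simp add: tabs_def)
qed

lemma tab_t_cong:
  assumes "tab_t M" "\<And>i. i < 4 * n \<Longrightarrow> M' i = M i"
  shows "tab_t M'"
  using assms by (simp add: tab_t_def)

lemma record_node_runs:
  assumes "scan_mid x (R, M)"
  shows "runs record_node (R, M) (\<lambda>k s'. k \<le> 24 \<and> scan_inv x s')"
proof -
  define a where "a = next_two x"
  define c where "c = next_c a"
  define f where "f = first_usable (Suc x)"
  have I: "frame R" "R rX = int x" "R rA = int a" "R rC = int c" "x < N" "tab_t M" "tabs (Suc x) M" "window_res x R"
    using assms unfolding scan_mid_def a_def c_def by auto
  note FR = I(1)[unfolded frame_def]
  have xa: "x < a" "a \<le> N" using next_two_gt[of x] next_two_le[of x N] tw_N I(5) by (auto simp: a_def)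
  have fN: "f \<le> N" "Suc x \<le> f" using first_usable_props[of "Suc x"] I(5) by (auto simp: f_def)
  have "tab_F (Suc x) M" using I(7) by (simp add: tabs_def)
  then have Mf: "M (BF + Suc x) = int f"
    using I(5) unfolding tab_F_def f_def by (meson Suc_leI order_refl)
  have addr: "nat (1 + (int BF + int x)) = BF + Suc x" "nat (int BF + (int x + 1)) = BF + Suc x"
    "nat (int BF + (1 + int x)) = BF + Suc x"
    by linarith+
  have Mf': "M (nat (1 + (int BF + int x))) = int f" "M (nat (int BF + (int x + 1))) = int f"
    "M (nat (int BF + (1 + int x))) = int f"
    unfolding addr by (rule Mf)+
  have Mt: "M x = (if tw x then 2 else 1)" using I(5,6) N_less by (simp add: tab_t_def)
  have un: "usable N a" "Suc x \<le> a" using xa tw_next_two by (auto simp: usable_def a_def)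
  have Ma: "M (BX + a) = int (first_end N a)"
    using I(7) xa un tw_next_two[of x] unfolding tabs_def tab_X_def by (simp add: a_def)
  have nxa: "first_end N a \<le> N" by (rule first_end_le)
  have lows: "BX + x \<ge> 4 * n" "BQ + x \<ge> 4 * n" "BA + x \<ge> 4 * n" "BL + f \<ge> 4 * n" "BF + x \<ge> 4 * n"
    using lay by auto
  have dist: "BX + x \<noteq> BQ + x" "BX + x \<noteq> BA + x" "BX + x \<noteq> BL + f" "BX + x \<noteq> BF + x"
     "BQ + x \<noteq> BA + x" "BQ + x \<noteq> BL + f" "BQ + x \<noteq> BF + x" "BA + x \<noteq> BL + f" "BA + x \<noteq> BF + x"
     "BL + f \<noteq> BF + x"
    using lay I(5) fN N_less by auto
  show ?thesis
  proof (cases "tw x")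
    case True
    have us: "usable N x" using True I(5) by (simp add: usable_def)
    have tax: "two_from x = x" "next_c x = a" using True I(5) by (auto simp: two_from_def next_c_def a_def)
    \<comment> \<open>If no chain starts at \<open>x\<close>, the value \<open>N + 1\<close> in
      \<open>rE\<close> exceeds \<open>first_end N a \<le> N\<close>, and the comparison picks the
      later block by itself.\<close>
    obtain e q where eq: "e = first_end N x" "succ_ok x q"
      "if int (first_end N a) < R rE then e = first_end N a \<and> q = a else R rE = int e \<and> R rQ = int q"
    proof (cases "int (first_end N a) < R rE")
      case lt: True
      have "\<not> (reach N x \<and> chain_end x \<le> first_end N (next_two x))"
        using I(8) lt unfolding window_res_def a_def by auto
      then have "first_end N x = first_end N a" "succ_ok x a" using first_end_rec[OF True, of N] True by (auto simp: a_def succ_ok_def)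
      then show ?thesis using that lt by auto
    next
      case False
      then obtain q where q: "reach N x" "R rE = int (chain_end x)" "R rQ = int q" "good x q"
        using I(8) nxa unfolding window_res_def by auto
      moreover have "chain_end x \<le> first_end N (next_two x)" using False q(2) by (simp add: a_def)
      ultimately have "first_end N x = chain_end x" "succ_ok x q" using first_end_rec[OF True, of N] by (auto simp: succ_ok_def)
      then show ?thesis using that False q by auto
    qed
    define M' where "M' = M(BX + x := int e, BQ + x := int q, BA + x := int a, BL + f := int x, BF + x := int x)"
    have "tabs x M'"
      by (rule tabs_SucI_usable[OF I(7,5) us, where q = q])
        (use dist eq True in \<open>auto simp: M'_def f_def[symmetric] a_def\<close>)
    moreover have "tab_t M'" by (rule tab_t_cong[OF I(6)]) (use lows in \<open>auto simp: M'_def\<close>)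
    ultimately have fin: "scan_inv x (R', M')"
      if "frame R'" "R' rX = int x" "R' rA = int x" "R' rC = int a" for R'
      using that I(5) tax by (simp add: scan_inv_def)
    show ?thesis
    proof (cases "int (first_end N a) < R rE")
      case lt: True
      then have e: "e = first_end N a" "q = a" using eq by auto
      have "runs record_node (R, M) (\<lambda>k s'. k \<le> 24 \<and> (case s' of (R', M'') \<Rightarrow>
          M'' = M' \<and> frame R' \<and> R' rX = int x \<and> R' rA = int x \<and> R' rC = int a))"
        using FR I(2,3,4) Mf' Mt True Ma lt unfolding record_node_def M'_def e frame_def
        by (simp add: runs_simps)
      then show ?thesis using fin unfolding runs_def by fastforce
    next
      case False
      then have e: "R rE = int e" "R rQ = int q" using eq by auto
      have "runs record_node (R, M) (\<lambda>k s'. k \<le> 24 \<and> (case s' of (R', M'') \<Rightarrow>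
          M'' = M' \<and> frame R' \<and> R' rX = int x \<and> R' rA = int x \<and> R' rC = int a))"
        using FR I(2,3,4) Mf' Mt True Ma False e unfolding record_node_def M'_def frame_def
        by (simp add: runs_simps)
      then show ?thesis using fin unfolding runs_def by fastforce
    qed
  next
    case False
    have tax: "two_from x = a" using False by (auto simp: two_from_def a_def)
    have us: "usable N x \<longleftrightarrow> reach N x" using False I(5) by (auto simp: usable_def)
    show ?thesis
    proof (cases "reach N x")
      case True
      then obtain q where q: "R rE = int (chain_end x)" "R rQ = int q" "good x q"
        using I(8) unfolding window_res_def by blast
      have cN: "chain_end x \<le> N" using True by (simp add: reach_iff)
      define M' where "M' = M(BX + x := int (chain_end x), BQ + x := int q, BL + f := int x, BF + x := int x)"
      have "tabs x M'"
        by (rule tabs_SucI_usable[OF I(7,5), where q = q])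
          (use dist q True us False in \<open>auto simp: M'_def f_def[symmetric] succ_ok_def\<close>)
      moreover have "tab_t M'" by (rule tab_t_cong[OF I(6)]) (use lows in \<open>auto simp: M'_def\<close>)
      ultimately have fin: "scan_inv x (R', M')"
        if "frame R'" "R' rX = int x" "R' rA = int a" "R' rC = int c" for R'
        using that I(5) tax by (simp add: scan_inv_def c_def)
      have "runs record_node (R, M) (\<lambda>k s'. k \<le> 24 \<and> (case s' of (R', M'') \<Rightarrow>
          M'' = M' \<and> frame R' \<and> R' rX = int x \<and> R' rA = int a \<and> R' rC = int c))"
        using FR I(2,3,4) Mf' Mt False q cN unfolding record_node_def M'_def frame_def
        by (simp add: runs_simps)
      then show ?thesis using fin unfolding runs_def by fastforce
    next
      case nr: False
      then have e: "R rE = int N + 1" using I(8) unfolding window_res_def by blast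
      define M' where "M' = M(BF + x := int f)"
      have "tabs x M'"
        by (rule tabs_SucI_unusable[OF I(7,5)]) (use nr us in \<open>auto simp: M'_def f_def\<close>)
      moreover have "tab_t M'" by (rule tab_t_cong[OF I(6)]) (use lows in \<open>auto simp: M'_def\<close>)
      ultimately have fin: "scan_inv x (R', M')"
        if "frame R'" "R' rX = int x" "R' rA = int a" "R' rC = int c" for R'
        using that I(5) tax by (simp add: scan_inv_def c_def)
      have "runs record_node (R, M) (\<lambda>k s'. k \<le> 24 \<and> (case s' of (R', M'') \<Rightarrow>
          M'' = M' \<and> frame R' \<and> R' rX = int x \<and> R' rA = int a \<and> R' rC = int c))"
        using FR I(2,3,4) Mf' Mt False e unfolding record_node_def M'_def frame_def
        by (simp add: runs_simps)
      then show ?thesis using fin unfolding runs_def by fastforce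
    qed
  qed
qed

end

text \<open>If no node has threshold 2, node 0 is treated as one; the result is then a single node.\<close>
definition find_two :: com where
  "find_two =
     (Const rOne 1 ;; Sub rW rW rOne ;; Const rZ 0 ;; Add rI rLen rZero) ;;
     WhilePos rI
       (Sub rI rI rOne ;; Load r1 rI ;; Sub r1 r1 rOne ;; IfPos r1 (Add rZ rI rZero) skip) ;;
     (Const r1 2 ;; Store rZ r1)"

text \<open>Reads trail writes by \<open>n\<close> cells, so copies are copied again;
  \<open>3 * n\<close> rounds fill the first \<open>4 * n\<close> cells.\<close>

definition extend :: com where
  "extend =
     (Add r2 rLen rLen ;; Add rI r2 rLen ;; Const rX 0 ;; Add rA rLen rZero) ;;
     WhilePos rI
       (Load r1 rX ;; Store rA r1 ;; Add rX rX rOne ;; Add rA rA rOne ;; Sub rI rI rOne)"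

definition setup_tables :: com where
  "setup_tables =
     Add r2 rLen rLen ;; Add bA r2 r2 ;; Add bX bA bA ;; Add bQ bX bA ;; Add bF bQ bA ;; Add bL bF bA ;;
     Add rTop r2 rLen ;; Add rTop rTop rZ ;; Add rX rTop rZero ;; Add rA rTop rZero ;; Add rC rTop rZero ;;
     Add r1 bF rTop ;; Store r1 rTop ;; Add r1 bX rTop ;; Store r1 rTop"

definition scan :: com where
  "scan = WhilePos rX ((window_bounds ;; window_min) ;; record_node)"

text \<open>The machine has no division. Three conditional subtractions of \<open>n\<close> compute
  \<open>into_lap\<close>, since \<open>first_end\<close> is at most
  \<open>z + 3 * n\<close>.\<close>

definition reduce :: com where
  "reduce = Sub r1 rS r2 ;; Add r1 r1 rOne ;; IfPos r1 (Sub rS rS rLen) skip"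

definition iterate :: com where
  "iterate =
     (Add rS rZ rZero ;; Add rI rLen rZero ;; Add r2 rZ rLen) ;;
     WhilePos rI (Add r1 bX rS ;; Load rS r1 ;; reduce ;; reduce ;; reduce ;; Sub rI rI rOne)"

definition clear :: com where
  "clear = (Add rI rLen rZero ;; Const r1 0) ;; WhilePos rI (Sub rI rI rOne ;; Store rI r1)"

text \<open>Two of these reduce modulo \<open>n\<close>, because the walk stays below
  \<open>3 * n\<close>.\<close>

definition wrap :: com where
  "wrap = Sub r3 r2 rLen ;; Add r3 r3 rOne ;; IfPos r3 (Sub r2 r2 rLen) skip"

text \<open>Once no further block ends within the lap, all remaining threshold-2 nodes are selected.\<close>
definition walk :: com where
  "walk =
     (Add rEnd rS rLen ;; Add rX rS rZero ;; Add r1 rLen rZero) ;;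
     WhilePos r1
       (Add r2 rX rZero ;; wrap ;; wrap ;; Store r2 rOne ;;
        Add r3 bX rX ;; Load r3 r3 ;; Add rU rEnd rOne ;; Sub rU rU r3 ;;
        IfPos rU (Add r3 bQ rX) (Add r3 bA rX) ;; Load rX r3 ;; Sub r1 rEnd rX)"

definition ring_solver :: com where
  "ring_solver = find_two ;; extend ;; setup_tables ;; scan ;; iterate ;; clear ;; walk"

section \<open>Correctness and cost of the phases\<close>

lemma find_two_correct:
  assumes n: "n \<ge> 3" and t: "\<And>v. v < n \<Longrightarrow> t v = 1 \<or> t v = 2" and lam: "lam \<ge> 1"
  shows "hoare (\<lambda>s. s = input_state n lam t) find_two (8 * n + 7)
    (\<lambda>s. \<exists>z<n. (t z = 2 \<or> z = 0 \<and> (\<forall>u<n. t u \<noteq> 2)) \<and>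
      fst s rLen = int n \<and> fst s rW = int (lam - 1) \<and> fst s rOne = 1 \<and> fst s rZ = int z \<and> fst s rZero = 0 \<and>
      (\<forall>u<n. snd s u = (if u = z then 2 else int (t u))))"
proof -
  define I :: "nat \<Rightarrow> state \<Rightarrow> bool" where
    "I v s \<longleftrightarrow> (case s of (R, M) \<Rightarrow> \<exists>z<n. v \<le> n \<and> (t z = 2 \<or> z = 0 \<and> (\<forall>u<n. v \<le> u \<longrightarrow> t u \<noteq> 2)) \<and>
      R rLen = int n \<and> R rW = int (lam - 1) \<and> R rOne = 1 \<and> R rZ = int z \<and> R rZero = 0 \<and> R rI = int v \<and>
      (\<forall>u<n. M u = int (t u)))" for v s
  have 1: "hoare (\<lambda>s. s = input_state n lam t)
      (Const rOne 1 ;; Sub rW rW rOne ;; Const rZ 0 ;; Add rI rLen rZero) 4 (I n)"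
    by (rule hoareI) (use n lam in \<open>auto simp: input_state_def runs_simps I_def of_nat_diff\<close>)
  have 2: "hoare (I n) (WhilePos rI
       (Sub rI rI rOne ;; Load r1 rI ;; Sub r1 r1 rOne ;; IfPos r1 (Add rZ rI rZero) skip))
       (8 * n + 1) (\<lambda>s. (\<exists>v. I v s) \<and> \<not> 0 < fst s rI)"
  proof (rule hoare_while)
    fix v R M assume I: "I v (R, M)" "0 < R rI"
    then obtain u where u: "v = Suc u" by (cases v) (auto simp: I_def)
    from I(1) obtain z where z: "z < n" "v \<le> n" "t z = 2 \<or> z = 0 \<and> (\<forall>u<n. v \<le> u \<longrightarrow> t u \<noteq> 2)"
      "R rLen = int n" "R rW = int (lam - 1)" "R rOne = 1" "R rZ = int z" "R rZero = 0" "R rI = int v"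
      "\<forall>u<n. M u = int (t u)"
      by (auto simp: I_def)
    have Mu: "M u = int (t u)" "u < n" using z u by auto
    have nat: "nat (int v - 1) = u" "int v - 1 = int u" "0 < int v" using u by auto
    define z' where "z' = (if t u = 2 then u else z)"
    have z': "z' < n" "t z' = 2 \<or> z' = 0 \<and> (\<forall>u'<n. u \<le> u' \<longrightarrow> t u' \<noteq> 2)"
      using z Mu u by (auto simp: z'_def Suc_le_eq le_less)
    have "runs (Sub rI rI rOne ;; Load r1 rI ;; Sub r1 r1 rOne ;; IfPos r1 (Add rZ rI rZero) skip) (R, M)
      (\<lambda>k s'. k < 8 \<and> I u s')"
      unfolding I_def using z(2,4-10) Mu nat z' t[OF Mu(2)]
      by (cases "t u = 2") (auto simp: runs_simps z'_def)
    then show "runs (Sub rI rI rOne ;; Load r1 rI ;; Sub r1 r1 rOne ;; IfPos r1 (Add rZ rI rZero) skip) (R, M)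
      (\<lambda>k s'. k < 8 \<and> (\<exists>v'<v. I v' s'))"
      using u unfolding runs_def by blast
  qed
  have 3: "hoare (\<lambda>s. (\<exists>v. I v s) \<and> \<not> 0 < fst s rI) (Const r1 2 ;; Store rZ r1) 2
    (\<lambda>s. \<exists>z<n. (t z = 2 \<or> z = 0 \<and> (\<forall>u<n. t u \<noteq> 2)) \<and>
      fst s rLen = int n \<and> fst s rW = int (lam - 1) \<and> fst s rOne = 1 \<and> fst s rZ = int z \<and> fst s rZero = 0 \<and>
      (\<forall>u<n. snd s u = (if u = z then 2 else int (t u))))"
    by (rule hoareI) (auto simp: runs_simps I_def)
  show ?thesis
    unfolding find_two_def by (rule hoare_weaken[OF hoare_seq[OF 1 hoare_seq[OF 2 3]]]) auto
qed

context ring_program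
begin

definition inputs_ok :: "(nat \<Rightarrow> int) \<Rightarrow> bool" where
  "inputs_ok R \<longleftrightarrow> R rLen = int n \<and> R rW = int w \<and> R rOne = 1 \<and> R rZ = int z \<and> R rZero = 0"

lemma extend_correct:
  "hoare (\<lambda>(R, M). inputs_ok R \<and> (\<forall>u<n. M u = (if tw u then 2 else 1))) extend (18 * n + 5)
    (\<lambda>(R, M). inputs_ok R \<and> tab_t M)"
proof -
  define I :: "nat \<Rightarrow> state \<Rightarrow> bool" where
    "I v s \<longleftrightarrow> (case s of (R, M) \<Rightarrow> inputs_ok R \<and> R rI = int v \<and> (\<exists>x. v + x = 3 * n \<and> R rX = int x \<and>
      R rA = int (x + n) \<and> (\<forall>u<x + n. M u = (if tw u then 2 else 1))))" for v s
  let ?body = "Load r1 rX ;; Store rA r1 ;; Add rX rX rOne ;; Add rA rA rOne ;; Sub rI rI rOne"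
  have 1: "hoare (\<lambda>(R, M). inputs_ok R \<and> (\<forall>u<n. M u = (if tw u then 2 else 1)))
      (Add r2 rLen rLen ;; Add rI r2 rLen ;; Const rX 0 ;; Add rA rLen rZero) 4 (I (3 * n))"
    by (rule hoareI) (auto simp: runs_simps I_def inputs_ok_def)
  have 2: "hoare (I (3 * n)) (WhilePos rI ?body) (6 * (3 * n) + 1) (\<lambda>s. (\<exists>v. I v s) \<and> \<not> 0 < fst s rI)"
  proof (rule hoare_while)
    fix v R M assume I: "I v (R, M)" "0 < R rI"
    then obtain u where u: "v = Suc u" by (cases v) (auto simp: I_def)
    from I(1) obtain x where x: "inputs_ok R" "R rI = int v" "v + x = 3 * n" "R rX = int x"
      "R rA = int (x + n)" "\<forall>u<x + n. M u = (if tw u then 2 else 1)"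
      by (auto simp: I_def)
    have "M x = (if tw x then 2 else 1)" using x(6) n_pos by simp
    then have Mx: "M x = (if tw (x + n) then 2 else 1)" by (simp add: tw_shift)
    define M' where "M' = M(x + n := M x)"
    have M': "\<forall>u<Suc x + n. M' u = (if tw u then 2 else 1)"
      using x(6) Mx by (auto simp: M'_def less_Suc_eq)
    have "runs ?body (R, M) (\<lambda>k (R', M''). k < 6 \<and> M'' = M' \<and> inputs_ok R' \<and> R' rI = int u \<and>
        R' rX = int (Suc x) \<and> R' rA = int (Suc x + n))"
      using x(1,2,4,5) u unfolding inputs_ok_def M'_def by (simp add: runs_simps)
    then obtain k R' where "exec ?body (R, M) k (R', M')" "k < 6" "inputs_ok R'" "R' rI = int u"
        "R' rX = int (Suc x)" "R' rA = int (Suc x + n)"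
      unfolding runs_def by blast
    moreover have "u + Suc x = 3 * n" using x(3) u by simp
    ultimately have "I u (R', M')" using M' unfolding I_def by blast
    then show "runs ?body (R, M) (\<lambda>k s'. k < 6 \<and> (\<exists>v'<v. I v' s'))"
      using u \<open>exec ?body (R, M) k (R', M')\<close> \<open>k < 6\<close> unfolding runs_def by blast
  qed
  show ?thesis
    unfolding extend_def
    by (rule hoare_weaken[OF hoare_seq[OF 1 2]]) (auto simp: I_def tab_t_def)
qed

lemma setup_tables_correct:
  "hoare (\<lambda>(R, M). inputs_ok R \<and> tab_t M) setup_tables 15 (scan_inv N)"
proof (rule hoareI)
  fix R M assume "(case (R, M) of (R, M) \<Rightarrow> inputs_ok R \<and> tab_t M)"
  then have A: "inputs_ok R" "tab_t M" by auto
  define M' where "M' = M(BF + N := int N, BX + N := int N)"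
  have dist: "BF + N \<noteq> BX + N" using lay n_pos by simp
  have "tabs N M'"
    using first_usable_usable[OF usable_N] first_end_end[of N] tw_N dist
    unfolding tabs_def tab_F_def tab_L_def tab_X_def tab_Q_def tab_A_def M'_def by auto
  moreover have "tab_t M'" by (rule tab_t_cong[OF A(2)]) (use lay n_pos in \<open>auto simp: M'_def\<close>)
  ultimately have fin: "scan_inv N (R', M')" if "frame R'" "R' rX = int N" "R' rA = int N" "R' rC = int N" for R'
    using that tw_N by (simp add: scan_inv_def two_from_def next_c_def)
  have addr: "nat (16 * int n + (int z + 3 * int n)) = BF + N" "nat (8 * int n + (int z + 3 * int n)) = BX + N"
    "nat (19 * int n + int z) = BF + N" "nat (11 * int n + int z) = BX + N"
    "nat (int z + 19 * int n) = BF + N" "nat (int z + 11 * int n) = BX + N"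
    unfolding lay N by linarith+
  have eqs: "int BA = 4 * int n" "int BX = 8 * int n" "int BQ = 12 * int n" "int BF = 16 * int n"
    "int BL = 20 * int n" "int N = 3 * int n + int z"
    unfolding lay N by simp_all
  have "runs setup_tables (R, M) (\<lambda>k (R', M''). k \<le> 15 \<and> M'' = M' \<and> frame R' \<and> R' rX = int N \<and>
      R' rA = int N \<and> R' rC = int N)"
    using A(1) unfolding setup_tables_def frame_def inputs_ok_def M'_def eqs
    by (simp add: runs_simps addr)
  then show "runs setup_tables (R, M) (\<lambda>k s'. k \<le> 15 \<and> scan_inv N s')"
    using fin unfolding runs_def by blast
qed

lemma scan_correct: "hoare (scan_inv N) scan (58 * N + 1) (\<lambda>(R, M). frame R \<and> tabs 0 M)"
proof -
  have "hoare (scan_inv N) scan (58 * N + 1) (\<lambda>s. (\<exists>x. scan_inv x s) \<and> \<not> 0 < fst s rX)"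
    unfolding scan_def
  proof (rule hoare_while)
    fix v R M assume I: "scan_inv v (R, M)" "0 < R rX"
    then obtain x where x: "v = Suc x" by (cases v) (auto simp: scan_inv_def)
    from scan_front[OF I(1)[unfolded x]] obtain k1 R1 M1 where 1:
      "exec (window_bounds ;; window_min) (R, M) k1 (R1, M1)" "k1 \<le> 33" "scan_mid x (R1, M1)"
      unfolding runs_def by auto
    from record_node_runs[OF 1(3)] obtain k2 s2 where 2:
      "exec record_node (R1, M1) k2 s2" "k2 \<le> 24" "scan_inv x s2"
      unfolding runs_def by blast
    have "exec ((window_bounds ;; window_min) ;; record_node) (R, M) (k1 + k2) s2"
      using 1(1) 2(1) exec.Seq by blast
    \<comment> \<open>At most 33 and 24 steps; one more is left for the guard.\<close>
    moreover have "k1 + k2 < 58" using 1(2) 2(2) by simp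
    ultimately show "runs ((window_bounds ;; window_min) ;; record_node) (R, M)
        (\<lambda>k s'. k < 58 \<and> (\<exists>v'<v. scan_inv v' s'))"
      using 2(3) x unfolding runs_def by blast
  qed
  then show ?thesis by (rule hoare_weaken) (auto simp: scan_inv_def)
qed

definition sub_once :: "nat \<Rightarrow> nat" where
  "sub_once y = (if z + n \<le> y then y - n else y)"

lemma into_lap_eq_sub_once:
  assumes "z \<le> y" "y \<le> z + 3 * n"
  shows "into_lap y = sub_once (sub_once (sub_once y))"
proof -
  define d where "d = y - z"
  have y: "y = z + d" using assms by (simp add: d_def)
  have d: "d \<le> 3 * n" using assms by (simp add: d_def)
  have lt: "sub_once (z + e) = z + e" if "e < n" for e
    using that by (simp add: sub_once_def)
  have ge: "sub_once (z + (n + e)) = z + e" for e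
    by (simp add: sub_once_def)
  define e where "e = d mod n"
  have e: "e < n" "d = d div n * n + e" using n_pos by (simp_all add: e_def)
  have "d div n \<le> 3" using d n_pos by (metis div_le_mono nonzero_mult_div_cancel_right neq0_conv)
  then consider "d = e" | "d = n + e" | "d = n + (n + e)" | "d = n + (n + (n + e))"
    using e(2) by (auto simp: le_Suc_eq numeral_3_eq_3)
  then have "sub_once (sub_once (sub_once y)) = z + e"
    using e(1) unfolding y by cases (simp_all only: lt ge)
  then show ?thesis by (simp add: into_lap_def y e_def)
qed

lemma reduce_runs:
  assumes "frame R" "R r2 = int (z + n)" "R rS = int y"
  shows "runs reduce (R, M) (\<lambda>k (R', M'). k \<le> 4 \<and> M' = M \<and> frame R' \<and> R' r2 = int (z + n) \<and>
    R' rI = R rI \<and> R' rS = int (sub_once y))"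
  using assms unfolding reduce_def frame_def
  by (cases "z + n \<le> y") (simp_all add: runs_simps sub_once_def of_nat_diff)

lemma iterate_correct:
  "hoare (\<lambda>(R, M). frame R \<and> tabs 0 M) iterate (16 * n + 4) (\<lambda>(R, M). frame R \<and> tabs 0 M \<and> R rS = int start)"
proof -
  define g where "g s = ((\<lambda>x. into_lap (first_end (z + 3 * n) x)) ^^ s) z" for s
  define I :: "nat \<Rightarrow> state \<Rightarrow> bool" where
    "I v s \<longleftrightarrow> (case s of (R, M) \<Rightarrow> frame R \<and> tabs 0 M \<and> R rI = int v \<and> R r2 = int (z + n) \<and>
       (\<exists>i. v + i = n \<and> R rS = int (g i)))" for v s
  let ?body = "Add r1 bX rS ;; Load rS r1 ;; reduce ;; reduce ;; reduce ;; Sub rI rI rOne"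
  have 1: "hoare (\<lambda>(R, M). frame R \<and> tabs 0 M) (Add rS rZ rZero ;; Add rI rLen rZero ;; Add r2 rZ rLen) 3 (I n)"
    by (rule hoareI) (auto simp: runs_simps I_def frame_def g_def intro: exI[of _ "0::nat"])
  have 2: "hoare (I n) (WhilePos rI ?body) (16 * n + 1) (\<lambda>s. (\<exists>v. I v s) \<and> \<not> 0 < fst s rI)"
  proof (rule hoare_while)
    fix v R M assume I: "I v (R, M)" "0 < R rI"
    then obtain u where u: "v = Suc u" by (cases v) (auto simp: I_def)
    from I(1) obtain i where i: "frame R" "tabs 0 M" "R rI = int v" "R r2 = int (z + n)" "v + i = n" "R rS = int (g i)"
      by (auto simp: I_def)
    define y where "y = first_end N (g i)"
    have gi: "z \<le> g i" "g i < z + n" "tw (g i)" using iter_props[of i] by (auto simp: g_def)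
    then have giN: "g i < N" by (simp add: N)
    have "usable N (g i)" using gi giN by (simp add: usable_def)
    then have My: "M (BX + g i) = int y"
      using i(2) gi giN by (simp add: tabs_def tab_X_def y_def)
    have y: "z \<le> y" "y \<le> z + 3 * n" using first_end_gt[OF giN] first_end_le(1)[of N "g i"] gi by (auto simp: y_def N)
    have gS: "g (Suc i) = sub_once (sub_once (sub_once y))"
      using into_lap_eq_sub_once[OF y] by (simp add: g_def y_def N)
    have "runs (Add r1 bX rS ;; Load rS r1) (R, M) (\<lambda>k (R', M'). k \<le> 2 \<and> M' = M \<and> frame R' \<and>
        R' r2 = int (z + n) \<and> R' rI = int v \<and> R' rS = int y)"
      using i(1,3,4,6) My unfolding frame_def by (simp add: runs_simps)
    then obtain k0 R0 where 0: "exec (Add r1 bX rS ;; Load rS r1) (R, M) k0 (R0, M)" "k0 \<le> 2" "frame R0"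
        "R0 r2 = int (z + n)" "R0 rI = int v" "R0 rS = int y"
      unfolding runs_def by blast
    from reduce_runs[OF 0(3,4,6), of M] obtain k1 R1 where 1: "exec reduce (R0, M) k1 (R1, M)" "k1 \<le> 4" "frame R1"
        "R1 r2 = int (z + n)" "R1 rI = int v" "R1 rS = int (sub_once y)"
      unfolding runs_def 0(5) by blast
    from reduce_runs[OF 1(3,4,6), of M] obtain k2 R2 where 2: "exec reduce (R1, M) k2 (R2, M)" "k2 \<le> 4" "frame R2"
        "R2 r2 = int (z + n)" "R2 rI = int v" "R2 rS = int (sub_once (sub_once y))"
      unfolding runs_def 1(5) by blast
    from reduce_runs[OF 2(3,4,6), of M] obtain k3 R3 where 3: "exec reduce (R2, M) k3 (R3, M)" "k3 \<le> 4" "frame R3"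
        "R3 r2 = int (z + n)" "R3 rI = int v" "R3 rS = int (g (Suc i))"
      unfolding runs_def 2(5) gS by blast
    define R4 where "R4 = R3(rI := R3 rI - R3 rOne)"
    have 4: "exec (Sub rI rI rOne) (R3, M) 1 (R4, M)" unfolding R4_def by (rule exec.Sub)
    have "I u (R4, M)"
      using 3(3-6) i(2,5) u unfolding I_def R4_def frame_def by (auto intro!: exI[of _ "Suc i"])
    moreover have "runs ?body (R, M) (\<lambda>k s'. k = k0 + (k1 + (k2 + (k3 + 1))) \<and> s' = (R4, M))"
    proof -
      \<comment> \<open>\<open>;;\<close> nests to the right, so the joint run of the first two
        instructions is split again.\<close>
      obtain a s where a: "exec (Add r1 bX rS) (R, M) a s" "exec (Load rS r1) s (k0 - a) (R0, M)" "a \<le> k0"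
        using 0(1) by (subst (asm) exec.simps) auto
      have "exec ?body (R, M) (a + ((k0 - a) + (k1 + (k2 + (k3 + 1))))) (R4, M)"
        by (rule exec.Seq[OF a(1) exec.Seq[OF a(2) exec.Seq[OF 1(1) exec.Seq[OF 2(1) exec.Seq[OF 3(1) 4]]]]])
      then show ?thesis using a(3) unfolding runs_def by auto
    qed
    ultimately show "runs ?body (R, M) (\<lambda>k s'. k < 16 \<and> (\<exists>v'<v. I v' s'))"
      using 0(2) 1(2) 2(2) 3(2) u unfolding runs_def by fastforce
  qed
  show ?thesis
    unfolding iterate_def
    by (rule hoare_weaken[OF hoare_seq[OF 1 2]]) (auto simp: I_def g_def start_def)
qed

text \<open>The output overwrites the thresholds, which is safe because the walk reads only the
  tables.\<close>

lemma tabs_cong: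
  assumes "tabs x M" "\<And>i. 4 * n \<le> i \<Longrightarrow> M' i = M i"
  shows "tabs x M'"
proof -
  have "M' (BF + y) = M (BF + y)" "M' (BL + y) = M (BL + y)" "M' (BX + y) = M (BX + y)"
    "M' (BQ + y) = M (BQ + y)" "M' (BA + y) = M (BA + y)" for y
    using assms(2) lay by auto
  then show ?thesis
    using assms(1) unfolding tabs_def tab_F_def tab_L_def tab_X_def tab_Q_def tab_A_def by simp
qed

lemma clear_correct:
  "hoare (\<lambda>(R, M). frame R \<and> tabs 0 M \<and> R rS = int start) clear (3 * n + 3)
     (\<lambda>(R, M). frame R \<and> tabs 0 M \<and> R rS = int start \<and> (\<forall>u<n. M u = 0))"
proof -
  define I :: "nat \<Rightarrow> state \<Rightarrow> bool" where
    "I v s \<longleftrightarrow> (case s of (R, M) \<Rightarrow> frame R \<and> tabs 0 M \<and> R rS = int start \<and> v \<le> n \<and> R rI = int v \<and> R r1 = 0 \<and>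
       (\<forall>u<n. v \<le> u \<longrightarrow> M u = 0))" for v s
  let ?body = "Sub rI rI rOne ;; Store rI r1"
  have 1: "hoare (\<lambda>(R, M). frame R \<and> tabs 0 M \<and> R rS = int start) (Add rI rLen rZero ;; Const r1 0) 2 (I n)"
    by (rule hoareI) (auto simp: runs_simps I_def frame_def)
  have 2: "hoare (I n) (WhilePos rI ?body) (3 * n + 1) (\<lambda>s. (\<exists>v. I v s) \<and> \<not> 0 < fst s rI)"
  proof (rule hoare_while)
    fix v R M assume I: "I v (R, M)" "0 < R rI"
    then obtain u where u: "v = Suc u" by (cases v) (auto simp: I_def)
    define M' where "M' = M(u := 0)"
    have "tabs 0 M'" by (rule tabs_cong[of _ M]) (use I u in \<open>auto simp: I_def M'_def\<close>)
    moreover have "\<forall>i<n. u \<le> i \<longrightarrow> M' i = 0" using I u by (auto simp: I_def M'_def)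
    ultimately have fin: "I u (R', M')" if "frame R'" "R' rS = int start" "R' rI = int u" "R' r1 = 0" for R'
      using that I(1) u by (simp add: I_def)
    have "runs ?body (R, M) (\<lambda>k (R', M''). k < 3 \<and> M'' = M' \<and> frame R' \<and> R' rS = int start \<and> R' rI = int u \<and> R' r1 = 0)"
      using I(1) u unfolding I_def frame_def M'_def by (simp add: runs_simps)
    then show "runs ?body (R, M) (\<lambda>k s'. k < 3 \<and> (\<exists>v'<v. I v' s'))"
      using fin u unfolding runs_def by blast
  qed
  show ?thesis
    unfolding clear_def
    by (rule hoare_weaken[OF hoare_seq[OF 1 2]]) (auto simp: I_def)
qed

lemma wrap_runs:
  assumes "frame R" "R r2 = int y"
  shows "runs wrap (R, M) (\<lambda>k (R', M'). k \<le> 4 \<and> M' = M \<and> frame R' \<and> R' rX = R rX \<and> R' rEnd = R rEnd \<and>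
    R' r2 = int (if n \<le> y then y - n else y))"
  using assms unfolding wrap_def frame_def
  by (cases "n \<le> y") (simp_all add: runs_simps of_nat_diff)

lemma walk_correct:
  "hoare (\<lambda>(R, M). frame R \<and> tabs 0 M \<and> R rS = int start \<and> (\<forall>u<n. M u = 0)) walk (24 * n + 4)
     (\<lambda>(R, M). \<exists>W. walk_inv start (start + n) W \<and>
        (\<forall>u<n. M u = (if u \<in> (\<lambda>x. x mod n) ` W then 1 else 0)))"
proof -
  define X where "X = start + n"
  have XN: "X < N" "X < 3 * n" using start_props z_less by (auto simp: X_def N)
  define I :: "nat \<Rightarrow> state \<Rightarrow> bool" where
    "I v s \<longleftrightarrow> (case s of (R, M) \<Rightarrow> \<exists>y W. v + y = X \<and> frame R \<and> tabs 0 M \<and> R rEnd = int X \<and> R rX = int y \<and>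
       R r1 = int v \<and> walk_inv start y W \<and> (\<forall>u<n. M u = (if u \<in> (\<lambda>x. x mod n) ` W then 1 else 0)))" for v s
  let ?tail = "Store r2 rOne ;;
        Add r3 bX rX ;; Load r3 r3 ;; Add rU rEnd rOne ;; Sub rU rU r3 ;;
        IfPos rU (Add r3 bQ rX) (Add r3 bA rX) ;; Load rX r3 ;; Sub r1 rEnd rX"
  let ?body = "Add r2 rX rZero ;; wrap ;; wrap ;; ?tail"
  have 1: "hoare (\<lambda>(R, M). frame R \<and> tabs 0 M \<and> R rS = int start \<and> (\<forall>u<n. M u = 0))
      (Add rEnd rS rLen ;; Add rX rS rZero ;; Add r1 rLen rZero) 3 (I n)"
    by (rule hoareI) (use walk_inv_init[OF start_props(3)] in \<open>auto simp: runs_simps I_def frame_def X_def intro!: exI[of _ "{}"]\<close>)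
  have 2: "hoare (I n) (WhilePos r1 ?body) (24 * n + 1) (\<lambda>s. (\<exists>v. I v s) \<and> \<not> 0 < fst s r1)"
  proof (rule hoare_while)
    fix v R M assume I: "I v (R, M)" "0 < R r1"
    from I(1) obtain y W where y: "v + y = X" "frame R" "tabs 0 M" "R rEnd = int X" "R rX = int y" "R r1 = int v"
      "walk_inv start y W" "\<forall>u<n. M u = (if u \<in> (\<lambda>x. x mod n) ` W then 1 else 0)"
      by (auto simp: I_def)
    have yX: "y < X" "y < N" using I(2) y(1,6) XN by auto
    have us: "usable N y"
    proof -
      have "tw y \<or> reach X y" using y(7) by (simp add: walk_inv_def X_def)
      then show ?thesis using yX XN unfolding usable_def reach_def by (meson le_trans less_imp_le)
    qed
    define Nxy where "Nxy = (if tw y then first_end N y else chain_end y)"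
    have MX: "M (BX + y) = int Nxy" using y(3) us yX unfolding tabs_def tab_X_def Nxy_def by auto
    obtain q where q: "M (BQ + y) = int q" "succ_ok y q" using y(3) us yX unfolding tabs_def tab_Q_def by blast
    have MA: "tw y \<Longrightarrow> M (BA + y) = int (next_two y)" using y(3) yX unfolding tabs_def tab_A_def by auto
    define y' where "y' = (if Nxy \<le> X then q else next_two y)"
    have st: "walk_inv start y' (insert y W) \<and> y < y'"
    proof (rule walk_inv_step[OF y(7) _ start_props(3), where N = N and Nxy = Nxy and Qy = q])
      show "y < start + n" "start + n < N" using yX XN by (auto simp: X_def)
      show "Nxy = first_end N y \<and> (if reach N y \<and> chain_end y \<le> first_end N (next_two y) then good y q else q = next_two y)" if "tw y"
        using q that by (auto simp: succ_ok_def Nxy_def split: if_splits)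
      show "Nxy = chain_end y \<and> good y q" if "\<not> tw y" "reach N y"
        using q that by (auto simp: succ_ok_def Nxy_def)
      show "y' = (if Nxy \<le> start + n then q else next_two y)" by (simp add: y'_def X_def)
    qed
    \<comment> \<open>\<open>BA\<close> is filled at threshold-2 nodes only. The walk consults it
      only there, since a running chain ends within the lap.\<close>
    have tail_tw: "tw y" if "\<not> Nxy \<le> X"
      using that y(7) by (auto simp: Nxy_def walk_inv_def X_def reach_iff split: if_splits)
    have y'X: "y' \<le> X" using st by (simp add: walk_inv_def X_def)
    define m where "m = y mod n"
    have mn: "m < n" using n_pos by (simp add: m_def)
    define h where "h x = (if n \<le> x then x - n else x)" for x
    have hm: "h (h y) = m"
    proof -
      have "y < 3 * n" using yX XN by simp
      then consider "y < n" | "n \<le> y" "y < 2 * n" | "2 * n \<le> y" "y < 3 * n" by linarith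
      then show ?thesis
      proof cases
        case 3
        have "y mod n = (y - n) mod n" "(y - n) mod n = (y - n - n) mod n"
          using 3 by (auto simp: le_mod_geq)
        then show ?thesis using 3 by (simp add: h_def m_def)
      qed (auto simp: h_def m_def le_mod_geq)
    qed
    define M' where "M' = M(m := 1)"
    have tabs': "tabs 0 M'" by (rule tabs_cong[OF y(3)]) (use mn in \<open>auto simp: M'_def\<close>)
    have marks: "\<forall>u<n. M' u = (if u \<in> (\<lambda>x. x mod n) ` insert y W then 1 else 0)"
      using y(8) by (auto simp: M'_def m_def)
    have M'X: "M' (BX + y) = int Nxy" "M' (BQ + y) = int q" "tw y \<Longrightarrow> M' (BA + y) = int (next_two y)"
      using MX q(1) MA mn lay by (auto simp: M'_def)
    have fin: "I (X - y') (R', M')"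
      if "frame R'" "R' rEnd = int X" "R' rX = int y'" "R' r1 = int X - int y'" for R'
      unfolding I_def using that tabs' st marks y'X
      by (auto simp: of_nat_diff intro!: exI[of _ y'] exI[of _ "insert y W"])
    define R0 where "R0 = R(r2 := R rX + R rZero)"
    have 0: "exec (Add r2 rX rZero) (R, M) 1 (R0, M)" unfolding R0_def by (rule exec.Add)
    have R0: "frame R0" "R0 r2 = int y" "R0 rX = int y" "R0 rEnd = int X"
      using y(2,4,5) by (auto simp: R0_def frame_def)
    from wrap_runs[OF R0(1,2), of M] obtain k1 R1 where 1: "exec wrap (R0, M) k1 (R1, M)" "k1 \<le> 4" "frame R1"
        "R1 rX = int y" "R1 rEnd = int X" "R1 r2 = int (h y)"
      unfolding runs_def R0(3,4) h_def by blast
    from wrap_runs[OF 1(3,6), of M] obtain k2 R2 where 2: "exec wrap (R1, M) k2 (R2, M)" "k2 \<le> 4" "frame R2"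
        "R2 rX = int y" "R2 rEnd = int X" "R2 r2 = int m"
      unfolding runs_def 1(4,5) hm[unfolded h_def[of "h y"], symmetric] by blast
    have "runs ?tail (R2, M) (\<lambda>k (R', M''). k \<le> 9 \<and> M'' = M' \<and> frame R' \<and> R' rEnd = int X \<and>
        R' rX = int y' \<and> R' r1 = int X - int y')"
    proof (cases "Nxy \<le> X")
      case True
      then have "y' = q" by (simp add: y'_def)
      then show ?thesis using 2(3-6) True M'X(1,2) unfolding frame_def M'_def
        by (simp add: runs_simps)
    next
      case False
      then have "y' = next_two y" by (simp add: y'_def)
      then show ?thesis using 2(3-6) False M'X(1) M'X(3)[OF tail_tw[OF False]] unfolding frame_def M'_def
        by (simp add: runs_simps)
    qed
    then obtain k3 R3 where 3: "exec ?tail (R2, M) k3 (R3, M')" "k3 \<le> 9" "frame R3" "R3 rEnd = int X"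
        "R3 rX = int y'" "R3 r1 = int X - int y'"
      unfolding runs_def by blast
    have "exec ?body (R, M) (1 + (k1 + (k2 + k3))) (R3, M')"
      by (rule exec.Seq[OF 0 exec.Seq[OF 1(1) exec.Seq[OF 2(1) 3(1)]]])
    moreover have "X - y' < v" using st y(1) yX by linarith
    moreover have "1 + (k1 + (k2 + k3)) < 24" using 1(2) 2(2) 3(2) by simp
    ultimately show "runs ?body (R, M) (\<lambda>k s'. k < 24 \<and> (\<exists>v'<v. I v' s'))"
      using fin[OF 3(3-6)] unfolding runs_def by blast
  qed
  show ?thesis
    unfolding walk_def
    by (rule hoare_weaken[OF hoare_seq[OF 1 2]]) (auto simp: I_def X_def)
qed

text \<open>The scan dominates with 58 steps for each of fewer than \<open>4 * n\<close> positions;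
  the other loops add \<open>61 * n\<close>.\<close>

lemma main_part_correct:
  "hoare (\<lambda>(R, M). inputs_ok R \<and> (\<forall>u<n. M u = (if tw u then 2 else 1)))
     (extend ;; setup_tables ;; scan ;; iterate ;; clear ;; walk) (300 * n + 40)
     (\<lambda>(R, M). \<exists>W. walk_inv start (start + n) W \<and>
        (\<forall>u<n. M u = (if u \<in> (\<lambda>x. x mod n) ` W then 1 else 0)))"
  by (rule hoare_weaken[OF hoare_seq[OF extend_correct hoare_seq[OF setup_tables_correct
        hoare_seq[OF scan_correct hoare_seq[OF iterate_correct hoare_seq[OF clear_correct walk_correct]]]]]])
    (use N_less in auto)

end

lemma ring_solver_correct:
  assumes n: "n \<ge> 3" and lam: "lam \<ge> 1" and t: "\<forall>v \<in> ring_nodes n. 1 \<le> t v \<and> t v \<le> 2"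
  shows "\<exists>k s' S. exec ring_solver (input_state n lam t) k s' \<and> k \<le> 308 * n + 47 \<and> outputs n s' S \<and>
    min_twc_target_set (ring_nodes n) (ring_edges n) t lam S"
proof -
  have t12: "t v = 1 \<or> t v = 2" if "v < n" for v
    using t that by (force simp: ring_nodes_def)
  obtain k1 s1 z where 1: "exec find_two (input_state n lam t) k1 s1" "k1 \<le> 8 * n + 7"
    and z: "z < n" "t z = 2 \<or> z = 0 \<and> (\<forall>u<n. t u \<noteq> 2)"
    and s1: "fst s1 rLen = int n" "fst s1 rW = int (lam - 1)" "fst s1 rOne = 1" "fst s1 rZ = int z"
      "fst s1 rZero = 0" "\<forall>u<n. snd s1 u = (if u = z then 2 else int (t u))"
    using find_two_correct[where t = t, OF n t12 lam] unfolding hoare_def runs_def by blast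
  define tw where "tw x \<longleftrightarrow> (t(z := 2)) (x mod n) = 2" for x
  define w where "w = lam - 1"
  interpret ring_program n w tw z "z + 3 * n" "4 * n" "8 * n" "12 * n" "16 * n" "20 * n"
    by unfold_locales (use z in \<open>auto simp: tw_def\<close>)
  have "\<forall>u<n. snd s1 u = (if tw u then 2 else 1)"
    using s1(6) t12 by (auto simp: tw_def)
  then have "(\<lambda>(R, M). inputs_ok R \<and> (\<forall>u<n. M u = (if tw u then 2 else 1))) s1"
    using s1(1-5)[folded w_def] by (simp add: inputs_ok_def case_prod_unfold)
  then obtain k2 s2 where 2: "exec (extend ;; setup_tables ;; scan ;; iterate ;; clear ;; walk) s1 k2 s2"
    "k2 \<le> 300 * n + 40" "(\<lambda>(R, M). \<exists>W. walk_inv start (start + n) W \<and>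
        (\<forall>u<n. M u = (if u \<in> (\<lambda>x. x mod n) ` W then 1 else 0))) s2"
    using main_part_correct unfolding hoare_def runs_def by blast
  then obtain W where W: "walk_inv start (start + n) W"
    "\<forall>u<n. snd s2 u = (if u \<in> (\<lambda>x. x mod n) ` W then 1 else 0)"
    by (auto simp: case_prod_unfold)
  define S where "S = (\<lambda>x. x mod n) ` W"
  note fin = walk_inv_final[OF W(1) start_props(3), folded S_def]
  have run: "exec ring_solver (input_state n lam t) (k1 + k2) s2"
    unfolding ring_solver_def by (rule exec.Seq[OF 1(1) 2(1)])
  have Sn: "S \<subseteq> ring_nodes n" using fin(2) by (auto simp: ring_nodes_def)
  have out: "outputs n s2 S" using Sn W(2) by (simp add: outputs_def S_def)
  have spread: "ring_spread n lam t S'" if "S' \<subseteq> ring_nodes n" for S'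
    using n lam t12 that by unfold_locales auto
  have two: "ring_spread.two n t x \<longleftrightarrow> t (x mod n) = 2" for x
    using ring_spread.two_def[OF spread[OF Sn]] by simp
  \<comment> \<open>Without threshold-2 nodes, \<open>tw\<close> holds only at the copies of the
    artificial \<open>z\<close>, and every gap is good for the real thresholds.\<close>
  have cases: "ring_spread.two n t = tw \<or> (\<forall>x. \<not> ring_spread.two n t x) \<and> card {v. v < n \<and> tw v} = 1"
  proof (cases "t z = 2")
    case True
    then have "t(z := 2) = t" by auto
    then show ?thesis by (auto simp: two tw_def fun_eq_iff)
  next
    case False
    then have "t u \<noteq> 2" if "u < n" for u using z(2) that by blast
    then have "{v. v < n \<and> tw v} = {z}" "\<not> ring_spread.two n t x" for x
      using z(1) n_pos by (auto simp: two tw_def)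
    then show ?thesis by simp
  qed
  have target: "twc_target_set (ring_nodes n) (ring_edges n) t lam S"
    unfolding ring_spread.target_iff[OF spread[OF Sn]] w_def[symmetric]
  proof (intro conjI allI impI)
    fix p q assume a: "p < q \<and> p \<in> lift_set n S \<and> q \<in> lift_set n S \<and>
      (\<forall>y. p < y \<and> y < q \<longrightarrow> y \<notin> lift_set n S)"
    show "gap_ok (ring_spread.two n t) w p q"
      using cases
    proof
      assume e: "ring_spread.two n t = tw"
      have "q \<le> next_two p \<or> step p q" by (rule fin(4)) (use a in auto)
      then show ?thesis using gap_ok_iff[of p q] a e by simp
    next
      assume "(\<forall>x. \<not> ring_spread.two n t x) \<and> card {v. v < n \<and> tw v} = 1"
      then show ?thesis by (simp add: gap_ok_def)
    qed
  qed (rule fin(1))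
  have "card S \<le> card S'" if S': "twc_target_set (ring_nodes n) (ring_edges n) t lam S'" for S'
  proof -
    have S'n: "S' \<subseteq> ring_nodes n" using S' by (simp add: twc_target_set_def)
    note T = S'[unfolded ring_spread.target_iff[OF spread[OF S'n]] w_def[symmetric]]
    have fS': "finite S'" using S'n finite_subset by (auto simp: ring_nodes_def)
    \<comment> \<open>Zero greedy blocks always fit, so the result never exceeds the number of
      \<open>tw\<close> nodes in a lap; this settles every competitor that saves nothing.\<close>
    have le: "card S \<le> card {v. v < n \<and> tw v}" using fin(3)[of 0] by simp
    from cases show ?thesis
    proof
      assume e: "ring_spread.two n t = tw"
      show ?thesis
      proof (cases "card {v. v < n \<and> tw v} \<le> card S'")
        case True
        then show ?thesis using le by simp
      next
        case False
        define m where "m = card {v. v < n \<and> tw v} - card S'"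
        have "{x. x < n \<and> x \<in> lift_set n S'} = S'"
          using S'n by (auto simp: lift_set_def ring_nodes_def)
        then have m: "card {x. x < n \<and> tw x} = card {x. x < n \<and> x \<in> lift_set n S'} + m" "1 \<le> m"
          using False by (auto simp: m_def)
        have "(gnext ^^ (N * m - 1)) x \<le> x + n + N * n" for N x
        proof (rule greedy_rate[where L = "lift_set n S'"])
          show "q \<le> next_two p \<or> step p q" if "p < q" "p \<in> lift_set n S'" "q \<in> lift_set n S'"
            "\<And>y. p < y \<Longrightarrow> y < q \<Longrightarrow> y \<notin> lift_set n S'" for p q
            using T that gap_ok_iff[OF that(1)] e by metis
          show "x + n \<in> lift_set n S' \<longleftrightarrow> x \<in> lift_set n S'" for x by (simp add: lift_set_def)
          show "lift_set n S' \<noteq> {}"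
          proof -
            obtain s where s: "s \<in> S'" using T by blast
            then have "s mod n = s" using S'n by (auto simp: ring_nodes_def)
            then have "s \<in> lift_set n S'" using s by (simp add: lift_set_def)
            then show ?thesis by blast
          qed
        qed (rule m)+
        then have "(gnext ^^ m) start \<le> start + n" by (rule start_optimal) (rule m(2))
        then have "card S + m \<le> card {v. v < n \<and> tw v}" by (rule fin(3))
        then show ?thesis using False by (simp add: m_def)
      qed
    next
      assume "(\<forall>x. \<not> ring_spread.two n t x) \<and> card {v. v < n \<and> tw v} = 1"
      moreover have "1 \<le> card S'" using T fS' by (simp add: Suc_le_eq card_gt_0_iff)
      ultimately show ?thesis using le by simp
    qed
  qed
  then have "min_twc_target_set (ring_nodes n) (ring_edges n) t lam S"
    using target by (simp add: min_twc_target_set_def)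
  moreover have "k1 + k2 \<le> 308 * n + 47" using 1(2) 2(2) by simp
  ultimately show ?thesis using run out by blast
qed

theorem theorem3:
  "\<exists>(P :: com) (f :: nat \<Rightarrow> nat).
     (\<lambda>n. real (f n)) \<in> O(\<lambda>n. real n) \<and>
     (\<forall>(n :: nat) (lam :: nat) (t :: nat \<Rightarrow> nat).
        n \<ge> 3 \<longrightarrow> lam \<ge> 1 \<longrightarrow> (\<forall>v \<in> ring_nodes n. 1 \<le> t v \<and> t v \<le> 2) \<longrightarrow>
        (\<exists>k s' S. exec P (input_state n lam t) k s' \<and> k \<le> f n \<and> outputs n s' S \<and>
           min_twc_target_set (ring_nodes n) (ring_edges n) t lam S))"
proof (intro exI[of _ ring_solver] exI[of _ "\<lambda>n. 308 * n + 47"] conjI allI impI)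
  have "eventually (\<lambda>n. norm (real (308 * n + 47)) \<le> 355 * norm (real n)) sequentially"
    \<comment> \<open>355 is 308 + 47, with the constant term absorbed for
      \<open>n \<ge> 1\<close>.\<close>
    using eventually_ge_at_top[of 1] by eventually_elim simp
  then show "(\<lambda>n. real (308 * n + 47)) \<in> O(\<lambda>n. real n)"
    by (rule bigoI)
qed (rule ring_solver_correct)

end
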